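(* Let $G$ be a countable discrete abelian group and $\alpha\colon G\curvearrowright A$ an action on a separable $C^*$-algebra. Suppose that $\alpha$ has the abelian Rokhlin property. Then every densely defined lower semicontinuous trace $\theta$ on $A\rtimes_\alpha G$ factors through the canonical conditional expectation $E\colon A\rtimes_\alpha G\to A$, i.e. $\theta(x)=\theta(E(x))$ for all positive $x\in A\rtimes_\alpha G$.
   Context: For a separable $C^*$-algebra $A$, put $A_\infty=\ell^\infty(\mathbb{N},A)/c_0(\mathbb{N},A)$, with $A\subseteq A_\infty$ as constant sequences; $A_\infty\cap A'$ is the relative commutant of $A$ in $A_\infty$, $A_\infty\cap A^\perp=\{x\in A_\infty: ax=xa=0\ \forall a\in A\}$, and $F_\infty(A)=(A_\infty\cap A')/(A_\infty\cap A^\perp)$ (a unital $C^*$-algebra). An action $\alpha\colon G\curvearrowright A$ induces, by componentwise application, an action $\widetilde{\alpha}_\infty$ of $G$ on $F_\infty(A)$. Abelian Rokhlin property: $\alpha$ has the abelian Rokhlin property if for every $\chi\in\widehat{G}$ (the Pontryagin dual) there is a unitary $u\in F_\infty(A)$ with $\widetilde{\alpha}_{\infty,g}(u)=\chi(g)u$ for all $g\in G$. Traces here are tracial weights $\theta\colon B_+\to[0,\infty]$ (additive, positively homogeneous, $\theta(x^*x)=\theta(xx^* )$); $\theta$ is densely defined if $\{x\in B_+:\theta(x)<\infty\}$ is dense in $B_+$, and lower semicontinuous with respect to the norm. As $G$ is discrete, $A$ is canonically a subalgebra of $A\rtimes_\alpha G$, and $E$ satisfies $E(a\lambda_g)=a$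 if $g$ is the neutral element and $0$ otherwise. *)

theory Defs
  imports "HOL-Analysis.Analysis" "HOL-Library.Poly_Mapping"
begin

section \<open>C*-algebras\<close>

class scaleC =
  fixes scaleC :: "complex \<Rightarrow> 'a \<Rightarrow> 'a" (infixr "*\<^sub>C" 75)

class star =
  fixes star :: "'a \<Rightarrow> 'a"

text \<open>Complex associative *-algebras, not necessarily unital.\<close>

class star_algebra = ring + scaleC + star +
  assumes scaleC_add_right: "c *\<^sub>C (x + y) = c *\<^sub>C x + c *\<^sub>C y"
    and scaleC_add_left: "(c + d) *\<^sub>C x = c *\<^sub>C x + d *\<^sub>C x"
    and scaleC_scaleC: "c *\<^sub>C d *\<^sub>C x = (c * d) *\<^sub>C x"
    and scaleC_one: "1 *\<^sub>C x = x"
    and mult_scaleC_left: "(c *\<^sub>C x) * y = c *\<^sub>C (x * y)"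
    and mult_scaleC_right: "x * (c *\<^sub>C y) = c *\<^sub>C (x * y)"
    and star_star: "star (star x) = x"
    and star_add: "star (x + y) = star x + star y"
    and star_mult: "star (x * y) = star y * star x"
    and star_scaleC: "star (c *\<^sub>C x) = cnj c *\<^sub>C star x"

class cstar_algebra = star_algebra + banach + real_normed_algebra +
  assumes scaleR_eq_scaleC: "r *\<^sub>R x = complex_of_real r *\<^sub>C x"
    and norm_scaleC: "norm (c *\<^sub>C x) = cmod c * norm x"
    and norm_star_mult_self: "norm (star x * x) = (norm x)\<^sup>2"

text \<open>
  Unitaries of a unital *-algebra. The unit is not a class parameter, so it is described by its
  defining property; no element is unitary if there is no unit.
\<close>

definition is_unit_element :: "'a::star_algebra \<Rightarrow> bool" where
  "is_unit_element e \<longleftrightarrow> (\<forall>x. e * x = x \<and> x * e = x)"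

definition unitary :: "'a::star_algebra \<Rightarrow> bool" where
  "unitary u \<longleftrightarrow> is_unit_element (star u * u) \<and> is_unit_element (u * star u)"

text \<open>In a C*-algebra these are the self-adjoint elements with spectrum in \<open>[0, \<infinity>)\<close>.\<close>

definition positive_cone :: "'a::star_algebra set" where
  "positive_cone = range (\<lambda>y. star y * y)"

definition star_homomorphism :: "('a::star_algebra \<Rightarrow> 'b::star_algebra) \<Rightarrow> bool" where
  "star_homomorphism \<phi> \<longleftrightarrow>
     (\<forall>x y. \<phi> (x + y) = \<phi> x + \<phi> y) \<and> (\<forall>c x. \<phi> (c *\<^sub>C x) = c *\<^sub>C \<phi> x) \<and>
     (\<forall>x y. \<phi> (x * y) = \<phi> x * \<phi> y) \<and> (\<forall>x. \<phi> (star x) = star (\<phi> x))"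

definition star_automorphism :: "('a::star_algebra \<Rightarrow> 'a) \<Rightarrow> bool" where
  "star_automorphism \<phi> \<longleftrightarrow> star_homomorphism \<phi> \<and> bij \<phi>"

definition group_action :: "('g::ab_group_add \<Rightarrow> 'a::star_algebra \<Rightarrow> 'a) \<Rightarrow> bool" where
  "group_action \<alpha> \<longleftrightarrow>
     (\<forall>g. star_automorphism (\<alpha> g)) \<and> \<alpha> 0 = id \<and> (\<forall>g h. \<alpha> (g + h) = \<alpha> g \<circ> \<alpha> h)"

lemma scaleC_zero_left [simp]: "0 *\<^sub>C (x::'a::star_algebra) = 0"
  using scaleC_add_left[of 0 0 x] by simp

lemma scaleC_zero_right [simp]: "c *\<^sub>C (0::'a::star_algebra) = 0"
  using scaleC_add_right[of c 0 "0::'a"] by simp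

lemma scaleC_minus_right: "c *\<^sub>C (- x) = - (c *\<^sub>C (x::'a::star_algebra))"
  using scaleC_add_right[of c x "- x"] by (simp add: eq_neg_iff_add_eq_0 add.commute)

lemma scaleC_diff_right: "c *\<^sub>C (x - y) = c *\<^sub>C x - c *\<^sub>C (y::'a::star_algebra)"
  using scaleC_add_right[of c x "- y"] by (simp add: scaleC_minus_right)

lemma scaleC_minus_one: "(- 1) *\<^sub>C x = - (x::'a::star_algebra)"
  using scaleC_add_left[of 1 "- 1" x] by (simp add: scaleC_one eq_neg_iff_add_eq_0 add.commute)

lemma star_zero [simp]: "star (0::'a::star_algebra) = 0"
  using star_add[of 0 "0::'a"] by simp

lemma star_minus: "star (- x) = - star (x::'a::star_algebra)"
  using star_add[of x "- x"] by (simp add: eq_neg_iff_add_eq_0 add.commute)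

lemma star_diff: "star (x - y) = star x - star (y::'a::star_algebra)"
  using star_add[of x "- y"] by (simp add: star_minus)

lemma norm_star [simp]: "norm (star x) = norm (x::'a::cstar_algebra)"
proof -
  have le: "norm y \<le> norm (star y)" for y :: 'a
  proof (cases "norm y = 0")
    case False
    have "norm y * norm y \<le> norm (star y) * norm y"
      using norm_mult_ineq[of "star y" y] by (simp add: norm_star_mult_self power2_eq_square)
    then show ?thesis using False by simp
  qed simp
  show ?thesis using le[of x] le[of "star x"] by (simp add: star_star)
qed

text \<open>
  For a self-adjoint \<open>x\<close> of norm less than \<open>1\<close> the fixed point \<open>s\<close> below is
  \<open>1 - sqrt (1 - x * x)\<close>; then \<open>x + i (1 - s)\<close> is a unitary in the unitization of \<open>A\<close>
  with real part \<open>x\<close>, which forces \<open>p x \<le> 1\<close>.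
\<close>

lemma unitary_dilation:
  fixes x :: "'a::cstar_algebra"
  assumes sa: "star x = x" and lt: "norm x < 1"
  shows "\<exists>s. star s = s \<and> s * x = x * s \<and> s + s = x * x + s * s"
proof -
  define z where "z = x * x"
  have z1: "norm z < 1"
  proof -
    have "norm z \<le> norm x * norm x" unfolding z_def by (rule norm_mult_ineq)
    also have "\<dots> < 1 * 1" using lt by (intro mult_strict_mono') auto
    also have "\<dots> = (1::real)" by simp
    finally show ?thesis .
  qed
  define r where "r = 1 - sqrt (1 - norm z)"
  have r: "0 \<le> r" "r < 1" "norm z + r * r = 2 * r"
  proof -
    have sq: "sqrt (1 - norm z) * sqrt (1 - norm z) = 1 - norm z" using z1 by simp
    show "0 \<le> r" using z1 by (simp add: r_def)
    show "r < 1" using z1 by (simp add: r_def)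
    have "r * r = 1 - 2 * sqrt (1 - norm z) + sqrt (1 - norm z) * sqrt (1 - norm z)"
      by (simp add: r_def algebra_simps)
    then show "norm z + r * r = 2 * r" unfolding sq by (simp add: r_def)
  qed
  define S where "S = {s. norm s \<le> r \<and> star s = s \<and> s * x = x * s}"
  define f where "f s = (1/2) *\<^sub>R (z + s * s)" for s
  have cont_star: "continuous_on UNIV (star :: 'a \<Rightarrow> 'a)"
    unfolding continuous_on_iff
    by (metis dist_norm norm_star star_diff)
  have "closed S"
  proof -
    have "S = {s. norm s \<le> r} \<inter> {s. star s = s} \<inter> {s. s * x = x * s}" by (auto simp: S_def)
    moreover have "closed {s::'a. norm s \<le> r}" by (intro closed_Collect_le continuous_intros)
    moreover have "closed {s::'a. star s = s}"
      by (intro closed_Collect_eq cont_star continuous_intros)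
    moreover have "closed {s. s * x = x * s}" by (intro closed_Collect_eq continuous_intros)
    ultimately show ?thesis by (simp add: closed_Int)
  qed
  then have "complete S" by (simp add: complete_eq_closed)
  moreover have "S \<noteq> {}" using r by (auto simp: S_def intro!: exI[of _ 0])
  moreover have "f ` S \<subseteq> S"
  proof clarify
    fix s assume s: "s \<in> S"
    have "norm (s * s) \<le> r * r"
      using norm_mult_ineq[of s s] s r(1) by (smt (verit) S_def mem_Collect_eq mult_mono norm_ge_zero)
    then have "norm (z + s * s) \<le> 2 * r"
      using norm_triangle_ineq[of z "s * s"] r(3) by linarith
    then have "norm (f s) \<le> r" by (simp add: f_def)
    moreover have "star (f s) = f s"
      using s sa by (simp add: f_def S_def scaleR_eq_scaleC star_scaleC star_add star_mult z_def)
    moreover have "f s * x = x * f s"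
    proof -
      have "s * x = x * s" using s by (simp add: S_def)
      then have "s * s * x = x * (s * s)" by (metis mult.assoc)
      then show ?thesis by (simp add: f_def z_def distrib_left distrib_right mult.assoc)
    qed
    ultimately show "f s \<in> S" by (simp add: S_def)
  qed
  moreover have "dist (f s) (f t) \<le> r * dist s t" if "s \<in> S" "t \<in> S" for s t
  proof -
    have "f s - f t = (1/2) *\<^sub>R (s * (s - t) + (s - t) * t)"
      by (simp add: f_def algebra_simps flip: scaleR_right_diff_distrib)
    moreover have "norm (s * (s - t)) \<le> r * norm (s - t)" "norm ((s - t) * t) \<le> r * norm (s - t)"
      using norm_mult_ineq[of s "s - t"] norm_mult_ineq[of "s - t" t] that
      by (smt (verit) S_def mem_Collect_eq mult.commute mult_right_mono norm_ge_zero)+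
    then have "norm (s * (s - t) + (s - t) * t) \<le> 2 * (r * norm (s - t))"
      using norm_triangle_ineq[of "s * (s - t)" "(s - t) * t"] by linarith
    ultimately show ?thesis by (simp add: dist_norm)
  qed
  ultimately obtain s where s: "s \<in> S" "f s = s"
    using Banach_fix[of S r f] r by blast
  have "s + s = (2::real) *\<^sub>R f s" using s(2) by (simp add: scaleR_2)
  also have "\<dots> = x * x + s * s" by (simp add: f_def z_def)
  finally show ?thesis using s(1) by (auto simp: S_def)
qed

lemma cstar_seminorm_le_norm:
  fixes p :: "'a::cstar_algebra \<Rightarrow> real"
  assumes nonneg: "\<And>x. 0 \<le> p x"
    and add: "\<And>x y. p (x + y) \<le> p x + p y"
    and scale: "\<And>c x. p (c *\<^sub>C x) = cmod c * p x"
    and cstar: "\<And>x. p (star x * x) = (p x)\<^sup>2"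
  shows "p x \<le> norm x"
proof -
  have sa_le: "p x \<le> 1" if sa: "star x = x" and lt: "norm x < 1" for x
  proof -
    obtain s where s: "star s = s" "s * x = x * s" "s + s = x * x + s * s"
      using unitary_dilation[OF sa lt] by blast
    have p_u: "p (x * b + c *\<^sub>C (b - s * b)) = p b" if c: "c = \<i> \<or> c = - \<i>" for b c
    proof -
      define u where "u = x * b + c *\<^sub>C (b - s * b)"
      have cc: "cnj c * c = 1" "cnj c = - c" using c by auto
      have sxb: "s * (x * b) = x * (s * b)" by (metis mult.assoc s(2))
      have ssb: "x * (x * b) + s * (s * b) = s * b + s * b"
      proof -
        have "(x * x + s * s) * b = (s + s) * b" by (simp only: s(3))
        then show ?thesis by (simp add: distrib_right mult.assoc)
      qed
      have "star u = star b * x + cnj c *\<^sub>C (star b - star b * s)"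
        by (simp add: u_def star_add star_mult star_scaleC star_diff sa s(1))
      also have "cnj c = - c" by (rule cc)
      finally have su: "star u = star b * x + (- c) *\<^sub>C (star b - star b * s)" .
      have "star u * u = star b * (x * (x * b)) + c *\<^sub>C (star b * (x * (b - s * b)))
          + ((- c) *\<^sub>C ((star b - star b * s) * (x * b)) + (- c * c) *\<^sub>C ((star b - star b * s) * (b - s * b)))"
        unfolding su unfolding u_def
        by (simp only: distrib_left distrib_right mult_scaleC_left mult_scaleC_right scaleC_scaleC
            scaleC_add_right mult.assoc) (simp only: ac_simps)
      also have "(star b - star b * s) * (x * b) = star b * (x * (b - s * b))"
        by (simp add: left_diff_distrib right_diff_distrib mult.assoc sxb)
      also have "- c * c = 1" using cc by simp
      also have "(star b - star b * s) * (b - s * b) = star b * (b - s * b - s * b + s * (s * b))"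
        by (simp add: left_diff_distrib right_diff_distrib distrib_left mult.assoc)
      also have "(- c) *\<^sub>C (star b * (x * (b - s * b))) = - (c *\<^sub>C (star b * (x * (b - s * b))))"
        by (metis mult_minus1 scaleC_minus_one scaleC_scaleC)
      finally have "star u * u = star b * (x * (x * b) + (b - s * b - s * b + s * (s * b)))"
        by (simp add: scaleC_one distrib_left)
      also have "x * (x * b) + (b - s * b - s * b + s * (s * b)) = b"
        using ssb by (simp add: algebra_simps)
      finally have "(p u)\<^sup>2 = (p b)\<^sup>2" by (metis cstar)
      then show ?thesis using nonneg[of u] nonneg[of b] by (simp add: u_def)
    qed
    define v w where "v = x * x + \<i> *\<^sub>C (x - s * x)" and "w = x * x + (- \<i>) *\<^sub>C (x - s * x)"
    have "v + w = x * x + x * x"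
      using scaleC_add_left[of \<i> "- \<i>" "x - s * x"] by (simp add: v_def w_def algebra_simps)
    also have "\<dots> = 2 *\<^sub>C (x * x)" using scaleC_add_left[of 1 1 "x * x"] by (simp add: scaleC_one)
    finally have "2 * p (x * x) = p (v + w)" by (simp add: scale)
    also have "\<dots> \<le> p v + p w" by (rule add)
    also have "\<dots> = 2 * p x" by (simp add: v_def w_def p_u)
    finally have "(p x)\<^sup>2 \<le> p x" using cstar[of x] sa by simp
    then show ?thesis
      using mult_strict_right_mono[of 1 "p x" "p x"] by (cases "p x \<le> 1") (auto simp: power2_eq_square)
  qed
  have sa_norm: "p x \<le> norm x" if sa: "star x = x" for x
  proof (rule field_le_epsilon)
    fix e :: real assume e: "0 < e"
    define t where "t = norm x + e"
    have t: "0 < t" "norm x < t" using e by (auto simp: t_def add_nonneg_pos)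
    have c: "cmod (complex_of_real (1 / t)) = 1 / t" using t by (simp only: norm_of_real) simp
    have "p (complex_of_real (1 / t) *\<^sub>C x) \<le> 1"
    proof (rule sa_le)
      show "star (complex_of_real (1 / t) *\<^sub>C x) = complex_of_real (1 / t) *\<^sub>C x"
        by (simp add: star_scaleC sa)
      show "norm (complex_of_real (1 / t) *\<^sub>C x) < 1"
        using t by (simp only: norm_scaleC c) simp
    qed
    then have "p x / t \<le> 1" by (simp only: scale c) simp
    then have "p x \<le> t" using t by simp
    then show "p x \<le> norm x + e" by (simp only: t_def)
  qed
  have "(p x)\<^sup>2 \<le> (norm x)\<^sup>2"
    using sa_norm[of "star x * x"] by (simp add: star_mult star_star cstar norm_star_mult_self)
  then show ?thesis by (rule power2_le_imp_le) simp
qed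

lemma star_homomorphism_contractive:
  fixes \<phi> :: "'a::cstar_algebra \<Rightarrow> 'b::cstar_algebra"
  assumes "star_homomorphism \<phi>"
  shows "norm (\<phi> x) \<le> norm x"
  using assms norm_star_mult_self[of "\<phi> _"]
  by (intro cstar_seminorm_le_norm[of "\<lambda>x. norm (\<phi> x)"])
     (auto simp: star_homomorphism_def norm_scaleC norm_triangle_ineq simp flip: norm_star_mult_self)

section \<open>The central sequence algebra\<close>

definition bounded_seq :: "(nat \<Rightarrow> 'a::cstar_algebra) \<Rightarrow> bool" where
  "bounded_seq x \<longleftrightarrow> bounded (range x)"

definition null_seq :: "(nat \<Rightarrow> 'a::cstar_algebra) \<Rightarrow> bool" where
  "null_seq x \<longleftrightarrow> x \<longlonglongrightarrow> 0"

definition seq_rel :: "(nat \<Rightarrow> 'a::cstar_algebra) \<Rightarrow> (nat \<Rightarrow> 'a) \<Rightarrow> bool" where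
  "seq_rel x y \<longleftrightarrow> bounded_seq x \<and> bounded_seq y \<and> null_seq (\<lambda>n. x n - y n)"

lemma bounded_seq_iff: "bounded_seq x \<longleftrightarrow> (\<exists>K. \<forall>n. norm (x n) \<le> K)"
  by (auto simp: bounded_seq_def bounded_iff)

lemma bounded_seq_const [simp]: "bounded_seq (\<lambda>_. a)"
  by (auto simp: bounded_seq_iff)

lemma bounded_seq_add: "bounded_seq x \<Longrightarrow> bounded_seq y \<Longrightarrow> bounded_seq (\<lambda>n. x n + y n)"
  unfolding bounded_seq_def by (rule bounded_plus_comp)

lemma bounded_seq_uminus: "bounded_seq x \<Longrightarrow> bounded_seq (\<lambda>n. - x n)"
  by (simp add: bounded_seq_iff)

lemma bounded_seq_diff: "bounded_seq x \<Longrightarrow> bounded_seq y \<Longrightarrow> bounded_seq (\<lambda>n. x n - y n)"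
  unfolding bounded_seq_def by (rule bounded_minus_comp)

lemma bounded_seq_mult:
  assumes "bounded_seq x" "bounded_seq y"
  shows "bounded_seq (\<lambda>n. x n * y n)"
proof -
  obtain K L where "\<And>n. norm (x n) \<le> K" "\<And>n. norm (y n) \<le> L"
    using assms by (auto simp: bounded_seq_iff)
  then have "norm (x n * y n) \<le> K * L" for n
    by (meson mult_mono norm_ge_zero norm_mult_ineq order_trans)
  then show ?thesis by (auto simp: bounded_seq_iff)
qed

lemma bounded_seq_scaleC: "bounded_seq x \<Longrightarrow> bounded_seq (\<lambda>n. c *\<^sub>C x n)"
  unfolding bounded_seq_iff norm_scaleC by (meson mult_left_mono norm_ge_zero)

lemma bounded_seq_star: "bounded_seq x \<Longrightarrow> bounded_seq (\<lambda>n. star (x n))"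
  by (simp add: bounded_seq_iff)

lemma null_seq_add: "null_seq x \<Longrightarrow> null_seq y \<Longrightarrow> null_seq (\<lambda>n. x n + y n)"
  unfolding null_seq_def by (rule tendsto_add_zero)

lemma null_seq_uminus: "null_seq x \<Longrightarrow> null_seq (\<lambda>n. - x n)"
  unfolding null_seq_def using tendsto_minus[of x 0] by simp

lemma null_seq_mult_right:
  assumes "null_seq x" "bounded_seq y"
  shows "null_seq (\<lambda>n. x n * y n)"
  using bounded_bilinear.Zfun_prod_Bfun[OF bounded_bilinear_mult, of x sequentially y] assms
  by (simp add: null_seq_def bounded_seq_def Bseq_eq_bounded tendsto_Zfun_iff)

lemma null_seq_mult_left:
  assumes "bounded_seq x" "null_seq y"
  shows "null_seq (\<lambda>n. x n * y n)"
  using bounded_bilinear.Bfun_prod_Zfun[OF bounded_bilinear_mult, of x sequentially y] assms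
  by (simp add: null_seq_def bounded_seq_def Bseq_eq_bounded tendsto_Zfun_iff)

lemma null_seq_norm_iff: "null_seq x \<longleftrightarrow> (\<lambda>n. norm (x n)) \<longlonglongrightarrow> 0"
  unfolding null_seq_def by (rule tendsto_norm_zero_iff[symmetric])

lemma null_seq_scaleC: "null_seq x \<Longrightarrow> null_seq (\<lambda>n. c *\<^sub>C x n)"
  unfolding null_seq_norm_iff norm_scaleC by (rule tendsto_mult_right_zero)

lemma null_seq_star: "null_seq x \<Longrightarrow> null_seq (\<lambda>n. star (x n))"
  by (simp add: null_seq_norm_iff)

text \<open>
  The sequence algebra: bounded sequences modulo null sequences. For this type and for \<open>finf\<close>
  below only the *-algebra structure is introduced, since unitaries and their multiples do not
  involve the quotient norm.
\<close>

quotient_type (overloaded) 'a ainf = "nat \<Rightarrow> 'a::cstar_algebra" / partial: seq_rel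
proof (rule part_equivpI)
  show "\<exists>x::nat \<Rightarrow> 'a. seq_rel x x"
    by (rule exI[of _ "\<lambda>_. 0"]) (simp add: seq_rel_def null_seq_def)
  show "symp (seq_rel :: (nat \<Rightarrow> 'a) \<Rightarrow> _)"
  proof (rule sympI)
    fix x y :: "nat \<Rightarrow> 'a" assume xy: "seq_rel x y"
    then have "null_seq (\<lambda>n. - (x n - y n))" by (intro null_seq_uminus) (simp add: seq_rel_def)
    then show "seq_rel y x" using xy by (simp add: seq_rel_def)
  qed
  show "transp (seq_rel :: (nat \<Rightarrow> 'a) \<Rightarrow> _)"
  proof (rule transpI)
    fix x y z :: "nat \<Rightarrow> 'a"
    assume xy: "seq_rel x y" and yz: "seq_rel y z"
    have "null_seq (\<lambda>n. (x n - y n) + (y n - z n))"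
      using xy yz by (intro null_seq_add) (auto simp: seq_rel_def)
    then show "seq_rel x z" using xy yz by (simp add: seq_rel_def)
  qed
qed

instantiation ainf :: (cstar_algebra) star_algebra
begin

lift_definition zero_ainf :: "'a ainf" is "\<lambda>_. 0"
  by (simp add: seq_rel_def null_seq_def)

lift_definition plus_ainf :: "'a ainf \<Rightarrow> 'a ainf \<Rightarrow> 'a ainf" is "\<lambda>x y n. x n + y n"
proof -
  fix x x' y y' :: "nat \<Rightarrow> 'a" assume h: "seq_rel x x'" "seq_rel y y'"
  have "null_seq (\<lambda>n. (x n - x' n) + (y n - y' n))"
    using h by (intro null_seq_add) (auto simp: seq_rel_def)
  then show "seq_rel (\<lambda>n. x n + y n) (\<lambda>n. x' n + y' n)"
    using h by (simp add: seq_rel_def bounded_seq_add algebra_simps)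
qed

lift_definition uminus_ainf :: "'a ainf \<Rightarrow> 'a ainf" is "\<lambda>x n. - x n"
proof -
  fix x x' :: "nat \<Rightarrow> 'a" assume h: "seq_rel x x'"
  have "null_seq (\<lambda>n. - (x n - x' n))"
    using h by (intro null_seq_uminus) (auto simp: seq_rel_def)
  then show "seq_rel (\<lambda>n. - x n) (\<lambda>n. - x' n)"
    using h by (simp add: seq_rel_def bounded_seq_uminus)
qed

definition minus_ainf :: "'a ainf \<Rightarrow> 'a ainf \<Rightarrow> 'a ainf" where
  "minus_ainf x y = x + - y"

lift_definition times_ainf :: "'a ainf \<Rightarrow> 'a ainf \<Rightarrow> 'a ainf" is "\<lambda>x y n. x n * y n"
proof -
  fix x x' y y' :: "nat \<Rightarrow> 'a" assume h: "seq_rel x x'" "seq_rel y y'"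
  have "null_seq (\<lambda>n. (x n - x' n) * y n + x' n * (y n - y' n))"
    using h by (intro null_seq_add null_seq_mult_left null_seq_mult_right) (auto simp: seq_rel_def)
  then show "seq_rel (\<lambda>n. x n * y n) (\<lambda>n. x' n * y' n)"
    using h by (simp add: seq_rel_def bounded_seq_mult algebra_simps)
qed

lift_definition scaleC_ainf :: "complex \<Rightarrow> 'a ainf \<Rightarrow> 'a ainf" is "\<lambda>c x n. c *\<^sub>C x n"
proof -
  fix c and x x' :: "nat \<Rightarrow> 'a" assume h: "seq_rel x x'"
  have "null_seq (\<lambda>n. c *\<^sub>C (x n - x' n))"
    using h by (intro null_seq_scaleC) (auto simp: seq_rel_def)
  then show "seq_rel (\<lambda>n. c *\<^sub>C x n) (\<lambda>n. c *\<^sub>C x' n)"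
    using h by (simp add: seq_rel_def bounded_seq_scaleC scaleC_diff_right)
qed

lift_definition star_ainf :: "'a ainf \<Rightarrow> 'a ainf" is "\<lambda>x n. star (x n)"
proof -
  fix x x' :: "nat \<Rightarrow> 'a" assume h: "seq_rel x x'"
  have "null_seq (\<lambda>n. star (x n - x' n))"
    using h by (intro null_seq_star) (auto simp: seq_rel_def)
  then show "seq_rel (\<lambda>n. star (x n)) (\<lambda>n. star (x' n))"
    using h by (simp add: seq_rel_def bounded_seq_star star_diff)
qed

lemma seq_rel_cong: "x = y \<Longrightarrow> seq_rel x x \<Longrightarrow> seq_rel x y"
  by simp

lemma seq_rel_refl: "seq_rel x x \<longleftrightarrow> bounded_seq x"
  by (simp add: seq_rel_def null_seq_def)

instance
proof
  fix x y z :: "'a ainf" and c d :: complex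
  note bs = seq_rel_refl bounded_seq_add bounded_seq_mult bounded_seq_scaleC bounded_seq_star
    bounded_seq_uminus
  show "x + y + z = x + (y + z)"
    by transfer (rule seq_rel_cong, simp_all add: bs add.assoc)
  show "x + y = y + x"
    by transfer (rule seq_rel_cong, simp_all add: bs add.commute)
  show "0 + x = x"
    by transfer (rule seq_rel_cong, simp_all add: bs)
  show "- x + x = 0"
    by transfer (rule seq_rel_cong, simp_all add: bs)
  show "x - y = x + - y" by (rule minus_ainf_def)
  show "x * y * z = x * (y * z)"
    by transfer (rule seq_rel_cong, simp_all add: bs mult.assoc)
  show "(x + y) * z = x * z + y * z"
    by transfer (rule seq_rel_cong, simp_all add: bs distrib_right)
  show "x * (y + z) = x * y + x * z"
    by transfer (rule seq_rel_cong, simp_all add: bs distrib_left)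
  show "c *\<^sub>C (x + y) = c *\<^sub>C x + c *\<^sub>C y"
    by transfer (rule seq_rel_cong, simp_all add: bs scaleC_add_right)
  show "(c + d) *\<^sub>C x = c *\<^sub>C x + d *\<^sub>C x"
    by transfer (rule seq_rel_cong, simp_all add: bs scaleC_add_left)
  show "c *\<^sub>C d *\<^sub>C x = (c * d) *\<^sub>C x"
    by transfer (rule seq_rel_cong, simp_all add: bs scaleC_scaleC)
  show "1 *\<^sub>C x = x"
    by transfer (rule seq_rel_cong, simp_all add: bs scaleC_one)
  show "(c *\<^sub>C x) * y = c *\<^sub>C (x * y)"
    by transfer (rule seq_rel_cong, simp_all add: bs mult_scaleC_left)
  show "x * (c *\<^sub>C y) = c *\<^sub>C (x * y)"
    by transfer (rule seq_rel_cong, simp_all add: bs mult_scaleC_right)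
  show "star (star x) = x"
    by transfer (rule seq_rel_cong, simp_all add: bs star_star)
  show "star (x + y) = star x + star y"
    by transfer (rule seq_rel_cong, simp_all add: bs star_add)
  show "star (x * y) = star y * star x"
    by transfer (rule seq_rel_cong, simp_all add: bs star_mult)
  show "star (c *\<^sub>C x) = cnj c *\<^sub>C star x"
    by transfer (rule seq_rel_cong, simp_all add: bs star_scaleC)
qed

end

lift_definition const_ainf :: "'a::cstar_algebra \<Rightarrow> 'a ainf" is "\<lambda>a _. a"
  by (simp add: seq_rel_refl)

lemma star_const_ainf: "star (const_ainf a) = const_ainf (star a)"
  by transfer (simp add: seq_rel_refl)

definition relative_commutant :: "'a::cstar_algebra ainf set" where
  "relative_commutant = {x. \<forall>a. const_ainf a * x = x * const_ainf a}"

definition annihilator :: "'a::cstar_algebra ainf set" where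
  "annihilator = {x. \<forall>a. const_ainf a * x = 0 \<and> x * const_ainf a = 0}"

lemma relative_commutant_closed:
  fixes x y :: "'a::cstar_algebra ainf"
  shows "0 \<in> (relative_commutant :: 'a ainf set)"
    and "x \<in> relative_commutant \<Longrightarrow> y \<in> relative_commutant \<Longrightarrow> x + y \<in> relative_commutant"
    and "x \<in> relative_commutant \<Longrightarrow> - x \<in> relative_commutant"
    and "x \<in> relative_commutant \<Longrightarrow> c *\<^sub>C x \<in> relative_commutant"
    and "x \<in> relative_commutant \<Longrightarrow> star x \<in> relative_commutant"
  unfolding relative_commutant_def
  by (simp_all add: distrib_left distrib_right mult_scaleC_left mult_scaleC_right)
     (metis star_const_ainf star_mult star_star)

lemma relative_commutant_mult:
  "x \<in> relative_commutant \<Longrightarrow> y \<in> relative_commutant \<Longrightarrow> x * y \<in> relative_commutant"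
  unfolding relative_commutant_def mem_Collect_eq by (metis mult.assoc)

lemma annihilator_closed:
  fixes x y :: "'a::cstar_algebra ainf"
  shows "0 \<in> (annihilator :: 'a ainf set)"
    and "x \<in> annihilator \<Longrightarrow> y \<in> annihilator \<Longrightarrow> x + y \<in> annihilator"
    and "x \<in> annihilator \<Longrightarrow> - x \<in> annihilator"
    and "x \<in> annihilator \<Longrightarrow> c *\<^sub>C x \<in> annihilator"
    and "x \<in> annihilator \<Longrightarrow> star x \<in> annihilator"
  unfolding annihilator_def
  by (simp_all add: distrib_left distrib_right mult_scaleC_left mult_scaleC_right)
     (metis star_const_ainf star_mult star_star star_zero)

lemma annihilator_mult:
  assumes "x \<in> annihilator" "y \<in> relative_commutant"
  shows "x * y \<in> annihilator" and "y * x \<in> annihilator"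
  using assms unfolding annihilator_def relative_commutant_def mem_Collect_eq
  by (metis mult.assoc mult_zero_left mult_zero_right)+

definition finf_rel :: "'a::cstar_algebra ainf \<Rightarrow> 'a ainf \<Rightarrow> bool" where
  "finf_rel x y \<longleftrightarrow> x \<in> relative_commutant \<and> y \<in> relative_commutant \<and> x - y \<in> annihilator"

lemma finf_rel_refl: "finf_rel x x \<longleftrightarrow> x \<in> relative_commutant"
  by (simp add: finf_rel_def annihilator_closed)

text \<open>The central sequence algebra: relative commutant modulo annihilator.\<close>

quotient_type (overloaded) 'a finf = "'a::cstar_algebra ainf" / partial: finf_rel
proof (rule part_equivpI)
  show "\<exists>x::'a ainf. finf_rel x x"
    by (rule exI[of _ 0]) (simp add: finf_rel_refl relative_commutant_closed)
  show "symp (finf_rel :: 'a ainf \<Rightarrow> _)"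
    by (rule sympI) (metis annihilator_closed(3) finf_rel_def minus_diff_eq)
  show "transp (finf_rel :: 'a ainf \<Rightarrow> _)"
  proof (rule transpI)
    fix x y z :: "'a ainf"
    assume xy: "finf_rel x y" and yz: "finf_rel y z"
    have "(x - y) + (y - z) \<in> annihilator"
      using xy yz by (intro annihilator_closed) (auto simp: finf_rel_def)
    then show "finf_rel x z" using xy yz by (simp add: finf_rel_def)
  qed
qed

instantiation finf :: (cstar_algebra) star_algebra
begin

lift_definition zero_finf :: "'a finf" is 0
  by (simp add: finf_rel_refl relative_commutant_closed)

lift_definition plus_finf :: "'a finf \<Rightarrow> 'a finf \<Rightarrow> 'a finf" is "(+)"
proof -
  fix x x' y y' :: "'a ainf" assume h: "finf_rel x x'" "finf_rel y y'"
  have "(x - x') + (y - y') \<in> annihilator"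
    using h by (intro annihilator_closed) (auto simp: finf_rel_def)
  then show "finf_rel (x + y) (x' + y')"
    using h by (simp add: finf_rel_def relative_commutant_closed algebra_simps)
qed

lift_definition uminus_finf :: "'a finf \<Rightarrow> 'a finf" is uminus
proof -
  fix x x' :: "'a ainf" assume h: "finf_rel x x'"
  have "- (x - x') \<in> annihilator"
    using h by (intro annihilator_closed) (auto simp: finf_rel_def)
  then show "finf_rel (- x) (- x')"
    using h by (simp add: finf_rel_def relative_commutant_closed)
qed

definition minus_finf :: "'a finf \<Rightarrow> 'a finf \<Rightarrow> 'a finf" where
  "minus_finf x y = x + - y"

lift_definition times_finf :: "'a finf \<Rightarrow> 'a finf \<Rightarrow> 'a finf" is "(*)"
proof -
  fix x x' y y' :: "'a ainf" assume h: "finf_rel x x'" "finf_rel y y'"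
  have "(x - x') * y + x' * (y - y') \<in> annihilator"
    using h by (intro annihilator_closed(2) annihilator_mult) (auto simp: finf_rel_def)
  then show "finf_rel (x * y) (x' * y')"
    using h by (simp add: finf_rel_def relative_commutant_mult algebra_simps)
qed

lift_definition scaleC_finf :: "complex \<Rightarrow> 'a finf \<Rightarrow> 'a finf" is scaleC
proof -
  fix c and x x' :: "'a ainf" assume h: "finf_rel x x'"
  have "c *\<^sub>C (x - x') \<in> annihilator"
    using h by (intro annihilator_closed) (auto simp: finf_rel_def)
  then show "finf_rel (c *\<^sub>C x) (c *\<^sub>C x')"
    using h by (simp add: finf_rel_def relative_commutant_closed scaleC_diff_right)
qed

lift_definition star_finf :: "'a finf \<Rightarrow> 'a finf" is star
proof -
  fix x x' :: "'a ainf" assume h: "finf_rel x x'"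
  have "star (x - x') \<in> annihilator"
    using h by (intro annihilator_closed) (auto simp: finf_rel_def)
  then show "finf_rel (star x) (star x')"
    using h by (simp add: finf_rel_def relative_commutant_closed star_diff)
qed

lemma finf_rel_cong: "x = y \<Longrightarrow> finf_rel x x \<Longrightarrow> finf_rel x y"
  by simp

instance
proof
  fix x y z :: "'a finf" and c d :: complex
  note rc = finf_rel_refl relative_commutant_closed relative_commutant_mult
  show "x + y + z = x + (y + z)"
    by transfer (rule finf_rel_cong, simp_all add: rc add.assoc)
  show "x + y = y + x"
    by transfer (rule finf_rel_cong, simp_all add: rc add.commute)
  show "0 + x = x"
    by transfer (rule finf_rel_cong, simp_all add: rc)
  show "- x + x = 0"
    by transfer (rule finf_rel_cong, simp_all add: rc)
  show "x - y = x + - y" by (rule minus_finf_def)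
  show "x * y * z = x * (y * z)"
    by transfer (rule finf_rel_cong, simp_all add: rc mult.assoc)
  show "(x + y) * z = x * z + y * z"
    by transfer (rule finf_rel_cong, simp_all add: rc distrib_right)
  show "x * (y + z) = x * y + x * z"
    by transfer (rule finf_rel_cong, simp_all add: rc distrib_left)
  show "c *\<^sub>C (x + y) = c *\<^sub>C x + c *\<^sub>C y"
    by transfer (rule finf_rel_cong, simp_all add: rc scaleC_add_right)
  show "(c + d) *\<^sub>C x = c *\<^sub>C x + d *\<^sub>C x"
    by transfer (rule finf_rel_cong, simp_all add: rc scaleC_add_left)
  show "c *\<^sub>C d *\<^sub>C x = (c * d) *\<^sub>C x"
    by transfer (rule finf_rel_cong, simp_all add: rc scaleC_scaleC)
  show "1 *\<^sub>C x = x"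
    by transfer (rule finf_rel_cong, simp_all add: rc scaleC_one)
  show "(c *\<^sub>C x) * y = c *\<^sub>C (x * y)"
    by transfer (rule finf_rel_cong, simp_all add: rc mult_scaleC_left)
  show "x * (c *\<^sub>C y) = c *\<^sub>C (x * y)"
    by transfer (rule finf_rel_cong, simp_all add: rc mult_scaleC_right)
  show "star (star x) = x"
    by transfer (rule finf_rel_cong, simp_all add: rc star_star)
  show "star (x + y) = star x + star y"
    by transfer (rule finf_rel_cong, simp_all add: rc star_add)
  show "star (x * y) = star y * star x"
    by transfer (rule finf_rel_cong, simp_all add: rc star_mult)
  show "star (c *\<^sub>C x) = cnj c *\<^sub>C star x"
    by transfer (rule finf_rel_cong, simp_all add: rc star_scaleC)
qed

end

text \<open>
  The maps induced by componentwise application. They are defined through representatives;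
  independence of the representatives, for *-automorphisms, is shown below.
\<close>

definition ainf_map :: "('a::cstar_algebra \<Rightarrow> 'a) \<Rightarrow> 'a ainf \<Rightarrow> 'a ainf" where
  "ainf_map \<phi> x = abs_ainf (\<lambda>n. \<phi> (rep_ainf x n))"

definition finf_map :: "('a::cstar_algebra \<Rightarrow> 'a) \<Rightarrow> 'a finf \<Rightarrow> 'a finf" where
  "finf_map \<phi> u = abs_finf (ainf_map \<phi> (rep_finf u))"

lemma seq_rel_map:
  fixes \<phi> :: "'a::cstar_algebra \<Rightarrow> 'a"
  assumes hom: "star_homomorphism \<phi>" and rel: "seq_rel x y"
  shows "seq_rel (\<lambda>n. \<phi> (x n)) (\<lambda>n. \<phi> (y n))"
proof -
  have add: "\<phi> (a + b) = \<phi> a + \<phi> b" for a b using hom by (simp add: star_homomorphism_def)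
  have diff: "\<phi> (a - b) = \<phi> a - \<phi> b" for a b
    using add[of "a - b" b] by simp
  have bdd: "bounded_seq (\<lambda>n. \<phi> (z n))" if "bounded_seq z" for z
    using that star_homomorphism_contractive[OF hom] unfolding bounded_seq_iff by (meson order_trans)
  have "(\<lambda>n. norm (\<phi> (x n) - \<phi> (y n))) \<longlonglongrightarrow> 0"
  proof (rule tendsto_sandwich[OF _ _ tendsto_const])
    show "(\<lambda>n. norm (x n - y n)) \<longlonglongrightarrow> 0"
      using rel by (simp add: seq_rel_def null_seq_norm_iff)
    show "\<forall>\<^sub>F n in sequentially. norm (\<phi> (x n) - \<phi> (y n)) \<le> norm (x n - y n)"
      using star_homomorphism_contractive[OF hom] by (simp flip: diff)
  qed simp
  then show ?thesis using rel bdd by (simp add: seq_rel_def null_seq_norm_iff)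
qed

lemma ainf_map_abs:
  fixes \<phi> :: "'a::cstar_algebra \<Rightarrow> 'a"
  assumes "star_homomorphism \<phi>" and "bounded_seq x"
  shows "ainf_map \<phi> (abs_ainf x) = abs_ainf (\<lambda>n. \<phi> (x n))"
proof -
  have "seq_rel (rep_ainf (abs_ainf x)) x"
    using assms(2) by (metis Quotient3_ainf rep_abs_rsp_left seq_rel_refl)
  then show ?thesis
    unfolding ainf_map_def using Quotient3_rel_abs[OF Quotient3_ainf] seq_rel_map[OF assms(1)] by blast
qed

lemma ainf_map_simps:
  fixes \<phi> :: "'a::cstar_algebra \<Rightarrow> 'a"
  assumes hom: "star_homomorphism \<phi>"
  shows "ainf_map \<phi> (x + y) = ainf_map \<phi> x + ainf_map \<phi> y"
    and "ainf_map \<phi> (x * y) = ainf_map \<phi> x * ainf_map \<phi> y"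
    and "ainf_map \<phi> (const_ainf a) = const_ainf (\<phi> a)"
proof -
  have h: "\<phi> (a + b) = \<phi> a + \<phi> b" "\<phi> (a * b) = \<phi> a * \<phi> b" for a b
    using hom by (auto simp: star_homomorphism_def)
  have ex: "\<exists>z. bounded_seq z \<and> x = abs_ainf z" for x :: "'a ainf"
    by (metis Quotient3_ainf Quotient3_abs_rep Quotient3_rep_reflp seq_rel_refl)
  have bdd: "bounded_seq (\<lambda>n. \<phi> (z n))" if "bounded_seq z" for z
    using seq_rel_map[OF hom, of z z] that by (simp add: seq_rel_refl)
  obtain v w where vw: "bounded_seq v" "x = abs_ainf v" "bounded_seq w" "y = abs_ainf w"
    using ex by metis
  show "ainf_map \<phi> (x + y) = ainf_map \<phi> x + ainf_map \<phi> y"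
    using vw bdd by (simp add: plus_ainf.abs_eq seq_rel_refl ainf_map_abs[OF hom] bounded_seq_add h)
  show "ainf_map \<phi> (x * y) = ainf_map \<phi> x * ainf_map \<phi> y"
    using vw bdd by (simp add: times_ainf.abs_eq seq_rel_refl ainf_map_abs[OF hom] bounded_seq_mult h)
  show "ainf_map \<phi> (const_ainf a) = const_ainf (\<phi> a)"
    by (simp add: const_ainf.abs_eq ainf_map_abs[OF hom])
qed

lemma finf_map_abs:
  fixes \<phi> :: "'a::cstar_algebra \<Rightarrow> 'a"
  assumes aut: "star_automorphism \<phi>" and x: "x \<in> relative_commutant"
  shows "finf_map \<phi> (abs_finf x) = abs_finf (ainf_map \<phi> x)"
proof -
  have hom: "star_homomorphism \<phi>" and surj: "\<And>a. \<exists>b. a = \<phi> b"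
    using aut by (auto simp: star_automorphism_def bij_def surj_def)
  note simps = ainf_map_simps[OF hom]
  have zero: "ainf_map \<phi> 0 = 0" using simps(1)[of 0 0] by simp
  have diff: "ainf_map \<phi> (y - z) = ainf_map \<phi> y - ainf_map \<phi> z" for y z
    using simps(1)[of "y - z" z] by simp
  have comm: "ainf_map \<phi> y \<in> relative_commutant" if "y \<in> relative_commutant" for y
    using that surj unfolding relative_commutant_def mem_Collect_eq by (metis simps(2,3))
  have ann: "ainf_map \<phi> y \<in> annihilator" if "y \<in> annihilator" for y
    using that surj unfolding annihilator_def mem_Collect_eq by (metis simps(2,3) zero)
  have "finf_rel (rep_finf (abs_finf x)) x"
    using x by (metis Quotient3_finf rep_abs_rsp_left finf_rel_refl)
  then have "finf_rel (ainf_map \<phi> (rep_finf (abs_finf x))) (ainf_map \<phi> x)"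
    by (auto simp: finf_rel_def comm ann simp flip: diff)
  then show ?thesis
    unfolding finf_map_def using Quotient3_rel_abs[OF Quotient3_finf] by blast
qed

section \<open>The abelian Rokhlin property\<close>

definition dual_group :: "('g::ab_group_add \<Rightarrow> complex) set" where
  "dual_group = {\<eta>. (\<forall>g h. \<eta> (g + h) = \<eta> g * \<eta> h) \<and> (\<forall>g. cmod (\<eta> g) = 1)}"

definition abelian_Rokhlin :: "('g::ab_group_add \<Rightarrow> 'a::cstar_algebra \<Rightarrow> 'a) \<Rightarrow> bool" where
  "abelian_Rokhlin \<alpha> \<longleftrightarrow>
     (\<forall>\<eta>\<in>dual_group. \<exists>u::'a finf. unitary u \<and> (\<forall>g. finf_map (\<alpha> g) u = \<eta> g *\<^sub>C u))"

section \<open>Crossed products\<close>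

text \<open>
  Finitely supported functions \<open>f\<close> from \<open>G\<close> to \<open>A\<close> stand for the sums of the \<open>f g \<lambda>\<^sub>g\<close>; in
  particular \<open>single g a\<close> is \<open>a \<lambda>\<^sub>g\<close>. The product is the \<open>\<alpha>\<close>-twisted convolution given by
  \<open>(a \<lambda>\<^sub>g) (b \<lambda>\<^sub>h) = a \<alpha>\<^sub>g(b) \<lambda>\<^bsub>g+h\<^esub>\<close> (the multiplication of \<open>Poly_Mapping\<close> is the untwisted
  one and is not used).
\<close>

definition cc_scale :: "complex \<Rightarrow> ('g \<Rightarrow>\<^sub>0 'a::star_algebra) \<Rightarrow> ('g \<Rightarrow>\<^sub>0 'a)" where
  "cc_scale c f = Poly_Mapping.map (scaleC c) f"

definition cc_mult ::
  "('g::ab_group_add \<Rightarrow> 'a::star_algebra \<Rightarrow> 'a) \<Rightarrow> ('g \<Rightarrow>\<^sub>0 'a) \<Rightarrow> ('g \<Rightarrow>\<^sub>0 'a) \<Rightarrow> ('g \<Rightarrow>\<^sub>0 'a)" where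
  "cc_mult \<alpha> f h =
     (\<Sum>s\<in>Poly_Mapping.keys f. \<Sum>t\<in>Poly_Mapping.keys h.
        Poly_Mapping.single (s + t) (Poly_Mapping.lookup f s * \<alpha> s (Poly_Mapping.lookup h t)))"

definition cc_star ::
  "('g::ab_group_add \<Rightarrow> 'a::star_algebra \<Rightarrow> 'a) \<Rightarrow> ('g \<Rightarrow>\<^sub>0 'a) \<Rightarrow> ('g \<Rightarrow>\<^sub>0 'a)" where
  "cc_star \<alpha> f =
     (\<Sum>s\<in>Poly_Mapping.keys f. Poly_Mapping.single (- s) (\<alpha> (- s) (star (Poly_Mapping.lookup f s))))"

definition cc_cstar_seminorm ::
  "('g::ab_group_add \<Rightarrow> 'a::star_algebra \<Rightarrow> 'a) \<Rightarrow> (('g \<Rightarrow>\<^sub>0 'a) \<Rightarrow> real) \<Rightarrow> bool" where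
  "cc_cstar_seminorm \<alpha> p \<longleftrightarrow>
     (\<forall>f. 0 \<le> p f) \<and> (\<forall>f h. p (f + h) \<le> p f + p h) \<and>
     (\<forall>c f. p (cc_scale c f) = cmod c * p f) \<and>
     (\<forall>f h. p (cc_mult \<alpha> f h) \<le> p f * p h) \<and>
     (\<forall>f. p (cc_mult \<alpha> (cc_star \<alpha> f) f) = (p f)\<^sup>2)"

text \<open>
  The universal norm, written as the largest C*-seminorm: every C*-seminorm is the norm of a
  *-representation and vice versa, so this is the supremum over the covariant representations.
  The supremum is bounded by the \<open>\<ell>\<^sup>1\<close>-norm, see below.
\<close>

definition universal_norm ::
  "('g::ab_group_add \<Rightarrow> 'a::cstar_algebra \<Rightarrow> 'a) \<Rightarrow> ('g \<Rightarrow>\<^sub>0 'a) \<Rightarrow> real" where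
  "universal_norm \<alpha> f = Sup {p f | p. cc_cstar_seminorm \<alpha> p}"

lemma cc_cstar_seminorm_le:
  fixes \<alpha> :: "'g::ab_group_add \<Rightarrow> 'a::cstar_algebra \<Rightarrow> 'a"
  assumes act: "group_action \<alpha>" and p: "cc_cstar_seminorm \<alpha> p"
  shows "p f \<le> (\<Sum>g\<in>Poly_Mapping.keys f. norm (Poly_Mapping.lookup f g))"
proof -
  have hom: "star_homomorphism (\<alpha> g)" for g
    using act by (simp add: group_action_def star_automorphism_def)
  have a0: "\<alpha> 0 = id" using act by (simp add: group_action_def)
  have map_mult: "\<alpha> g (x * y) = \<alpha> g x * \<alpha> g y" and map_star: "\<alpha> g (star x) = star (\<alpha> g x)"
    and map_add: "\<alpha> g (x + y) = \<alpha> g x + \<alpha> g y" for g x y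
    using hom[of g] by (auto simp: star_homomorphism_def)
  have map_0: "\<alpha> g 0 = 0" for g using map_add[of g 0 0] by simp
  have ps: "0 \<le> p f" "p (f + h) \<le> p f + p h" "p (cc_scale c f) = cmod c * p f"
    "p (cc_mult \<alpha> (cc_star \<alpha> f) f) = (p f)\<^sup>2" for f h c
    using p by (auto simp: cc_cstar_seminorm_def)
  have scale_single: "cc_scale c (Poly_Mapping.single g a) = Poly_Mapping.single g (c *\<^sub>C a)"
    for c and g :: 'g and a :: 'a
    by (simp add: cc_scale_def)
  have star_single: "cc_star \<alpha> (Poly_Mapping.single g a) = Poly_Mapping.single (- g) (\<alpha> (- g) (star a))"
    for g a
    by (cases "a = 0") (simp_all add: cc_star_def map_0)
  have mult_single: "cc_mult \<alpha> (Poly_Mapping.single g a) (Poly_Mapping.single h b) =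
      Poly_Mapping.single (g + h) (a * \<alpha> g b)" for g a h b
    by (cases "a = 0"; cases "b = 0") (simp_all add: cc_mult_def map_0)
  have le0: "p (Poly_Mapping.single 0 a) \<le> norm a" for a
  proof (rule cstar_seminorm_le_norm[of "\<lambda>a. p (Poly_Mapping.single 0 a)"])
    show "p (Poly_Mapping.single 0 (x + y)) \<le> p (Poly_Mapping.single 0 x) + p (Poly_Mapping.single 0 y)"
      for x y by (simp add: ps single_add)
    show "p (Poly_Mapping.single 0 (c *\<^sub>C x)) = cmod c * p (Poly_Mapping.single 0 x)" for c x
      by (simp add: ps flip: scale_single)
    show "p (Poly_Mapping.single 0 (star x * x)) = (p (Poly_Mapping.single 0 x))\<^sup>2" for x
      using ps(4)[of "Poly_Mapping.single 0 x"] by (simp add: star_single mult_single a0)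
  qed (rule ps)
  have le: "p (Poly_Mapping.single g a) \<le> norm a" for g a
  proof -
    have "(p (Poly_Mapping.single g a))\<^sup>2 = p (Poly_Mapping.single 0 (\<alpha> (- g) (star a * a)))"
      using ps(4)[of "Poly_Mapping.single g a"] by (simp add: star_single mult_single map_mult)
    also have "\<dots> \<le> norm (star a * a)"
      using le0 star_homomorphism_contractive[OF hom] order_trans by blast
    finally have "(p (Poly_Mapping.single g a))\<^sup>2 \<le> (norm a)\<^sup>2" by (simp add: norm_star_mult_self)
    then show ?thesis by (rule power2_le_imp_le) simp
  qed
  have p0: "p 0 = 0" using ps(3)[of 0 0] scale_single[of 0 0 0] by simp
  have psum: "p (\<Sum>g\<in>F. k g) \<le> (\<Sum>g\<in>F. p (k g))" if "finite F" for F :: "'g set" and k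
    using that by induction (auto simp: p0 intro: order_trans[OF ps(2)])
  have "f = (\<Sum>g\<in>Poly_Mapping.keys f. Poly_Mapping.single g (Poly_Mapping.lookup f g))"
    by (rule poly_mapping_eqI) (simp add: lookup_sum lookup_single when_def in_keys_iff)
  then have "p f \<le> (\<Sum>g\<in>Poly_Mapping.keys f. p (Poly_Mapping.single g (Poly_Mapping.lookup f g)))"
    using psum[of "Poly_Mapping.keys f"] by (metis finite_keys)
  also have "\<dots> \<le> (\<Sum>g\<in>Poly_Mapping.keys f. norm (Poly_Mapping.lookup f g))"
    by (intro sum_mono le)
  finally show ?thesis .
qed

text \<open>
  \<open>B\<close> together with \<open>j\<close> is the crossed product of \<open>A\<close> by \<open>\<alpha>\<close>: the completion of the twisted
  convolution algebra with respect to the universal norm. This determines \<open>(B, j)\<close> up to a unique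
  isomorphism.
\<close>

definition crossed_product ::
  "('g::ab_group_add \<Rightarrow> 'a::cstar_algebra \<Rightarrow> 'a) \<Rightarrow> (('g \<Rightarrow>\<^sub>0 'a) \<Rightarrow> 'b::cstar_algebra) \<Rightarrow> bool" where
  "crossed_product \<alpha> j \<longleftrightarrow>
     (\<forall>f h. j (f + h) = j f + j h) \<and> (\<forall>c f. j (cc_scale c f) = c *\<^sub>C j f) \<and>
     (\<forall>f h. j (cc_mult \<alpha> f h) = j f * j h) \<and> (\<forall>f. j (cc_star \<alpha> f) = star (j f)) \<and>
     (\<forall>f. norm (j f) = universal_norm \<alpha> f) \<and> closure (range j) = UNIV"

definition cp_embed :: "(('g::ab_group_add \<Rightarrow>\<^sub>0 'a::cstar_algebra) \<Rightarrow> 'b::cstar_algebra) \<Rightarrow> 'a \<Rightarrow> 'b" where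
  "cp_embed j a = j (Poly_Mapping.single 0 a)"

definition conditional_expectation ::
  "('a::cstar_algebra \<Rightarrow> 'b::cstar_algebra) \<Rightarrow> ('b \<Rightarrow> 'a) \<Rightarrow> bool" where
  "conditional_expectation \<iota> E \<longleftrightarrow>
     (\<forall>x y. E (x + y) = E x + E y) \<and> (\<forall>c x. E (c *\<^sub>C x) = c *\<^sub>C E x) \<and>
     (\<forall>x. norm (E x) \<le> norm x) \<and> (\<forall>x\<in>positive_cone. E x \<in> positive_cone) \<and>
     (\<forall>a. E (\<iota> a) = a) \<and> (\<forall>a x b. E (\<iota> a * x * \<iota> b) = a * E x * b)"

text \<open>Since the elements \<open>a \<lambda>\<^sub>g\<close> span a dense subspace and \<open>E\<close> is
  contractive, there is at most one such \<open>E\<close>.\<close>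

definition canonical_expectation ::
  "(('g::ab_group_add \<Rightarrow>\<^sub>0 'a::cstar_algebra) \<Rightarrow> 'b::cstar_algebra) \<Rightarrow> ('b \<Rightarrow> 'a) \<Rightarrow> bool" where
  "canonical_expectation j E \<longleftrightarrow> conditional_expectation (cp_embed j) E \<and>
     (\<forall>g a. E (j (Poly_Mapping.single g a)) = (if g = 0 then a else 0))"

section \<open>Traces\<close>

text \<open>Only the values of \<open>\<theta>\<close> on the positive cone matter. Note \<open>0 * \<infinity> = 0\<close> in \<open>ennreal\<close>.\<close>

definition tracial_weight :: "('b::cstar_algebra \<Rightarrow> ennreal) \<Rightarrow> bool" where
  "tracial_weight \<theta> \<longleftrightarrow>
     (\<forall>x\<in>positive_cone. \<forall>y\<in>positive_cone. \<theta> (x + y) = \<theta> x + \<theta> y) \<and>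
     (\<forall>r\<ge>0. \<forall>x\<in>positive_cone. \<theta> (r *\<^sub>R x) = ennreal r * \<theta> x) \<and>
     (\<forall>x. \<theta> (star x * x) = \<theta> (x * star x))"

definition densely_defined :: "('b::cstar_algebra \<Rightarrow> ennreal) \<Rightarrow> bool" where
  "densely_defined \<theta> \<longleftrightarrow> positive_cone \<subseteq> closure {x \<in> positive_cone. \<theta> x < \<infinity>}"

definition lower_semicontinuous :: "('b::cstar_algebra \<Rightarrow> ennreal) \<Rightarrow> bool" where
  "lower_semicontinuous \<theta> \<longleftrightarrow>
     (\<forall>t. closedin (top_of_set positive_cone) {x \<in> positive_cone. \<theta> x \<le> t})"

end

theory Submission
  imports Defs "HOL-Real_Asymp.Real_Asymp"
begin

text \<open>
  Put \<open>R(a, b) = Re \<theta> (star b * a)\<close> on the left ideal \<open>{a. \<theta> (star a * a) < \<infinity>}\<close>, and for \<open>c \<in> A\<close> in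
  this ideal let \<open>\<phi>\<^sub>c z = R(c, z c)\<close>, a bounded functional on the crossed product. Let \<open>u\<^sub>n \<in> A\<close>
  represent a unitary of the central sequence algebra with eigencharacter \<open>\<eta>\<close>. If \<open>c = h k\<close> with
  \<open>h\<close>, \<open>k\<close> in the ideal, then \<open>u\<^sub>n\<close> asymptotically commutes with \<open>c\<close> in the norm of \<open>R\<close>, so that
  \<open>\<phi>\<^sub>c (a \<lambda>\<^sub>g) \<approx> \<phi>\<^sub>c (u\<^sub>n star u\<^sub>n a \<lambda>\<^sub>g) \<approx> \<phi>\<^sub>c (star u\<^sub>n a \<lambda>\<^sub>g u\<^sub>n) \<approx> \<phi>\<^sub>c (\<eta> g a \<lambda>\<^sub>g)\<close>. Since characters
  separate points, \<open>\<phi>\<^sub>c\<close> vanishes on \<open>a \<lambda>\<^sub>g\<close> for \<open>g \<noteq> 0\<close>, hence \<open>\<phi>\<^sub>c = \<phi>\<^sub>c \<circ> E\<close>.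

  Such \<open>c\<close> with \<open>0 \<le> c\<^sup>2 \<le> 1\<close> form an approximate unit: if \<open>\<theta> x < \<infinity>\<close> and \<open>x\<close> is within
  \<open>\<epsilon>\<close> of \<open>b \<in> A\<close>, then spectral cut-offs of \<open>b\<close> above \<open>\<epsilon>\<close> are dominated by multiples of \<open>f x f\<close>.
  Lower semicontinuity then gives \<open>\<theta> (star v * v) = sup \<phi>\<^sub>c (star v * v)\<close>.
\<close>

section \<open>Continuous functional calculus\<close>

text \<open>The obstacle is that \<theta> lives on the cone only, may be infinite and is not norm
  continuous, whereas central sequences control nothing but norms. The functionals
  \<open>corner_functional c\<close> are norm bounded, and at \<open>star v * v\<close> they return
  a value of \<theta> itself, namely that of \<open>star (v * c) * (v * c)\<close>. This number is
  real, so an additive real form suffices, and the scalar \<eta> g is always moved inside the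
  algebra. Commutators with c must be small in the seminorm of \<theta>; each factor of c = h k
  supplies one finite seminorm, hence cut-offs built as products. Square roots and cut-offs come
  from a functional calculus derived from the C*-identity. Without a unit, 1 - z = (1 - s)^2 is
  written as s + s = z + s s and used by letting it act on elements.\<close>

lemma norm_eq_0_of_star_mult:
  fixes x :: "'a::cstar_algebra"
  shows "star x * x = 0 \<longleftrightarrow> x = 0"
  using norm_star_mult_self[of x] by auto

lemma mult_left_cancel_all:
  fixes x y :: "'a::cstar_algebra"
  assumes "\<And>z. x * z = y * z"
  shows "x = y"
proof -
  have "star (star (x - y)) * star (x - y) = 0"
    using assms[of "star (x - y)"] by (simp add: star_star left_diff_distrib)
  then show ?thesis unfolding norm_eq_0_of_star_mult by (metis star_star star_zero eq_iff_diff_eq_0)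
qed

lemma star_scaleR [simp]: "star (r *\<^sub>R x) = r *\<^sub>R star (x::'a::cstar_algebra)"
  by (simp add: scaleR_eq_scaleC star_scaleC)

lemma bounded_linear_star: "bounded_linear (star :: 'a::cstar_algebra \<Rightarrow> 'a)"
  by (rule bounded_linear_intro[of _ 1]) (auto simp: star_add)

lemmas tendsto_star [tendsto_intros] = bounded_linear.tendsto[OF bounded_linear_star]

text \<open>
  There need not be a unit, so a polynomial with a constant term only gives an operator:
  \<open>pact p x\<close> is left multiplication by \<open>p(x)\<close>.
\<close>

definition pact :: "real poly \<Rightarrow> 'a::cstar_algebra \<Rightarrow> 'a \<Rightarrow> 'a" where
  "pact p x y = fold_coeffs (\<lambda>c z. c *\<^sub>R y + x * z) p 0"

lemma pact_0 [simp]: "pact 0 x y = 0"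
  by (simp add: pact_def)

lemma pact_pCons [simp]: "pact (pCons c p) x y = c *\<^sub>R y + x * pact p x y"
  by (cases "p = 0 \<and> c = 0") (auto simp: pact_def)

lemma pact_add: "pact (p + q) x y = pact p x y + pact q x y"
  by (induction p q rule: poly_induct2) (simp_all add: algebra_simps)

lemma pact_smult: "pact (smult c p) x y = c *\<^sub>R pact p x y"
  by (induction p) (simp_all add: algebra_simps)

lemma pact_diff: "pact (p - q) x y = pact p x y - pact q x y"
  using pact_add[of "p - q" q x y] by simp

lemma pact_1 [simp]: "pact 1 x y = y"
  by (simp add: one_pCons)

lemma pact_add_right: "pact p x (y + z) = pact p x y + pact p x z"
  by (induction p) (simp_all add: algebra_simps)

lemma pact_scaleC_right: "pact p x (c *\<^sub>C y) = c *\<^sub>C pact p x y"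
  by (induction p) (simp_all add: scaleC_add_right scaleR_eq_scaleC scaleC_scaleC mult_scaleC_right mult.commute)

lemma pact_scaleR_right: "pact p x (c *\<^sub>R y) = c *\<^sub>R pact p x y"
  by (simp add: scaleR_eq_scaleC pact_scaleC_right)

lemma pact_diff_right: "pact p x (y - z) = pact p x y - pact p x z"
  using pact_add_right[of p x "y - z" z] by simp

lemma pact_zero_right [simp]: "pact p x 0 = 0"
  using pact_scaleR_right[of p x 0 0] by simp

lemma pact_mult: "pact (p * q) x y = pact p x (pact q x y)"
  by (induction p) (simp_all add: pact_add pact_smult)

lemma pact_mult_right: "pact p x (y * z) = pact p x y * z"
  by (induction p) (simp_all add: algebra_simps)

lemma pact_intertwine:
  assumes "x * z = z * x'"
  shows "pact p x (z * y) = z * pact p x' y"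
proof (induction p)
  case (pCons a p)
  then show ?case using assms by (simp add: distrib_left flip: mult.assoc)
qed simp

lemma pact_self_adjoint:
  assumes "star x = x"
  shows "star (pact p x y) * z = star y * pact p x z"
proof (induction p arbitrary: z)
  case (pCons a p)
  have "star (pact p x y) * (x * z) = star y * (x * pact p x z)"
    using pCons(2)[of "x * z"] by (simp only: pact_intertwine[OF refl])
  then show ?case by (simp add: star_add star_mult assms distrib_left distrib_right mult.assoc)
qed simp

lemma pact_pcompose:
  assumes "\<And>y. e * y = pact q x y"
  shows "pact (pcompose p q) x y = pact p e y"
  by (induction p) (simp_all add: pcompose_pCons pact_add pact_mult assms)

lemma pact_self_mult: "pact p x x * y = pact (pCons 0 p) x y"
  by (metis pact_mult_right pact_intertwine pact_pCons scaleR_zero_left add_0)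

text \<open>Meant for the isometry x + i (1 - s), which lies in the unitization only; so
  \<open>U\<close> is a map on the algebra and not an element of it.\<close>

definition opact :: "complex poly \<Rightarrow> ('a::cstar_algebra \<Rightarrow> 'a) \<Rightarrow> 'a \<Rightarrow> 'a" where
  "opact q U y = fold_coeffs (\<lambda>c z. c *\<^sub>C y + U z) q 0"

lemma opact_0 [simp]: "opact 0 U y = 0"
  by (simp add: opact_def)

lemma opact_pCons: "U 0 = 0 \<Longrightarrow> opact (pCons c q) U y = c *\<^sub>C y + U (opact q U y)"
  by (cases "q = 0 \<and> c = 0") (auto simp: opact_def)

lemma opact_add:
  assumes "U 0 = 0" "\<And>y z. U (y + z) = U y + U z"
  shows "opact (p + q) U y = opact p U y + opact q U y"
  by (induction p q rule: poly_induct2)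
     (simp_all add: assms opact_pCons scaleC_add_left algebra_simps)

lemma opact_smult:
  assumes "U 0 = 0" "\<And>c y. U (c *\<^sub>C y) = c *\<^sub>C U y"
  shows "opact (smult c p) U y = c *\<^sub>C opact p U y"
  by (induction p) (simp_all add: assms opact_pCons scaleC_add_right scaleC_scaleC)

lemma opact_monom:
  assumes "U 0 = 0"
  shows "opact (monom c n) U y = (U ^^ n) (c *\<^sub>C y)"
  using assms by (induction n) (simp_all add: monom_0 monom_Suc opact_pCons)

lemma norm_opact_le:
  assumes "U 0 = 0" "\<And>y. norm (U y) \<le> norm y" "degree q \<le> n" "\<And>i. cmod (coeff q i) \<le> M"
  shows "norm (opact q U y) \<le> (real n + 1) * M * norm y"
  using assms(3,4)
proof (induction n arbitrary: q)
  case 0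
  then obtain c where "q = [:c:]" using degree_eq_zeroE by auto
  then show ?case using 0(2)[of 0] by (simp add: opact_pCons assms norm_scaleC mult_right_mono)
next
  case (Suc n)
  obtain c q' where q: "q = pCons c q'" by (cases q)
  have "degree q' \<le> n" using Suc.prems(1) by (auto simp: q split: if_splits)
  moreover have "cmod (coeff q' i) \<le> M" for i using Suc.prems(2)[of "Suc i"] by (simp add: q)
  ultimately have "norm (opact q' U y) \<le> (real n + 1) * M * norm y" using Suc.IH by blast
  moreover have "norm (c *\<^sub>C y) \<le> M * norm y"
    using Suc.prems(2)[of 0] by (simp add: q norm_scaleC mult_right_mono)
  moreover have "norm (opact q U y) \<le> norm (c *\<^sub>C y) + norm (opact q' U y)"
    using norm_triangle_ineq[of "c *\<^sub>C y" "U (opact q' U y)"] assms(2)[of "opact q' U y"]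
    by (simp add: q opact_pCons assms(1))
  ultimately show ?case by (simp add: algebra_simps)
qed

text \<open>Orthogonality of the roots of unity: for 0 < |m| < N the ratio differs from 1 while its
  N-th power is 1, so the geometric sum vanishes.\<close>

lemma sum_cis_multiples:
  fixes m :: int and N :: nat
  assumes "N > 0" "\<bar>m\<bar> < int N"
  shows "(\<Sum>k<N. cis (2 * pi * of_int m / N) ^ k) = (if m = 0 then of_nat N else 0)"
proof (cases "m = 0")
  case False
  define w where "w = cis (2 * pi * of_int m / N)"
  have "w ^ N = cis (real N * (2 * pi * of_int m / N))" by (simp only: w_def Complex.DeMoivre)
  also have "real N * (2 * pi * of_int m / N) = 2 * pi * of_int m" using assms by simp
  finally have wN: "w ^ N = 1" by (simp add: cis_multiple_2pi)
  have "w \<noteq> 1"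
  proof
    assume "w = 1"
    then have "cos (2 * pi * of_int m / N) = 1" by (simp add: w_def complex_eq_iff)
    then obtain n :: int where "2 * pi * of_int m / N = of_int n * 2 * pi"
      using cos_one_2pi_int by metis
    then have "real_of_int m = of_int n * of_nat N"
      using assms(1) by (simp add: field_simps)
    then have "m = n * int N" by (metis of_int_eq_iff of_int_mult of_int_of_nat_eq)
    then show False using assms False by (auto simp: abs_mult)
  qed
  then show ?thesis using False wN by (simp add: geometric_sum flip: w_def)
qed (simp add: cis_zero)

text \<open>The coefficients are recovered by averaging over the roots of unity.\<close>

lemma coeff_le_circle_bound:
  fixes q :: "complex poly"
  assumes "\<And>t. cmod (poly q (cis t)) \<le> M"
  shows "cmod (coeff q j) \<le> M"
proof (cases "j \<le> degree q")
  case False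
  then show ?thesis using order_trans[OF norm_ge_zero assms] by (simp add: coeff_eq_0)
next
  case True
  \<comment> \<open>More nodes than the degree: the frequencies i - j stay below N in absolute
    value, so only i = j survives the average.\<close>
  define N where "N = Suc (degree q)"
  have N: "N > 0" by (simp add: N_def)
  let ?a = "\<lambda>k. 2 * pi * real k / N"
  have "(\<Sum>k<N. poly q (cis (?a k)) * cis (- (real j * ?a k))) =
      (\<Sum>k<N. \<Sum>i\<le>degree q. coeff q i * cis (2 * pi * of_int (int i - int j) / N) ^ k)"
  proof -
    have "cis (?a k) ^ i * cis (- (real j * ?a k)) = cis (2 * pi * of_int (int i - int j) / N) ^ k" for k i
      by (simp only: Complex.DeMoivre cis_mult) (simp add: field_simps diff_divide_distrib)
    then show ?thesis by (simp add: poly_altdef sum_distrib_right mult.assoc)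
  qed
  also have "\<dots> = (\<Sum>i\<le>degree q. coeff q i * (\<Sum>k<N. cis (2 * pi * of_int (int i - int j) / N) ^ k))"
    by (subst sum.swap) (simp add: sum_distrib_left)
  also have "\<dots> = (\<Sum>i\<le>degree q. coeff q i * (if i = j then of_nat N else 0))"
  proof (intro sum.cong refl arg_cong2[where f="(*)"])
    fix i assume "i \<in> {..degree q}"
    then have "\<bar>int i - int j\<bar> < int N" using True by (simp add: N_def abs_less_iff)
    from sum_cis_multiples[OF N this]
    show "(\<Sum>k<N. cis (2 * pi * of_int (int i - int j) / N) ^ k) = (if i = j then of_nat N else 0)"
      by (simp only: right_minus_eq of_nat_eq_iff)
  qed
  also have "\<dots> = coeff q j * of_nat N" using True by (simp add: if_distrib cong: if_cong)
  finally have eq: "coeff q j * of_nat N = (\<Sum>k<N. poly q (cis (?a k)) * cis (- (real j * ?a k)))" ..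
  have "cmod (coeff q j * of_nat N) \<le> (\<Sum>k<N. cmod (poly q (cis (?a k)) * cis (- (real j * ?a k))))"
    unfolding eq by (rule norm_sum)
  also have "\<dots> \<le> (\<Sum>k<N. M)"
    by (intro sum_mono) (simp add: norm_mult assms)
  finally show ?thesis using N by (simp add: norm_mult mult.commute)
qed

text \<open>
  By \<open>unitary_dilation\<close>, \<open>x\<close> acts as \<open>(U + V) / 2\<close> with isometries \<open>U = V\<^sup>-\<^sup>1\<close>, and
  \<open>p(cos t)\<close> is a trigonometric polynomial with at most \<open>2 d + 1\<close> coefficients, each bounded by \<open>M\<close>.
\<close>

lemma pact_crude_bound:
  fixes x :: "'a::cstar_algebra"
  assumes sa: "star x = x" and lt: "norm x < 1" and deg: "degree p \<le> d"
    and M: "\<And>t. \<bar>t\<bar> \<le> 1 \<Longrightarrow> \<bar>poly p t\<bar> \<le> M"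
  shows "norm (pact p x y) \<le> (2 * real d + 1) * M * norm y"
proof -
  obtain s where s: "star s = s" "s * x = x * s" "s + s = x * x + s * s"
    using unitary_dilation[OF sa lt] by blast
  \<comment> \<open>For c = i and c = -i this is multiplication by x + c (1 - s), where 1 - s plays
    the role of sqrt(1 - x^2). The two maps are inverse and adjoint to each other.\<close>
  define W where "W c y = x * y + c *\<^sub>C (y - s * y)" for c y
  define U V where "U = W \<i>" and "V = W (- \<i>)"
  have W0: "W c 0 = 0" for c by (simp add: W_def)
  have Wadd: "W c (y + z) = W c y + W c z" for c y z
    by (simp add: W_def scaleC_add_right scaleC_diff_right algebra_simps)
  have Wscale: "W c (b *\<^sub>C y) = b *\<^sub>C W c y" for c b y
    by (simp add: W_def scaleC_add_right scaleC_diff_right mult_scaleC_right scaleC_scaleC mult.commute)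
  have inv: "W c (W b y) = y" if "c = \<i> \<and> b = - \<i> \<or> c = - \<i> \<and> b = \<i>" for c b y
  proof -
    have sxy: "s * (x * y) = x * (s * y)" by (metis mult.assoc s(2))
    have ss: "x * (x * y) + s * (s * y) = s * y + s * y"
      by (metis distrib_right mult.assoc s(3))
    have cb: "c * b = 1" "c = - b" using that by auto
    have "W c (W b y) = x * (x * y) + b *\<^sub>C (x * y - x * (s * y))
        + (c *\<^sub>C (x * y - x * (s * y)) + (c * b) *\<^sub>C (y - s * y - s * y + s * (s * y)))"
      by (simp add: W_def distrib_left right_diff_distrib mult_scaleC_right scaleC_add_right
          scaleC_diff_right scaleC_scaleC sxy algebra_simps)
    also have "\<dots> = x * (x * y) + s * (s * y) + y - s * y - s * y"
      using scaleC_add_left[of b "- b" "x * y - x * (s * y)"]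
      unfolding cb(1) unfolding cb(2) by (simp add: scaleC_one algebra_simps)
    also have "\<dots> = y" using ss by simp
    finally show ?thesis .
  qed
  have UV: "U (V y) = y" and VU: "V (U y) = y" for y by (auto simp: U_def V_def inv)
  have adj: "star (U y) * z = star y * V z" for y z
    by (simp add: U_def V_def W_def star_add star_mult star_scaleC star_diff sa s(1) distrib_left
        distrib_right mult_scaleC_left mult_scaleC_right left_diff_distrib right_diff_distrib mult.assoc)
  have adj': "star (V y) * z = star y * U z" for y z
    by (simp add: U_def V_def W_def star_add star_mult star_scaleC star_diff sa s(1) distrib_left
        distrib_right mult_scaleC_left mult_scaleC_right left_diff_distrib right_diff_distrib mult.assoc)
  have normU: "norm (U y) = norm y" for y
    using norm_star_mult_self[of "U y"] norm_star_mult_self[of y] by (simp add: adj VU)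
  have normV: "norm (V y) = norm y" for y
    using norm_star_mult_self[of "V y"] norm_star_mult_self[of y] by (simp add: adj' UV)
  have UVsum: "U y + V y = 2 *\<^sub>C (x * y)" for y
  proof -
    have "U y + V y = x * y + x * y"
      using scaleC_add_left[of \<i> "- \<i>" "y - s * y"] by (simp add: U_def V_def W_def algebra_simps)
    also have "\<dots> = 2 *\<^sub>C (x * y)" using scaleC_add_left[of 1 1 "x * y"] by (simp add: scaleC_one)
    finally show ?thesis .
  qed
  have xU: "x * U y = (1/2) *\<^sub>C (y + U (U y))" for y
    using UVsum[of "U y"] by (simp add: VU scaleC_scaleC scaleC_one add.commute)
  have comm: "pact p x (U y) = U (pact p x y)" for p y
    using pact_intertwine[of x s x p y] pact_intertwine[of x x x p y] s(2)
    by (simp add: U_def W_def pact_add_right pact_scaleC_right pact_diff_right)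
  have U: "U 0 = 0" "\<And>y z. U (y + z) = U y + U z" "\<And>c y. U (c *\<^sub>C y) = c *\<^sub>C U y"
    by (simp_all add: U_def W0 Wadd Wscale)
  have Upow: "(U ^^ n) (c *\<^sub>C y) = c *\<^sub>C (U ^^ n) y" for n c y
    by (induction n) (simp_all add: U)
  \<comment> \<open>The power \<open>U ^^ d\<close> clears the negative powers of U: e^(i d t) p(cos
    t) is an ordinary polynomial in e^(i t).\<close>
  have "\<exists>q. degree q \<le> 2 * d \<and> (\<forall>t. poly q (cis t) = cis t ^ d * complex_of_real (poly p (cos t))) \<and>
      (\<forall>y. pact p x ((U ^^ d) y) = opact q U y)"
    using deg
  proof (induction d arbitrary: p)
    case 0
    then obtain c where p: "p = [:c:]" using degree_eq_zeroE by auto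
    show ?case by (rule exI[of _ "[:complex_of_real c:]"]) (simp add: p opact_pCons U scaleR_eq_scaleC)
  next
    case (Suc d)
    obtain c p' where p: "p = pCons c p'" by (cases p)
    have "degree p' \<le> d" using Suc.prems by (auto simp: p split: if_splits)
    then obtain q where q: "degree q \<le> 2 * d"
      "\<And>t. poly q (cis t) = cis t ^ d * complex_of_real (poly p' (cos t))"
      "\<And>y. pact p' x ((U ^^ d) y) = opact q U y"
      using Suc.IH by blast
    \<comment> \<open>Horner's step on the circle: e^(i (d+1) t) cos t = e^(i d t) (1 + e^(2 i t)) /
      2, and the double \<open>pCons 0\<close> multiplies by e^(2 i t).\<close>
    define q' where "q' = monom (complex_of_real c) (Suc d) + smult (1/2) (q + pCons 0 (pCons 0 q))"
    have "degree (q + pCons 0 (pCons 0 q)) \<le> 2 * Suc d"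
      by (rule degree_add_le) (use q(1) in \<open>auto intro: order_trans[OF degree_pCons_le]\<close>)
    then have "degree (smult (1/2) (q + pCons 0 (pCons 0 q))) \<le> 2 * Suc d"
      by (rule order_trans[OF degree_smult_le])
    then have "degree q' \<le> 2 * Suc d"
      unfolding q'_def by (intro degree_add_le order_trans[OF degree_monom_le]) auto
    moreover have "poly q' (cis t) = cis t ^ Suc d * complex_of_real (poly p (cos t))" for t
    proof -
      have "cis t * cis t + 1 = 2 * (cis t * complex_of_real (cos t))"
        by (simp add: complex_eq_iff cis_mult cos_double_cos sin_double flip: mult_2) (simp add: power2_eq_square)
      then have "(1 + cis t * cis t) / 2 = cis t * complex_of_real (cos t)" by (simp add: algebra_simps)
      moreover have "poly q' (cis t) = complex_of_real c * cis t ^ Suc d + (1 + cis t * cis t) / 2 * poly q (cis t)"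
        by (simp add: q'_def poly_monom field_simps)
      ultimately show ?thesis by (simp add: q(2) p field_simps)
    qed
    moreover have "pact p x ((U ^^ Suc d) y) = opact q' U y" for y
    proof -
      have "pact p x ((U ^^ Suc d) y) = c *\<^sub>R (U ^^ Suc d) y + x * U (opact q U y)"
        by (simp add: p q(3) comm del: funpow.simps) (simp add: comm q(3))
      then show ?thesis
        by (simp add: q'_def opact_add opact_smult opact_monom opact_pCons U xU Upow scaleR_eq_scaleC)
    qed
    ultimately show ?case by blast
  qed
  then obtain q where q: "degree q \<le> 2 * d"
      "\<And>t. poly q (cis t) = cis t ^ d * complex_of_real (poly p (cos t))"
      "\<And>y. pact p x ((U ^^ d) y) = opact q U y" by blast
  have co: "cmod (coeff q i) \<le> M" for i
    by (rule coeff_le_circle_bound) (simp add: q(2) norm_mult norm_power M)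
  define z where "z = (V ^^ d) y"
  have "(U ^^ n) ((V ^^ n) y) = y" for n y
    by (induction n arbitrary: y) (simp_all add: funpow_swap1 UV VU)
  then have "pact p x y = opact q U z" by (simp add: z_def flip: q(3))
  moreover have "norm z = norm y" unfolding z_def by (induction d) (simp_all add: normV)
  ultimately show ?thesis
    using norm_opact_le[of U q "2 * d" M z] U(1) normU q(1) co by simp
qed

text \<open>The factor linear in the degree disappears on passing to the powers \<open>p ^ (2 ^ m)\<close>.\<close>

lemma pact_bound:
  fixes x :: "'a::cstar_algebra"
  assumes sa: "star x = x" and lt: "norm x < 1"
    and M: "\<And>t. \<bar>t\<bar> \<le> 1 \<Longrightarrow> \<bar>poly p t\<bar> \<le> M"
  shows "norm (pact p x y) \<le> M * norm y"
proof (rule ccontr)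
  assume neg: "\<not> ?thesis"
  have M0: "0 \<le> M" using M[of 0] by simp
  have y: "norm y > 0" using neg by (cases "y = 0") auto
  \<comment> \<open>The C*-identity and self-adjointness bound the squared norm of p^k(x) y by norm
    y times the norm of p^(2k)(x) y; each iteration doubles k.\<close>
  have step: "norm (pact p x y) ^ (2 ^ m) \<le> norm y ^ (2 ^ m - 1) * norm (pact (p ^ (2 ^ m)) x y)" for m
  proof (induction m)
    case (Suc m)
    let ?z = "pact (p ^ (2 ^ m)) x y"
    have "(norm ?z)\<^sup>2 = norm (star y * pact (p ^ (2 ^ Suc m)) x y)"
      by (simp add: pact_self_adjoint[OF sa] mult_2 power_add pact_mult flip: norm_star_mult_self)
    also have "\<dots> \<le> norm y * norm (pact (p ^ (2 ^ Suc m)) x y)"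
      using norm_mult_ineq[of "star y"] by simp
    finally have z: "(norm ?z)\<^sup>2 \<le> norm y * norm (pact (p ^ (2 ^ Suc m)) x y)" .
    have e: "(2::nat) ^ Suc m - 1 = (2 ^ m - 1) * 2 + 1"
      by (cases "(2::nat) ^ m") auto
    have "norm (pact p x y) ^ (2 ^ Suc m) = (norm (pact p x y) ^ (2 ^ m))\<^sup>2"
      by (simp add: mult.commute flip: power_mult)
    also have "\<dots> \<le> (norm y ^ (2 ^ m - 1) * norm ?z)\<^sup>2"
      using Suc by (intro power_mono) auto
    also have "\<dots> = norm y ^ ((2 ^ m - 1) * 2) * (norm ?z)\<^sup>2"
      by (simp add: power_mult_distrib flip: power_mult)
    also have "\<dots> \<le> norm y ^ ((2 ^ m - 1) * 2) * (norm y * norm (pact (p ^ (2 ^ Suc m)) x y))"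
      using z by (intro mult_left_mono) auto
    also have "\<dots> = norm y ^ (2 ^ Suc m - 1) * norm (pact (p ^ (2 ^ Suc m)) x y)"
      unfolding e by (simp add: power_add)
    finally show ?case .
  qed simp
  define r where "r = norm (pact p x y) / norm y"
  have r: "M < r" using neg y by (simp add: r_def field_simps)
  have le: "r ^ (2 ^ m) \<le> (2 * real (degree p) * 2 ^ m + 1) * M ^ (2 ^ m)" for m
  proof -
    have "norm (pact (p ^ (2 ^ m)) x y) \<le> (2 * real (degree p * 2 ^ m) + 1) * M ^ (2 ^ m) * norm y"
      by (rule pact_crude_bound[OF sa lt degree_power_le])
         (simp add: power_abs power_mono M)
    then have "norm (pact p x y) ^ (2 ^ m) \<le> norm y ^ (2 ^ m - 1) * ((2 * real (degree p) * 2 ^ m + 1) * M ^ (2 ^ m) * norm y)"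
      using order_trans[OF step[of m] mult_left_mono[of _ _ "norm y ^ (2 ^ m - 1)"]] by (simp add: mult.assoc)
    also have "\<dots> = norm y ^ (2 ^ m) * ((2 * real (degree p) * 2 ^ m + 1) * M ^ (2 ^ m))"
      by (simp add: power_eq_if[of "norm y" "2 ^ m"])
    finally show ?thesis using y by (simp add: r_def power_divide field_simps)
  qed
  show False
  proof (cases "M = 0")
    case True
    then show False using le[of 0] r by simp
  next
    case False
    define \<rho> where "\<rho> = r / M"
    have \<rho>: "1 < \<rho>" using False M0 r by (simp add: \<rho>_def)
    have "\<rho> ^ (2 ^ m) \<le> 2 * real (degree p) * real (2 ^ m) + 1" for m
      using le[of m] M0 False by (simp add: \<rho>_def power_divide field_simps)
    moreover have "\<forall>\<^sub>F n in sequentially. 2 * real (degree p) * real n + 1 < \<rho> ^ n"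
      using \<rho> by real_asymp
    then obtain n0 where "\<And>n. n \<ge> n0 \<Longrightarrow> 2 * real (degree p) * real n + 1 < \<rho> ^ n"
      by (auto simp: eventually_sequentially)
    moreover have "(2::nat) ^ n0 \<ge> n0" by simp
    ultimately show False by (meson not_le)
  qed
qed

text \<open>The element x p(x), that is, t p(t) evaluated at x: the polynomials without constant
  term are those with a value in an algebra without unit.\<close>

definition pel :: "real poly \<Rightarrow> 'a::cstar_algebra \<Rightarrow> 'a" where
  "pel p x = pact p x x"

lemma pel_mult: "pel p x * y = pact (pCons 0 p) x y"
  by (simp add: pel_def pact_self_mult)

lemma pel_star:
  assumes "star x = x"
  shows "star (pel p x) = pel p x"
proof (rule mult_left_cancel_all)
  show "star (pel p x) * z = pel p x * z" for z
    using pact_self_adjoint[OF assms, of p x z] by (simp add: pel_def assms pact_self_mult)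
qed

text \<open>For the self-adjoint z = x p(x) the squared norm is the norm of z z, and the second z
  can be treated as a vector on which the operator t p(t) acts.\<close>

lemma norm_pel_le:
  fixes x :: "'a::cstar_algebra"
  assumes sa: "star x = x" and lt: "norm x < 1"
    and M: "\<And>t. \<bar>t\<bar> \<le> 1 \<Longrightarrow> \<bar>t * poly p t\<bar> \<le> M"
  shows "norm (pel p x) \<le> M"
proof (cases "pel p x = 0")
  case True
  then show ?thesis using M[of 0] by simp
next
  case False
  have "(norm (pel p x))\<^sup>2 = norm (pel p x * pel p x)"
    by (simp add: pel_star[OF sa] flip: norm_star_mult_self)
  also have "\<dots> \<le> M * norm (pel p x)"
    unfolding pel_mult by (rule pact_bound[OF sa lt]) (simp add: M)
  finally show ?thesis using False by (simp add: power2_eq_square)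
qed

definition czero :: "(real \<Rightarrow> real) \<Rightarrow> bool" where
  "czero f \<longleftrightarrow> continuous_on {-1..1} f \<and> f 0 = 0"

definition approx_polys :: "(real \<Rightarrow> real) \<Rightarrow> (nat \<Rightarrow> real poly) \<Rightarrow> bool" where
  "approx_polys f p \<longleftrightarrow> uniform_limit {-1..1} (\<lambda>n t. t * poly (p n) t) f sequentially"

text \<open>Continuous functional calculus; junk unless \<open>star x = x\<close>, \<open>norm x < 1\<close>, \<open>czero f\<close>.\<close>

definition cfc :: "'a::cstar_algebra \<Rightarrow> (real \<Rightarrow> real) \<Rightarrow> 'a" where
  "cfc x f = lim (\<lambda>n. pel ((SOME p. approx_polys f p) n) x)"

text \<open>Weierstrass gives a polynomial with a constant term c. As f vanishes at 0, |c| is below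
  the tolerance and dropping c costs as much again; hence the halved tolerance.\<close>

lemma ex_approx_polys:
  assumes "czero f"
  shows "\<exists>p. approx_polys f p"
proof -
  have ex: "\<exists>p. \<forall>t\<in>{-1..1}. \<bar>t * poly p t - f t\<bar> < 1 / (real n + 1)" for n
  proof -
    have "0 < 1 / (real n + 1) / 2" by simp
    then obtain g where g: "real_polynomial_function g" "\<And>t. t \<in> {-1..1} \<Longrightarrow> \<bar>f t - g t\<bar> < 1 / (real n + 1) / 2"
      using Stone_Weierstrass_real_polynomial_function[of "{-1..1}" f "1 / (real n + 1) / 2"] assms
      unfolding czero_def by (metis compact_Icc)
    obtain a N where a: "g = (\<lambda>t. \<Sum>i\<le>N. a i * t ^ i)"
      using g(1) unfolding real_polynomial_function_iff_sum by blast
    obtain c p where cp: "(\<Sum>i\<le>N. monom (a i) i) = pCons c p" by (cases "(\<Sum>i\<le>N. monom (a i) i)")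
    have gp: "g t = c + t * poly p t" for t
    proof -
      have "g t = poly (\<Sum>i\<le>N. monom (a i) i) t" by (simp add: a poly_sum poly_monom)
      then show ?thesis by (simp add: cp)
    qed
    have "\<bar>c\<bar> < 1 / (real n + 1) / 2" using g(2)[of 0] assms by (simp add: gp czero_def)
    then have "\<bar>t * poly p t - f t\<bar> < 1 / (real n + 1)" if "t \<in> {-1..1}" for t
    proof -
      define A where "A = 1 / (real n + 1)"
      show ?thesis using g(2)[OF that] \<open>\<bar>c\<bar> < _\<close> unfolding gp A_def[symmetric] by linarith
    qed
    then show ?thesis by blast
  qed
  obtain p where p: "\<And>n t. t \<in> {-1..1} \<Longrightarrow> \<bar>t * poly (p n) t - f t\<bar> < 1 / (real n + 1)"
    using ex by metis
  have "approx_polys f p"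
    unfolding approx_polys_def uniform_limit_iff
  proof (intro allI impI)
    fix e :: real assume "e > 0"
    then have "\<forall>\<^sub>F n in sequentially. 1 / (real n + 1) < e" by real_asymp
    then show "\<forall>\<^sub>F n in sequentially. \<forall>t\<in>{-1..1}. dist (t * poly (p n) t) (f t) < e"
    proof eventually_elim
      case (elim n)
      then show ?case unfolding dist_real_def using p order_less_trans by blast
    qed
  qed
  then show ?thesis by blast
qed

lemma pel_diff: "pel (p - q) x = pel p x - pel q x"
  by (simp add: pel_def pact_diff)

text \<open>The uniform bound on \<open>pel\<close> makes any two approximating sequences of f
  Cauchy relative to each other. So the choice made in \<open>cfc\<close> is immaterial, and each
  rule below follows by picking a sequence suited to it.\<close>

lemma cfc_LIMSEQ:
  fixes x :: "'a::cstar_algebra"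
  assumes sa: "star x = x" "norm x < 1" and f: "czero f" and p: "approx_polys f p"
  shows "(\<lambda>n. pel (p n) x) \<longlonglongrightarrow> cfc x f"
proof -
  define P where "P = (SOME p. approx_polys f p)"
  have P: "approx_polys f P" unfolding P_def using ex_approx_polys[OF f] by (rule someI_ex)
  have close: "\<exists>N. \<forall>m\<ge>N. \<forall>n\<ge>N. norm (pel (r m) x - pel (q n) x) \<le> e"
    if r: "approx_polys f r" and q: "approx_polys f q" and e: "e > 0" for r q and e :: real
  proof -
    have "\<forall>\<^sub>F n in sequentially. \<forall>t\<in>{-1..1}. \<bar>t * poly (r n) t - f t\<bar> < e / 2"
      "\<forall>\<^sub>F n in sequentially. \<forall>t\<in>{-1..1}. \<bar>t * poly (q n) t - f t\<bar> < e / 2"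
      using r q half_gt_zero[OF e] unfolding approx_polys_def uniform_limit_iff dist_real_def by blast+
    then have "\<forall>\<^sub>F n in sequentially. (\<forall>t\<in>{-1..1}. \<bar>t * poly (r n) t - f t\<bar> < e / 2) \<and>
        (\<forall>t\<in>{-1..1}. \<bar>t * poly (q n) t - f t\<bar> < e / 2)"
      by (rule eventually_conj)
    then obtain N where N: "\<And>n t. n \<ge> N \<Longrightarrow> t \<in> {-1..1} \<Longrightarrow> \<bar>t * poly (r n) t - f t\<bar> < e / 2"
      "\<And>n t. n \<ge> N \<Longrightarrow> t \<in> {-1..1} \<Longrightarrow> \<bar>t * poly (q n) t - f t\<bar> < e / 2"
      unfolding eventually_sequentially by blast
    have "norm (pel (r m) x - pel (q n) x) \<le> e" if "m \<ge> N" "n \<ge> N" for m n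
      unfolding pel_diff[symmetric]
    proof (rule norm_pel_le[OF sa])
      fix t :: real assume "\<bar>t\<bar> \<le> 1"
      then have "t \<in> {-1..1}" by auto
      from N(1)[OF that(1) this] N(2)[OF that(2) this]
      show "\<bar>t * poly (r m - q n) t\<bar> \<le> e" unfolding poly_diff right_diff_distrib by linarith
    qed
    then show ?thesis by blast
  qed
  have "Cauchy (\<lambda>n. pel (P n) x)"
  proof (rule CauchyI)
    fix e :: real assume "e > 0"
    then have "e / 2 < e" by simp
    with close[OF P P half_gt_zero[OF \<open>e > 0\<close>]]
    show "\<exists>M. \<forall>m\<ge>M. \<forall>n\<ge>M. norm (pel (P m) x - pel (P n) x) < e"
      by (meson order_le_less_trans)
  qed
  then have lim: "(\<lambda>n. pel (P n) x) \<longlonglongrightarrow> cfc x f"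
    unfolding cfc_def P_def using Cauchy_convergent convergent_LIMSEQ_iff by blast
  have "(\<lambda>n. pel (p n) x - pel (P n) x) \<longlonglongrightarrow> 0"
  proof (rule LIMSEQ_I)
    fix e :: real assume "e > 0"
    then obtain N where "\<forall>m\<ge>N. \<forall>n\<ge>N. norm (pel (p m) x - pel (P n) x) \<le> e / 2"
      using close[OF p P half_gt_zero] by blast
    then have "\<forall>n\<ge>N. norm (pel (p n) x - pel (P n) x) \<le> e / 2" by blast
    moreover have "e / 2 < e" using \<open>e > 0\<close> by simp
    ultimately show "\<exists>N. \<forall>n\<ge>N. norm (pel (p n) x - pel (P n) x - 0) < e"
      by (metis diff_zero order_le_less_trans)
  qed
  from tendsto_add[OF this lim] show ?thesis by simp
qed

lemma czero_bounded:
  assumes "czero f"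
  shows "bounded (f ` {-1..1})"
  using assms by (intro compact_imp_bounded compact_continuous_image) (auto simp: czero_def)

section \<open>Algebraic rules of the functional calculus\<close>

lemma approx_polys_add:
  "approx_polys f p \<Longrightarrow> approx_polys g q \<Longrightarrow> approx_polys (\<lambda>t. f t + g t) (\<lambda>n. p n + q n)"
  unfolding approx_polys_def by (simp add: distrib_left uniform_limit_add)

lemma approx_polys_scale:
  assumes "approx_polys f p"
  shows "approx_polys (\<lambda>t. c * f t) (\<lambda>n. smult c (p n))"
  using bounded_linear.uniform_limit[OF bounded_linear_mult_right assms[unfolded approx_polys_def], of c]
  by (simp add: approx_polys_def mult.left_commute)

lemma approx_polys_mult:
  assumes "approx_polys f p" "approx_polys g q" "czero f" "czero g"
  shows "approx_polys (\<lambda>t. f t * g t) (\<lambda>n. pCons 0 (p n * q n))"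
  using uniform_lim_mult[OF assms(1,2)[unfolded approx_polys_def] assms(3,4)[THEN czero_bounded]]
  by (simp add: approx_polys_def mult_ac)

lemma pel_pCons_mult: "pel (pCons 0 (p * q)) x = pel p x * pel q x"
  by (simp add: pel_mult) (simp add: pel_def pact_mult)

lemma czero_add: "czero f \<Longrightarrow> czero g \<Longrightarrow> czero (\<lambda>t. f t + g t)"
  and czero_diff: "czero f \<Longrightarrow> czero g \<Longrightarrow> czero (\<lambda>t. f t - g t)"
  and czero_mult: "czero f \<Longrightarrow> czero g \<Longrightarrow> czero (\<lambda>t. f t * g t)"
  and czero_scale: "czero f \<Longrightarrow> czero (\<lambda>t. c * f t)"
  and czero_ident: "czero (\<lambda>t. t)"
  by (auto simp: czero_def intro!: continuous_intros)

context
  fixes x :: "'a::cstar_algebra"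
  assumes sa: "star x = x" and lt: "norm x < 1"
begin

lemma cfc_add:
  assumes "czero f" "czero g"
  shows "cfc x (\<lambda>t. f t + g t) = cfc x f + cfc x g"
proof -
  obtain p q where pq: "approx_polys f p" "approx_polys g q" using assms ex_approx_polys by metis
  have "(\<lambda>n. pel (p n + q n) x) \<longlonglongrightarrow> cfc x f + cfc x g"
    unfolding pel_def pact_add using cfc_LIMSEQ[OF sa lt] assms pq
    by (intro tendsto_add) (auto simp: pel_def)
  then show ?thesis
    using cfc_LIMSEQ[OF sa lt czero_add[OF assms] approx_polys_add[OF pq]] LIMSEQ_unique by blast
qed

lemma cfc_scale:
  assumes "czero f"
  shows "cfc x (\<lambda>t. c * f t) = c *\<^sub>R cfc x f"
proof -
  obtain p where p: "approx_polys f p" using assms ex_approx_polys by metis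
  have "(\<lambda>n. pel (smult c (p n)) x) \<longlonglongrightarrow> c *\<^sub>R cfc x f"
    unfolding pel_def pact_smult using cfc_LIMSEQ[OF sa lt assms p]
    by (intro tendsto_scaleR) (auto simp: pel_def)
  then show ?thesis
    using cfc_LIMSEQ[OF sa lt czero_scale[OF assms] approx_polys_scale[OF p]] LIMSEQ_unique by blast
qed

lemma cfc_diff:
  assumes "czero f" "czero g"
  shows "cfc x (\<lambda>t. f t - g t) = cfc x f - cfc x g"
  using cfc_add[OF czero_diff[OF assms] assms(2)] by simp

lemma cfc_mult:
  assumes "czero f" "czero g"
  shows "cfc x (\<lambda>t. f t * g t) = cfc x f * cfc x g"
proof -
  obtain p q where pq: "approx_polys f p" "approx_polys g q" using assms ex_approx_polys by metis
  have "(\<lambda>n. pel (pCons 0 (p n * q n)) x) \<longlonglongrightarrow> cfc x f * cfc x g"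
    unfolding pel_pCons_mult using cfc_LIMSEQ[OF sa lt] assms pq by (intro tendsto_mult) auto
  then show ?thesis
    using cfc_LIMSEQ[OF sa lt czero_mult[OF assms] approx_polys_mult[OF pq assms]] LIMSEQ_unique by blast
qed

lemma cfc_ident: "cfc x (\<lambda>t. t) = x"
proof -
  have "approx_polys (\<lambda>t. t) (\<lambda>_. 1)" by (simp add: approx_polys_def uniform_limit_iff)
  from cfc_LIMSEQ[OF sa lt czero_ident this] show ?thesis
    by (simp add: pel_def LIMSEQ_const_iff)
qed

lemma cfc_star:
  assumes "czero f"
  shows "star (cfc x f) = cfc x f"
proof -
  obtain p where p: "approx_polys f p" using assms ex_approx_polys by metis
  note lim = cfc_LIMSEQ[OF sa lt assms p]
  show ?thesis using tendsto_star[OF lim] lim LIMSEQ_unique by (simp add: pel_star[OF sa]) blast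
qed

lemma norm_cfc_le:
  assumes f: "czero f" and M: "\<And>t. \<bar>t\<bar> \<le> 1 \<Longrightarrow> \<bar>f t\<bar> \<le> M"
  shows "norm (cfc x f) \<le> M"
proof (rule field_le_epsilon)
  fix e :: real assume e: "e > 0"
  obtain p where p: "approx_polys f p" using f ex_approx_polys by metis
  have "\<forall>\<^sub>F n in sequentially. \<forall>t\<in>{-1..1}. \<bar>t * poly (p n) t - f t\<bar> < e"
    using p e by (simp add: approx_polys_def uniform_limit_iff dist_real_def)
  then have "\<forall>\<^sub>F n in sequentially. norm (pel (p n) x) \<le> M + e"
  proof eventually_elim
    case (elim n)
    show ?case
    proof (rule norm_pel_le[OF sa lt])
      fix t :: real assume t: "\<bar>t\<bar> \<le> 1"
      then have "t \<in> {-1..1}" by auto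
      then have "\<bar>t * poly (p n) t - f t\<bar> < e" using elim by blast
      then show "\<bar>t * poly (p n) t\<bar> \<le> M + e" using M[OF t] by linarith
    qed
  qed
  then show "norm (cfc x f) \<le> M + e"
    using tendsto_norm[OF cfc_LIMSEQ[OF sa lt f p]] tendsto_upperbound by force
qed

lemma cfc_zero:
  assumes "czero f" "\<And>t. \<bar>t\<bar> \<le> 1 \<Longrightarrow> f t = 0"
  shows "cfc x f = 0"
  using norm_cfc_le[of f 0] assms by simp

lemma cfc_cong:
  assumes "czero f" "czero g" "\<And>t. \<bar>t\<bar> \<le> 1 \<Longrightarrow> f t = g t"
  shows "cfc x f = cfc x g"
  using cfc_diff[OF assms(1,2)] cfc_zero[OF czero_diff[OF assms(1,2)]] assms(3) by simp

text \<open>Polynomial substitutions are enough: t^2 leads from a square root r to r r, and -t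
  exchanges the positive and the negative part.\<close>

lemma cfc_compose_poly:
  assumes e: "norm (pel q x) < 1" and q: "\<And>t. \<bar>t\<bar> \<le> 1 \<Longrightarrow> \<bar>t * poly q t\<bar> \<le> 1" and f: "czero f"
  shows "cfc (pel q x) f = cfc x (\<lambda>t. f (t * poly q t))"
proof -
  obtain p where p: "approx_polys f p" using f ex_approx_polys by metis
  \<comment> \<open>With s = t q(t), the approximant s p_n(s) is t times this polynomial.\<close>
  let ?p = "\<lambda>n. pcompose (p n) (pCons 0 q) * q"
  have cz: "czero (\<lambda>t. f (t * poly q t))"
    using f q unfolding czero_def
    by (auto intro!: continuous_on_compose2[of "{-1..1}" f] continuous_intros simp: abs_le_iff)
  have "approx_polys (\<lambda>t. f (t * poly q t)) ?p"
    unfolding approx_polys_def uniform_limit_iff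
  proof (intro allI impI)
    fix \<epsilon> :: real assume "\<epsilon> > 0"
    then have "\<forall>\<^sub>F n in sequentially. \<forall>t\<in>{-1..1}. dist (t * poly (p n) t) (f t) < \<epsilon>"
      using p by (simp add: approx_polys_def uniform_limit_iff)
    then show "\<forall>\<^sub>F n in sequentially. \<forall>t\<in>{-1..1}. dist (t * poly (?p n) t) (f (t * poly q t)) < \<epsilon>"
    proof eventually_elim
      case (elim n)
      show ?case
      proof
        fix t :: real assume "t \<in> {-1..1}"
        then have "t * poly q t \<in> {-1..1}" using q[of t] by (auto simp: abs_le_iff)
        from elim[rule_format, OF this]
        show "dist (t * poly (?p n) t) (f (t * poly q t)) < \<epsilon>"
          by (simp add: poly_pcompose mult_ac)
      qed
    qed
  qed
  from cfc_LIMSEQ[OF sa lt cz this]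
  have "(\<lambda>n. pel (?p n) x) \<longlonglongrightarrow> cfc x (\<lambda>t. f (t * poly q t))" .
  moreover have "pel (?p n) x = pel (p n) (pel q x)" for n
  proof -
    have "pel (?p n) x = pact (pcompose (p n) (pCons 0 q)) x (pel q x)"
      by (simp add: pel_def pact_mult)
    also have "\<dots> = pact (p n) (pel q x) (pel q x)"
      by (rule pact_pcompose) (rule pel_mult)
    finally show ?thesis by (simp add: pel_def)
  qed
  ultimately show ?thesis
    using cfc_LIMSEQ[OF pel_star[OF sa] e f p] LIMSEQ_unique by fastforce
qed

end

text \<open>The case of interest is x = c * star c, x' = star c * c, z = c: then c carries spectral
  parts of one product to those of the other.\<close>

lemma cfc_intertwine:
  fixes x x' z :: "'a::cstar_algebra"
  assumes "star x = x" "norm x < 1" "star x' = x'" "norm x' < 1" "x * z = z * x'" "czero f"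
  shows "cfc x f * z = z * cfc x' f"
proof -
  obtain p where p: "approx_polys f p" using assms(6) ex_approx_polys by metis
  have "pel (p n) x * z = z * pel (p n) x'" for n
    using pact_intertwine[OF assms(5), of "p n" x'] assms(5) pact_mult_right[of "p n" x x z]
    by (simp add: pel_def)
  then have "(\<lambda>n. pel (p n) x * z) \<longlonglongrightarrow> z * cfc x' f"
    using tendsto_mult[OF tendsto_const cfc_LIMSEQ[OF assms(3,4,6) p]] by simp
  moreover have "(\<lambda>n. pel (p n) x * z) \<longlonglongrightarrow> cfc x f * z"
    using tendsto_mult[OF cfc_LIMSEQ[OF assms(1,2,6) p] tendsto_const] by simp
  ultimately show ?thesis using LIMSEQ_unique by blast
qed

section \<open>Positive elements\<close>

text \<open>A self-adjoint root can be fed to the functional calculus, an arbitrary y with h = star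
  y * y cannot. That the two notions agree is the content of \<open>pos_star_mult\<close>.\<close>

definition pos :: "'a::cstar_algebra \<Rightarrow> bool" where
  "pos h \<longleftrightarrow> (\<exists>r. star r = r \<and> h = r * r)"

lemma pos_star: "pos h \<Longrightarrow> star h = h"
  by (auto simp: pos_def star_mult)

lemma norm_square_sa: "star r = r \<Longrightarrow> norm (r * r) = (norm r)\<^sup>2" for r :: "'a::cstar_algebra"
  by (metis norm_star_mult_self)

lemma square_sa_eq_0: "star r = r \<Longrightarrow> r * r = 0 \<longleftrightarrow> r = 0" for r :: "'a::cstar_algebra"
  by (metis norm_eq_0_of_star_mult)

lemma pos_0 [simp]: "pos 0"
  by (auto simp: pos_def intro!: exI[of _ 0])

lemma pos_scale:
  assumes "pos h" "t \<ge> 0"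
  shows "pos (t *\<^sub>R h)"
proof -
  obtain r where "star r = r" "h = r * r" using assms(1) by (auto simp: pos_def)
  then show ?thesis
    using assms(2) by (auto simp: pos_def intro!: exI[of _ "sqrt t *\<^sub>R r"])
qed

lemma pos_scale_iff: "t > 0 \<Longrightarrow> pos (t *\<^sub>R h) \<longleftrightarrow> pos h"
  using pos_scale[of h t] pos_scale[of "t *\<^sub>R h" "1 / t"] by auto

section \<open>Positive and negative parts; sums of positive elements\<close>

lemma czero_parts: "czero (\<lambda>t. max (- t) 0)" "czero (\<lambda>t. max t 0)"
  by (auto simp: czero_def intro!: continuous_intros)

lemma cfc_parts:
  fixes h :: "'a::cstar_algebra"
  assumes "star h = h" "norm h < 1"
  shows "h = cfc h (\<lambda>t. max t 0) - cfc h (\<lambda>t. max (- t) 0)"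
proof -
  have "cfc h (\<lambda>t. max t 0) - cfc h (\<lambda>t. max (- t) 0) = cfc h (\<lambda>t. max t 0 - max (- t) 0)"
    by (simp add: cfc_diff[OF assms] czero_parts)
  also have "(\<lambda>t::real. max t 0 - max (- t) 0) = (\<lambda>t. t)" by (auto simp: max_def)
  finally show ?thesis by (simp add: cfc_ident[OF assms])
qed

lemma pos_norm_root:
  fixes r :: "'a::cstar_algebra"
  assumes "star r = r" "norm (r * r) < 1"
  shows "norm r < 1"
  using assms by (simp add: norm_square_sa power2_eq_square abs_square_less_1 flip: power2_eq_square)

text \<open>Expressed in a self-adjoint root of h, the negative part is the function max(-t^2, 0),
  which is zero.\<close>

lemma pos_negative_part:
  fixes h :: "'a::cstar_algebra"
  assumes "pos h" "norm h < 1"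
  shows "cfc h (\<lambda>t. max (- t) 0) = 0"
proof -
  obtain r where r: "star r = r" "h = r * r" using assms(1) by (auto simp: pos_def)
  have r1: "norm r < 1" using pos_norm_root r assms(2) by blast
  have h: "h = pel [:0, 1:] r" by (simp add: pel_def r)
  have "cfc h (\<lambda>t. max (- t) 0) = cfc r (\<lambda>t. max (- (t * poly [:0, 1:] t)) 0)"
    unfolding h by (rule cfc_compose_poly[OF r(1) r1])
      (use assms(2) h in \<open>auto simp: czero_parts abs_square_le_1 simp flip: power2_eq_square\<close>)
  also have "\<dots> = 0"
    by (rule cfc_zero[OF r(1) r1]) (auto simp: czero_def intro!: continuous_intros)
  finally show ?thesis .
qed

text \<open>With h = r r, the operator 1 - h is 1 - t^2 at r, and 0 <= 1 - t^2 <= 1 on [-1, 1].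
  Together with \<open>contractive_imp_pos\<close> this describes positivity by a condition that is
  convex in h.\<close>

lemma pos_imp_contractive:
  fixes h :: "'a::cstar_algebra"
  assumes "pos h" "norm h < 1"
  shows "norm (y - h * y) \<le> norm y"
proof -
  obtain r where r: "star r = r" "h = r * r" using assms(1) by (auto simp: pos_def)
  have r1: "norm r < 1" using pos_norm_root r assms(2) by blast
  have "norm (pact [:1, 0, - 1:] r y) \<le> 1 * norm y"
  proof (rule pact_bound[OF r(1) r1])
    fix t :: real assume "\<bar>t\<bar> \<le> 1"
    then have "t\<^sup>2 \<le> 1" by (simp add: abs_square_le_1)
    then show "\<bar>poly [:1, 0, - 1:] t\<bar> \<le> 1" by (simp add: power2_eq_square)
  qed
  then show ?thesis by (simp add: r mult.assoc)
qed

lemma negative_part_zero_imp_pos: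
  fixes h :: "'a::cstar_algebra"
  assumes sa: "star h = h" "norm h < 1" and "cfc h (\<lambda>t. max (- t) 0) = 0"
  shows "pos h"
proof -
  have cz: "czero (\<lambda>t. sqrt (max t 0))" by (auto simp: czero_def intro!: continuous_intros)
  have "h = cfc h (\<lambda>t. max t 0)" using cfc_parts[OF sa] assms(3) by simp
  also have "(\<lambda>t::real. max t 0) = (\<lambda>t. sqrt (max t 0) * sqrt (max t 0))" by simp
  also have "cfc h \<dots> = cfc h (\<lambda>t. sqrt (max t 0)) * cfc h (\<lambda>t. sqrt (max t 0))"
    by (rule cfc_mult[OF sa cz cz])
  finally show ?thesis using cfc_star[OF sa cz] by (auto simp: pos_def)
qed

text \<open>On the negative part of \<open>h\<close> the powers of \<open>1 - h\<close> grow without bound.\<close>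

lemma contractive_imp_pos:
  fixes h :: "'a::cstar_algebra"
  assumes sa: "star h = h" "norm h < 1" and contr: "\<And>y. norm (y - h * y) \<le> norm y"
  shows "pos h"
proof -
  let ?n = "\<lambda>t::real. max (- t) 0"
  \<comment> \<open>Where \<open>?n t\<close> is nonzero, 1 + ?n t is 1 - t; so \<open>g k\<close>
    represents (1 - h)^k applied to the negative part.\<close>
  define g where "g k t = (1 + ?n t) ^ k * ?n t" for k :: nat and t
  have cg: "czero (g k)" for k by (auto simp: czero_def g_def intro!: continuous_intros)
  have g: "norm (cfc h (g k)) \<le> norm (cfc h ?n)" for k
  proof (induction k)
    case (Suc k)
    have "g (Suc k) = (\<lambda>t. g k t - t * g k t)" by (auto simp: g_def max_def algebra_simps)
    then have "cfc h (g (Suc k)) = cfc h (g k) - h * cfc h (g k)"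
      by (simp add: cfc_diff[OF sa] cfc_mult[OF sa] cfc_ident[OF sa] czero_mult czero_ident cg)
    then show ?case using contr Suc order_trans by metis
  qed (simp add: g_def)
  have "real k * (norm (cfc h ?n))\<^sup>2 \<le> norm (cfc h ?n)" for k :: nat
  proof -
    \<comment> \<open>Chosen so that w times \<open>g k\<close> is k times the square of the
      negative part, while Bernoulli's inequality bounds w by 1.\<close>
    define w where "w t = real k * ?n t / (1 + ?n t) ^ k" for t
    have nz: "1 + ?n t > 0" for t by simp
    have cw: "czero w" unfolding czero_def w_def
      by (auto intro!: continuous_intros simp: add_pos_nonneg[THEN less_imp_neq, THEN not_sym])
    have "\<bar>w t\<bar> \<le> 1" for t
    proof -
      have "real k * ?n t \<le> (1 + ?n t) ^ k"
      proof -
        have "-1 \<le> ?n t" by simp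
        from Bernoulli_inequality[OF this, of k] show ?thesis by (simp only: mult.commute)
      qed
      moreover have "0 \<le> w t" by (simp add: w_def)
      ultimately show ?thesis using nz[of t] by (simp add: w_def)
    qed
    then have "norm (cfc h w) \<le> 1" by (intro norm_cfc_le[OF sa cw])
    moreover have "real k *\<^sub>R (cfc h ?n * cfc h ?n) = cfc h w * cfc h (g k)"
    proof -
      have "(\<lambda>t. w t * g k t) = (\<lambda>t. real k * (?n t * ?n t))"
      proof
        fix t
        have "(1 + ?n t) ^ k \<noteq> 0" using nz[of t] by simp
        then show "w t * g k t = real k * (?n t * ?n t)" by (simp add: w_def g_def)
      qed
      then show ?thesis
        using cfc_mult[OF sa cw cg[of k]] cfc_scale[OF sa czero_mult[OF czero_parts(1) czero_parts(1)], of "real k"]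
        by (simp add: cfc_mult[OF sa czero_parts(1) czero_parts(1)])
    qed
    ultimately have "norm (real k *\<^sub>R (cfc h ?n * cfc h ?n)) \<le> 1 * norm (cfc h ?n)"
      using norm_mult_ineq[of "cfc h w" "cfc h (g k)"] g[of k]
        mult_mono[of "norm (cfc h w)" 1 "norm (cfc h (g k))" "norm (cfc h ?n)"] by simp
    then show ?thesis by (simp add: norm_square_sa cfc_star[OF sa czero_parts(1)])
  qed
  then have "\<not> 0 < (norm (cfc h ?n))\<^sup>2"
    using reals_Archimedean3[of "(norm (cfc h ?n))\<^sup>2"] by (meson linorder_not_less)
  then have "cfc h ?n = 0" by simp
  then show ?thesis by (rule negative_part_zero_imp_pos[OF sa])
qed

text \<open>Contractivity of 1 - h survives averaging, so the midpoint of the rescaled summands is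
  positive; the rest is scaling.\<close>

lemma pos_add:
  fixes h k :: "'a::cstar_algebra"
  assumes "pos h" "pos k"
  shows "pos (h + k)"
proof -
  define K where "K = 1 + norm h + norm k"
  have K: "K > 0" by (simp add: K_def add_pos_nonneg)
  define h' k' where "h' = (1 / K) *\<^sub>R h" and "k' = (1 / K) *\<^sub>R k"
  have lt: "norm h' < 1" "norm k' < 1"
    using K by (simp_all add: h'_def k'_def) (simp_all add: K_def add_pos_nonneg)
  have p: "pos h'" "pos k'" using assms K by (auto simp: h'_def k'_def intro!: pos_scale)
  define m where "m = (1 / 2) *\<^sub>R (h' + k')"
  have "pos m"
  proof (rule contractive_imp_pos)
    show "star m = m" using p by (simp add: m_def star_add pos_star)
    show "norm m < 1" using norm_triangle_ineq[of h' k'] lt by (simp add: m_def)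
    fix y
    have "y - m * y = (1 / 2) *\<^sub>R ((y - h' * y) + (y - k' * y))"
      by (simp add: m_def algebra_simps flip: scaleR_2)
    then show "norm (y - m * y) \<le> norm y"
      using norm_triangle_ineq[of "y - h' * y" "y - k' * y"] pos_imp_contractive[OF p(1) lt(1), of y]
        pos_imp_contractive[OF p(2) lt(2), of y] by simp
  qed
  moreover have "h + k = (2 * K) *\<^sub>R m"
    using K by (simp add: m_def h'_def k'_def scaleR_add_right)
  ultimately show ?thesis using K by (simp add: pos_scale)
qed

lemma pos_sum: "(\<And>i. i \<in> I \<Longrightarrow> pos (f i)) \<Longrightarrow> pos (sum f I)"
  by (induction I rule: infinite_finite_induct) (auto intro: pos_add)

text \<open>Positivity of x kills its negative part, positivity of -x its positive part, and x is
  the difference of the two.\<close>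

lemma pos_antisym:
  fixes m :: "'a::cstar_algebra"
  assumes "pos m" "pos (- m)"
  shows "m = 0"
proof -
  define c where "c = 1 / (1 + norm m)"
  have c: "c > 0" by (simp add: c_def add_pos_nonneg)
  define x where "x = c *\<^sub>R m"
  have x: "norm x < 1" by (simp add: x_def c_def field_simps add_pos_nonneg abs_of_nonneg)
  have p: "pos x" "pos (- x)"
    using assms c pos_scale[of _ c] by (auto simp: x_def simp flip: scaleR_minus_right)
  have sa: "star x = x" using p by (simp add: pos_star)
  have e: "pel [:-1:] x = - x" by (simp add: pel_def)
  have "cfc x (\<lambda>t. max (- (t * poly [:-1:] t)) 0) = cfc (- x) (\<lambda>t. max (- t) 0)"
    using cfc_compose_poly[OF sa x, of "[:-1:]" "\<lambda>t. max (- t) 0"] by (simp add: e x czero_parts)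
  also have "\<dots> = 0" using p(2) x by (intro pos_negative_part) auto
  finally have "cfc x (\<lambda>t. max t 0) = 0" by simp
  then have "x = 0"
    using cfc_parts[OF sa x] pos_negative_part[OF p(1) x] by simp
  then show ?thesis using c by (simp add: x_def)
qed

text \<open>The Cartesian decomposition c = a + i b: the cross terms of the two products cancel in
  the sum.\<close>

lemma complex_parts:
  fixes c :: "'a::cstar_algebra"
  shows "\<exists>a b. star a = a \<and> star b = b \<and> star c * c + c * star c = 2 *\<^sub>R (a * a + b * b)"
proof -
  define a where "a = (1/2) *\<^sub>R (c + star c)"
  define b where "b = (1/2) *\<^sub>R (\<i> *\<^sub>C (star c - c))"
  have bb: "(\<i> *\<^sub>C (star c - c)) * (\<i> *\<^sub>C (star c - c)) = - ((star c - c) * (star c - c))"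
    by (simp add: mult_scaleC_left mult_scaleC_right scaleC_scaleC scaleC_minus_one)
  have "star a = a" by (simp add: a_def star_add star_star add.commute)
  moreover have "star (\<i> *\<^sub>C (star c - c)) = \<i> *\<^sub>C (star c - c)"
    using scaleC_minus_right[of \<i> "c - star c"] scaleC_scaleC[of \<i> "-1" "c - star c"]
    by (simp add: star_scaleC star_diff star_star scaleC_minus_one)
  then have "star b = b" by (simp add: b_def)
  moreover have "2 *\<^sub>R (a * a + b * b) = (1/2) *\<^sub>R ((c + star c) * (c + star c) - (star c - c) * (star c - c))"
    by (simp add: a_def b_def bb algebra_simps)
  moreover have "(c + star c) * (c + star c) - (star c - c) * (star c - c) = 2 *\<^sub>R (star c * c + c * star c)"
    by (simp add: algebra_simps scaleR_2)
  ultimately show ?thesis by (intro exI[of _ a] exI[of _ b]) simp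
qed

text \<open>Kaplansky: if \<open>c = a h\<^sub>-\<close> with \<open>h = star a * a\<close>, then \<open>star c * c = - h\<^sub>-\<^sup>3\<close>, so
  \<open>c * star c\<close> is positive, and the negative part of \<open>star c * c\<close> is carried by \<open>c\<close> to that of
  \<open>c * star c\<close>.\<close>

lemma pos_star_mult:
  fixes a :: "'a::cstar_algebra"
  shows "pos (star a * a)"
proof -
  have main: "pos (star a * a)" if lt: "norm a < 1" for a :: 'a
  proof -
    let ?n = "\<lambda>t::real. max (- t) 0"
    define h where "h = star a * a"
    have sa: "star h = h" by (simp add: h_def star_mult star_star)
    have h1: "norm h < 1" using lt by (simp add: h_def norm_star_mult_self abs_square_less_1)
    define v where "v = cfc h ?n"
    have v: "star v = v" by (simp add: v_def cfc_star[OF sa h1] czero_parts)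
    have v1: "norm v \<le> 1" unfolding v_def by (intro norm_cfc_le[OF sa h1]) (auto simp: czero_parts)
    define c where "c = a * v"
    define m where "m = v * v * v"
    have cc: "star c * c = - m"
    proof -
      have "h * v = cfc h (\<lambda>t. t * ?n t)"
        by (simp add: cfc_mult[OF sa h1] czero_ident czero_parts cfc_ident[OF sa h1] v_def)
      also have "(\<lambda>t. t * ?n t) = (\<lambda>t. (- 1) * (?n t * ?n t))" by (auto simp: max_def)
      also have "cfc h \<dots> = - (v * v)"
        by (subst cfc_scale[OF sa h1]) (simp_all add: czero_mult czero_parts cfc_mult[OF sa h1] v_def)
      finally have "star a * (a * v) = - (v * v)" by (simp add: h_def mult.assoc)
      then show ?thesis by (simp add: c_def m_def star_mult v mult.assoc)
    qed
    have pm: "pos m"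
    proof -
      let ?r = "\<lambda>t. ?n t * sqrt (?n t)"
      have cr: "czero ?r" by (auto simp: czero_def intro!: continuous_intros)
      have "m = cfc h (\<lambda>t. ?n t * ?n t * ?n t)"
        by (simp add: m_def v_def cfc_mult[OF sa h1] czero_mult czero_parts)
      also have "(\<lambda>t. ?n t * ?n t * ?n t) = (\<lambda>t. ?r t * ?r t)" by (simp add: mult_ac)
      also have "cfc h \<dots> = cfc h ?r * cfc h ?r" by (rule cfc_mult[OF sa h1 cr cr])
      finally show ?thesis using cfc_star[OF sa h1 cr] by (auto simp: pos_def)
    qed
    obtain x y where xy: "star x = x" "star y = y" "star c * c + c * star c = 2 *\<^sub>R (x * x + y * y)"
      using complex_parts by blast
    define p where "p = c * star c"
    have "p = 2 *\<^sub>R (x * x + y * y) + m"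
      using xy(3) by (simp add: cc p_def algebra_simps)
    moreover have "pos (x * x)" "pos (y * y)" using xy by (auto simp: pos_def)
    ultimately have pp: "pos p" by (auto intro!: pos_add pos_scale pm)
    have c1: "norm c < 1"
    proof -
      have "norm c \<le> norm a * norm v" unfolding c_def by (rule norm_mult_ineq)
      also have "\<dots> \<le> norm a * 1" using v1 by (intro mult_left_mono) auto
      finally show ?thesis using lt by simp
    qed
    have p1: "norm p < 1" "norm (star c * c) < 1"
      using c1 norm_star_mult_self[of "star c"] by (simp_all add: p_def star_star norm_star_mult_self abs_square_less_1)
    have k: "star (star c * c) = star c * c" by (simp add: star_mult star_star)
    \<comment> \<open>From p c = c (star c * c), c carries the negative part of
      \<open>star c * c\<close> to that of the positive element p, which is zero.\<close>
    have "0 = cfc p ?n * c" by (simp add: pos_negative_part[OF pp p1(1)])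
    also have "\<dots> = c * cfc (star c * c) ?n"
      by (rule cfc_intertwine) (simp_all add: p1 k czero_parts pos_star[OF pp], simp add: p_def mult.assoc)
    finally have z: "star c * c * cfc (star c * c) ?n = 0" by (simp add: mult.assoc)
    let ?k = "star c * c"
    have m1: "norm m < 1" using p1(2) by (simp add: cc)
    \<comment> \<open>\<open>star c * c\<close> is -m with m positive, so its positive part vanishes
      and its negative part is m; fact \<open>z\<close> then reads m m = 0 up to sign.\<close>
    have mk: "m = cfc ?k ?n"
    proof -
      have "cfc (pel [:-1:] ?k) ?n = cfc ?k (\<lambda>t. ?n (t * poly [:-1:] t))"
        by (rule cfc_compose_poly[OF k p1(2)]) (use p1(2) in \<open>auto simp: pel_def czero_parts\<close>)
      moreover have "pel [:-1:] ?k = m" by (simp add: pel_def cc)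
      ultimately have "cfc ?k (\<lambda>t. max t 0) = 0" using pos_negative_part[OF pm m1] by simp
      then show ?thesis using cfc_parts[OF k p1(2)] by (simp add: cc)
    qed
    then have "m * m = 0" using z by (simp add: cc)
    then have "v * v * (v * v) = 0"
      using square_sa_eq_0[of m] pos_star[OF pm] by (simp add: m_def mult.assoc)
    then have "v = 0" using square_sa_eq_0[of "v * v"] square_sa_eq_0[of v] v by (simp add: star_mult)
    then show ?thesis using negative_part_zero_imp_pos[OF sa h1] by (simp add: v_def h_def)
  qed
  define K where "K = 1 + norm a"
  have K: "K > 0" by (simp add: K_def add_pos_nonneg)
  have "pos (star ((1 / K) *\<^sub>R a) * ((1 / K) *\<^sub>R a))"
    by (rule main) (use K in \<open>simp add: field_simps\<close>, simp add: K_def)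
  then have "pos ((1 / K / K) *\<^sub>R (star a * a))" by simp
  then show ?thesis using K by (simp add: pos_scale_iff)
qed

lemma pos_conj:
  fixes h v :: "'a::cstar_algebra"
  assumes "pos h"
  shows "pos (star v * h * v)"
proof -
  obtain r where "star r = r" "h = r * r" using assms by (auto simp: pos_def)
  then show ?thesis using pos_star_mult[of "r * v"] by (simp add: star_mult mult.assoc)
qed

text \<open>s stands for 1 - sqrt(1 - z), and the identity says (1 - s)^2 = 1 - z with no unit in
  sight. Sandwiched between star a and a, it exhibits star a * a - star a * z * a as the square of a
  - s a, the form in which operator inequalities are used below.\<close>

lemma root_of_one_minus:
  fixes z :: "'a::cstar_algebra"
  assumes sa: "star z = z" "norm z < 1"
  shows "\<exists>s. star s = s \<and> s + s = z + s * s"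
proof -
  let ?f = "\<lambda>t. 1 - sqrt (1 - t)"
  have cz: "czero ?f" by (auto simp: czero_def intro!: continuous_intros)
  have "cfc z (\<lambda>t. ?f t + ?f t) = cfc z (\<lambda>t. t + ?f t * ?f t)"
  proof (rule cfc_cong[OF sa])
    fix t :: real assume "\<bar>t\<bar> \<le> 1"
    then have "sqrt (1 - t) * sqrt (1 - t) = 1 - t" by simp
    then show "?f t + ?f t = t + ?f t * ?f t" by (simp add: algebra_simps)
  qed (intro czero_add czero_mult czero_ident cz)+
  then have "cfc z ?f + cfc z ?f = z + cfc z ?f * cfc z ?f"
    by (simp only: cfc_add[OF sa] cfc_mult[OF sa] cz czero_ident czero_mult cfc_ident[OF sa])
  then show ?thesis using cfc_star[OF sa cz] by blast
qed

text \<open>Let h + p be below 1 and v the part of h above 1. Then v (1 - h) v = v (1 - (h + p)) v +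
  v p v is positive, but negative by the choice of v. So v = 0 and h is at most 1.\<close>

lemma pos_norm_mono:
  fixes h p :: "'a::cstar_algebra"
  assumes h: "pos h" and p: "pos p"
  shows "norm h \<le> norm (h + p)"
proof -
  have main: "norm h \<le> 1" if h: "pos h" and p: "pos p" and lt: "norm (h + p) < 1" for h p :: 'a
  proof -
    \<comment> \<open>Shrinks h below norm 1 for the functional calculus; the level 1 for h becomes
      the level \<kappa> for \<open>H\<close>.\<close>
    define \<kappa> where "\<kappa> = 1 / (2 + norm h)"
    have \<kappa>: "0 < \<kappa>" "\<kappa> * norm h < 1" "\<kappa> \<le> 1"
    proof -
      have "2 + norm h > 0" using norm_ge_zero[of h] by linarith
      then show "0 < \<kappa>" "\<kappa> * norm h < 1" "\<kappa> \<le> 1" by (simp_all add: \<kappa>_def)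
    qed
    define H where "H = \<kappa> *\<^sub>R h"
    have H: "star H = H" "norm H < 1" "pos H"
      using h \<kappa> by (simp_all add: H_def pos_star pos_scale)
    let ?f = "\<lambda>t. max (t - \<kappa>) 0"
    have cf: "czero ?f" using \<kappa> by (auto simp: czero_def intro!: continuous_intros)
    define v where "v = cfc H ?f"
    have v: "star v = v" by (simp add: v_def cfc_star[OF H(1,2) cf])
    obtain s where s: "star s = s" "s + s = (h + p) + s * s"
      using root_of_one_minus[of "h + p"] lt h p by (auto simp: star_add pos_star)
    define m where "m = v * v * v"
    have m_eq: "m = \<kappa> *\<^sub>R (v * h * v - v * v)"
    proof -
      have "m = cfc H (\<lambda>t. ?f t * ?f t * ?f t)"
        by (simp add: m_def v_def cfc_mult[OF H(1,2)] czero_mult cf)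
      also have "(\<lambda>t. ?f t * ?f t * ?f t) = (\<lambda>t. ?f t * t * ?f t - \<kappa> * (?f t * ?f t))"
        by (auto simp: max_def algebra_simps)
      also have "cfc H \<dots> = v * H * v - \<kappa> *\<^sub>R (v * v)"
        by (simp add: v_def cfc_mult[OF H(1,2)] cfc_diff[OF H(1,2)] cfc_scale[OF H(1,2)] cfc_ident[OF H(1,2)]
            czero_mult czero_scale czero_ident cf)
      finally show ?thesis by (simp add: H_def algebra_simps)
    qed
    have "pos m"
    proof -
      let ?r = "\<lambda>t. ?f t * sqrt (?f t)"
      have cr: "czero ?r" using \<kappa> by (auto simp: czero_def intro!: continuous_intros)
      have "m = cfc H (\<lambda>t. ?f t * ?f t * ?f t)"
        by (simp add: m_def v_def cfc_mult[OF H(1,2)] czero_mult cf)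
      also have "(\<lambda>t. ?f t * ?f t * ?f t) = (\<lambda>t. ?r t * ?r t)" by (simp add: mult_ac)
      also have "cfc H \<dots> = cfc H ?r * cfc H ?r" by (rule cfc_mult[OF H(1,2) cr cr])
      finally show ?thesis using cfc_star[OF H(1,2) cr] by (auto simp: pos_def)
    qed
    moreover have "pos (- m)"
    proof -
      have "v * (s + s) * v = v * ((h + p) + s * s) * v" by (simp only: s(2))
      then have "v * v - v * h * v = star (v - s * v) * (v - s * v) + star v * p * v"
        by (simp add: star_diff star_mult v s(1) algebra_simps)
      moreover have "- m = \<kappa> *\<^sub>R (v * v - v * h * v)" by (simp add: m_eq algebra_simps)
      ultimately show ?thesis using \<kappa> p by (auto intro!: pos_scale pos_add pos_star_mult pos_conj)
    qed
    ultimately have "m = 0" by (rule pos_antisym)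
    then have "v * v * (v * v) = 0" by (simp add: m_def mult.assoc)
    then have v0: "v = 0" using square_sa_eq_0[of "v * v"] square_sa_eq_0[of v] v by (simp add: star_mult)
    have "H = cfc H (\<lambda>t. max t 0 - ?f t)"
      using cfc_parts[OF H(1,2)] pos_negative_part[OF H(3,2)] v0
      by (simp add: cfc_diff[OF H(1,2)] czero_parts cf v_def)
    moreover have "norm (cfc H (\<lambda>t. max t 0 - ?f t)) \<le> \<kappa>"
      using \<kappa> by (intro norm_cfc_le[OF H(1,2)] czero_diff czero_parts cf) auto
    ultimately have "norm H \<le> \<kappa>" by simp
    then show ?thesis using \<kappa> by (simp add: H_def)
  qed
  show ?thesis
  proof (rule field_le_epsilon)
    fix e :: real assume e: "e > 0"
    define K where "K = norm (h + p) + e"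
    have K: "K > 0" using e by (simp add: K_def add_nonneg_pos)
    have "norm ((1 / K) *\<^sub>R h) \<le> 1"
    proof (rule main)
      show "norm ((1 / K) *\<^sub>R h + (1 / K) *\<^sub>R p) < 1"
        using K e by (simp add: K_def flip: scaleR_add_right)
    qed (use h p K in \<open>auto intro: pos_scale\<close>)
    then show "norm h \<le> norm (h + p) + e" using K by (simp add: K_def)
  qed
qed

section \<open>Tracial weights\<close>

locale weight =
  fixes \<theta> :: "'b::cstar_algebra \<Rightarrow> ennreal"
  assumes tracial: "tracial_weight \<theta>"
begin

definition q :: "'b \<Rightarrow> ennreal" where
  "q a = \<theta> (star a * a)"

lemma q_star: "q (star a) = q a"
  using tracial by (simp add: q_def tracial_weight_def star_star)

lemma star_mult_in_cone [simp]: "star a * a \<in> positive_cone"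
  by (auto simp: positive_cone_def)

lemma q_add: "\<theta> (star a * a + star b * b) = q a + q b"
  using tracial by (simp add: q_def tracial_weight_def)

text \<open>Additivity in the form used throughout: an algebraic identity between sums of two
  squares, where membership in the cone is automatic. Inequalities arise when one square is a
  remainder and another is 0.\<close>

lemma q_add_cong:
  assumes "star a * a + star b * b = star c * c + star d * d"
  shows "q a + q b = q c + q d"
  by (metis assms q_add)

lemma q_scaleR: "q (r *\<^sub>R a) = ennreal (r\<^sup>2) * q a"
proof -
  have "\<theta> (r\<^sup>2 *\<^sub>R (star a * a)) = ennreal (r\<^sup>2) * \<theta> (star a * a)"
    using tracial unfolding tracial_weight_def by (meson star_mult_in_cone zero_le_power2)
  then show ?thesis by (simp add: q_def power2_eq_square)
qed

lemma q_minus: "q (- a) = q a"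
  by (simp add: q_def star_minus)

lemma q_zero [simp]: "q 0 = 0"
  using q_scaleR[of 0 0] by simp

lemma parallelogram: "q (a + b) + q (a - b) = 2 * q a + 2 * q b"
proof -
  have "q (a + b) + q (a - b) = q (sqrt 2 *\<^sub>R a) + q (sqrt 2 *\<^sub>R b)"
    by (rule q_add_cong) (simp add: star_add star_diff algebra_simps scaleR_2)
  then show ?thesis by (simp add: q_scaleR)
qed

lemma q_add_le: "q (a + b) \<le> 2 * q a + 2 * q b"
  by (metis parallelogram le_iff_add)

text \<open>After scaling, 1 - star z * z = (1 - s)^2, so that q (z a) and the remainder q (a - s a)
  add up to q a.\<close>

lemma q_left_mult_le:
  assumes "norm y < K"
  shows "q (y * a) \<le> ennreal (K\<^sup>2) * q a"
proof -
  have K: "K > 0" using assms norm_ge_zero[of y] by linarith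
  define z where "z = (1 / K) *\<^sub>R y"
  have "norm z < 1" using assms K by (simp add: z_def)
  then have "norm (star z * z) < 1" by (simp add: norm_star_mult_self abs_square_less_1)
  moreover have "star (star z * z) = star z * z" by (simp add: star_mult star_star)
  ultimately obtain s where s: "star s = s" "s + s = star z * z + s * s"
    using root_of_one_minus by blast
  have "q (z * a) \<le> q (z * a) + q (a - s * a)" by simp
  also have "\<dots> = q a + q 0"
  proof (rule q_add_cong)
    have "star a * (s + s) * a = star a * (star z * z + s * s) * a" by (simp only: s(2))
    then show "star (z * a) * (z * a) + star (a - s * a) * (a - s * a) = star a * a + star 0 * 0"
      by (simp add: star_mult star_diff s(1) algebra_simps)
  qed
  finally have "q (z * a) \<le> q a" by simp
  moreover have "y * a = K *\<^sub>R (z * a)" using K by (simp add: z_def)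
  ultimately show ?thesis by (simp add: q_scaleR mult_left_mono)
qed

definition fin :: "'b set" where
  "fin = {a. q a < \<infinity>}"

lemma fin_add: "a \<in> fin \<Longrightarrow> b \<in> fin \<Longrightarrow> a + b \<in> fin"
  using q_add_le[of a b] by (simp add: fin_def ennreal_mult_less_top order_le_less_trans)

lemma fin_left_mult: "a \<in> fin \<Longrightarrow> y * a \<in> fin"
  using q_left_mult_le[of y "norm y + 1" a]
  by (simp add: fin_def) (metis ennreal_mult_less_top ennreal_less_top order_le_less_trans infinity_ennreal_def)

lemma fin_star: "a \<in> fin \<Longrightarrow> star a \<in> fin"
  by (simp add: fin_def q_star)

lemma fin_right_mult: "a \<in> fin \<Longrightarrow> a * y \<in> fin"
  by (metis fin_left_mult fin_star star_mult star_star)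

lemma fin_scaleR: "a \<in> fin \<Longrightarrow> r *\<^sub>R a \<in> fin"
  by (simp add: fin_def q_scaleR ennreal_mult_less_top)

lemma fin_minus: "a \<in> fin \<Longrightarrow> - a \<in> fin"
  by (simp add: fin_def q_minus)

lemma fin_diff: "a \<in> fin \<Longrightarrow> b \<in> fin \<Longrightarrow> a - b \<in> fin"
  using fin_add[of a "- b"] fin_minus[of b] by simp

text \<open>Outside \<open>fin\<close> the value is the junk 0 that \<open>enn2real\<close> assigns
  to infinity; hence the membership hypotheses in the additive rules.\<close>

definition qr :: "'b \<Rightarrow> real" where
  "qr a = enn2real (q a)"

lemma q_eq_qr: "a \<in> fin \<Longrightarrow> q a = ennreal (qr a)"
  by (simp add: fin_def qr_def)

lemma qr_nonneg [simp]: "0 \<le> qr a"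
  by (simp add: qr_def)

section \<open>The real inner product on elements of finite weight\<close>

lemma qr_add_cong:
  assumes "a \<in> fin" "b \<in> fin" "c \<in> fin" "d \<in> fin"
    and "star a * a + star b * b = star c * c + star d * d"
  shows "qr a + qr b = qr c + qr d"
proof -
  have "ennreal (qr a + qr b) = ennreal (qr c + qr d)"
    using q_add_cong[OF assms(5)] assms by (simp add: q_eq_qr)
  then show ?thesis by (simp del: ennreal_plus)
qed

lemma qr_parallelogram:
  assumes "a \<in> fin" "b \<in> fin"
  shows "qr (a + b) + qr (a - b) = 2 * qr a + 2 * qr b"
proof -
  have "qr (a + b) + qr (a - b) = qr (sqrt 2 *\<^sub>R a) + qr (sqrt 2 *\<^sub>R b)"
    using assms by (intro qr_add_cong fin_add fin_diff fin_scaleR)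
      (simp_all add: star_add star_diff algebra_simps scaleR_2)
  then show ?thesis by (simp add: qr_def q_scaleR enn2real_mult)
qed

lemma qr_left_mult_le:
  assumes "norm y < K" "a \<in> fin"
  shows "qr (y * a) \<le> K\<^sup>2 * qr a"
proof -
  have "ennreal (qr (y * a)) \<le> ennreal (K\<^sup>2 * qr a)"
    using q_left_mult_le[OF assms(1), of a] assms(2) by (simp add: q_eq_qr fin_left_mult ennreal_mult)
  then show ?thesis by (simp add: ennreal_le_iff)
qed

lemma qr_star: "qr (star a) = qr a"
  by (simp add: qr_def q_star)

text \<open>The real part of the inner product \<open>\<theta> (star b * a)\<close>, following Jordan and von Neumann.\<close>

definition ip :: "'b \<Rightarrow> 'b \<Rightarrow> real" where
  "ip a b = (qr (a + b) - qr (a - b)) / 4"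

lemma qr_uminus: "qr (- a) = qr a"
  by (simp add: qr_def q_minus)

lemma ip_commute: "ip a b = ip b a"
  using qr_uminus[of "a - b"] by (simp add: ip_def add.commute)

lemma ip_self: "ip a a = qr a"
  using q_scaleR[of 2 a] by (simp add: ip_def qr_def enn2real_mult flip: scaleR_2)

lemma ip_star: "ip (star a) (star b) = ip a b"
  by (simp add: ip_def qr_star flip: star_add star_diff)

text \<open>The parallelogram identity at a + u and a - u gives ip a (u + v) + ip a (u - v) = 2 ip a
  u; half the sum and half the difference of b and c turn this into additivity.\<close>

lemma ip_add_right:
  assumes "a \<in> fin" "b \<in> fin" "c \<in> fin"
  shows "ip a (b + c) = ip a b + ip a c"
proof -
  have *: "ip a (u + v) + ip a (u - v) = 2 * ip a u" if "u \<in> fin" "v \<in> fin" for u v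
    using qr_parallelogram[OF fin_add[OF assms(1) that(1)] that(2)]
      qr_parallelogram[OF fin_diff[OF assms(1) that(1)] that(2)]
    by (simp add: ip_def algebra_simps add_divide_distrib diff_divide_distrib)
  have double: "ip a (2 *\<^sub>R u) = 2 * ip a u" if "u \<in> fin" for u
    using *[OF that that] by (simp add: ip_def scaleR_2)
  let ?u = "(1/2) *\<^sub>R (b + c)" and ?v = "(1/2) *\<^sub>R (b - c)"
  have "?u + ?v = b" "?u - ?v = c"
    by (simp_all add: algebra_simps flip: scaleR_add_left)
  then have "ip a b + ip a c = 2 * ip a ?u"
    using *[of ?u ?v] assms by (simp add: fin_scaleR fin_add fin_diff)
  also have "\<dots> = ip a (b + c)" using double[of ?u] assms by (simp add: fin_scaleR fin_add)
  finally show ?thesis ..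
qed

lemma ip_diff_right: "a \<in> fin \<Longrightarrow> b \<in> fin \<Longrightarrow> c \<in> fin \<Longrightarrow> ip a (b - c) = ip a b - ip a c"
  using ip_add_right[of a "b - c" c] by (simp add: fin_diff)

text \<open>In both sums of two squares the cross terms cancel and the same four squares remain, so
  additivity of \<theta> yields the adjoint relation. The same device moves real scalars in
  \<open>ip_scaleR_swap\<close>.\<close>

lemma ip_left_mult:
  assumes "a \<in> fin" "b \<in> fin"
  shows "ip (y * a) b = ip a (star y * b)"
proof -
  have "qr (y * a + b) + qr (a - star y * b) = qr (y * a - b) + qr (a + star y * b)"
    using assms by (intro qr_add_cong fin_add fin_diff fin_left_mult)
      (simp_all add: star_add star_diff star_mult star_star algebra_simps)
  then show ?thesis by (simp add: ip_def)
qed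

lemma ip_right_mult:
  assumes "a \<in> fin" "b \<in> fin"
  shows "ip (a * y) b = ip a (b * star y)"
  using ip_left_mult[OF fin_star[OF assms(1)] fin_star[OF assms(2)], of "star y"]
  by (metis ip_star star_mult star_star)

lemma ip_scaleR_swap:
  assumes "a \<in> fin" "b \<in> fin"
  shows "ip (t *\<^sub>R a) b = ip a (t *\<^sub>R b)"
proof -
  have "qr (t *\<^sub>R a + b) + qr (a - t *\<^sub>R b) = qr (t *\<^sub>R a - b) + qr (a + t *\<^sub>R b)"
    using assms by (intro qr_add_cong fin_add fin_diff fin_scaleR)
      (simp_all add: star_add star_diff algebra_simps)
  then show ?thesis by (simp add: ip_def)
qed

lemma abs_ip_le:
  assumes "a \<in> fin" "b \<in> fin"
  shows "\<bar>ip a b\<bar> \<le> (qr a + qr b) / 2"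
proof -
  have "\<bar>qr (a + b) - qr (a - b)\<bar> \<le> 2 * (qr a + qr b)"
    using qr_parallelogram[OF assms] qr_nonneg[of "a + b"] qr_nonneg[of "a - b"] by argo
  then show ?thesis by (simp add: ip_def)
qed

text \<open>Cauchy-Schwarz: scaling by t and 1/t balances the two terms of the arithmetic mean in
  \<open>abs_ip_le\<close>. Positive bounds r, s keep t defined when a seminorm vanishes;
  \<open>abs_ip_le_sqrt\<close> lets the excess tend to 0.\<close>

lemma abs_ip_le_mult:
  assumes fin: "a \<in> fin" "b \<in> fin" and "qr a \<le> r\<^sup>2" "qr b \<le> s\<^sup>2" "r > 0" "s > 0"
  shows "\<bar>ip a b\<bar> \<le> r * s"
proof -
  define t where "t = sqrt (s / r)"
  have t: "t > 0" "t\<^sup>2 = s / r" using assms by (simp_all add: t_def)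
  have "ip a b = ip (t *\<^sub>R a) ((1 / t) *\<^sub>R b)"
    using t ip_scaleR_swap[of a "(1/t) *\<^sub>R b" t] fin by (simp add: fin_scaleR)
  then have "\<bar>ip a b\<bar> \<le> (qr (t *\<^sub>R a) + qr ((1 / t) *\<^sub>R b)) / 2"
    using abs_ip_le fin by (simp add: fin_scaleR)
  also have "\<dots> = (s / r * qr a + r / s * qr b) / 2"
    using assms(5,6) by (simp add: qr_def q_scaleR enn2real_mult t power_divide)
  also have "\<dots> \<le> (s / r * r\<^sup>2 + r / s * s\<^sup>2) / 2"
    using assms by (intro divide_right_mono add_mono mult_left_mono) auto
  also have "\<dots> = r * s" using assms by (simp add: power2_eq_square)
  finally show ?thesis .
qed

text \<open>Formally the real part of \<theta> (star c * z * c).\<close>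

definition corner_functional :: "'b \<Rightarrow> 'b \<Rightarrow> real" where
  "corner_functional c z = ip c (z * c)"

lemma corner_functional_diff: "c \<in> fin \<Longrightarrow> corner_functional c (x - z) = corner_functional c x - corner_functional c z"
  by (simp add: corner_functional_def left_diff_distrib ip_diff_right fin_left_mult)

text \<open>A factor K slightly above norm z is split as sqrt K and 1 / sqrt K between the two
  arguments, so that both terms of the arithmetic mean are at most K qr c.\<close>

lemma abs_corner_functional_le:
  assumes c: "c \<in> fin"
  shows "\<bar>corner_functional c z\<bar> \<le> norm z * qr c"
proof (rule field_le_epsilon)
  fix e :: real assume e: "e > 0"
  define d where "d = e / (qr c + 1)"
  have "qr c + 1 > 0" using qr_nonneg[of c] by linarith
  then have d: "d > 0" "d * qr c \<le> e"
    using e by (simp_all add: d_def field_simps)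
  define K where "K = norm z + d"
  have K: "K > 0" "norm z < K" using d by (simp_all add: K_def add_nonneg_pos)
  have "corner_functional c z = ip (sqrt K *\<^sub>R c) ((1 / sqrt K) *\<^sub>R (z * c))"
    using K ip_scaleR_swap[of c "(1/sqrt K) *\<^sub>R (z * c)" "sqrt K"] c
    by (simp add: corner_functional_def fin_scaleR fin_left_mult)
  also have "\<bar>\<dots>\<bar> \<le> (K * qr c + qr (z * c) / K) / 2"
    using abs_ip_le[of "sqrt K *\<^sub>R c" "(1 / sqrt K) *\<^sub>R (z * c)"] c K
    by (simp add: fin_scaleR fin_left_mult qr_def q_scaleR enn2real_mult power_divide)
  also have "qr (z * c) / K \<le> K * qr c"
    using qr_left_mult_le[OF K(2) c] K by (simp add: field_simps power2_eq_square)
  finally have "\<bar>corner_functional c z\<bar> \<le> K * qr c" by simp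
  then show "\<bar>corner_functional c z\<bar> \<le> norm z * qr c + e" using d by (simp add: K_def algebra_simps)
qed

text \<open>The way back from the bounded functional to the weight.\<close>

lemma corner_functional_star_mult:
  assumes "c \<in> fin"
  shows "corner_functional c (star y * y) = qr (y * c)"
  using ip_left_mult[OF assms fin_left_mult[OF assms], of y y]
  by (simp add: corner_functional_def ip_self mult.assoc)

lemma qr_left_mult_le_norm:
  assumes "a \<in> fin"
  shows "qr (y * a) \<le> (norm y)\<^sup>2 * qr a"
proof (rule tendsto_lowerbound)
  show "((\<lambda>K. K\<^sup>2 * qr a) \<longlongrightarrow> (norm y)\<^sup>2 * qr a) (at_right (norm y))"
    by (intro tendsto_intros)
  show "\<forall>\<^sub>F K in at_right (norm y). qr (y * a) \<le> K\<^sup>2 * qr a"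
    using eventually_at_right_less by eventually_elim (use qr_left_mult_le assms in blast)
qed simp

lemma qr_right_mult_le_norm: "a \<in> fin \<Longrightarrow> qr (a * y) \<le> (norm y)\<^sup>2 * qr a"
  using qr_left_mult_le_norm[of "star a" "star y"] by (metis fin_star norm_star qr_star star_mult)

lemma abs_ip_le_sqrt:
  assumes "a \<in> fin" "b \<in> fin"
  shows "\<bar>ip a b\<bar> \<le> sqrt (qr a) * sqrt (qr b)"
proof (rule tendsto_lowerbound)
  show "((\<lambda>e. (sqrt (qr a) + e) * (sqrt (qr b) + e)) \<longlongrightarrow> sqrt (qr a) * sqrt (qr b)) (at_right 0)"
    by (rule tendsto_eq_intros refl | simp)+
  show "\<forall>\<^sub>F e in at_right 0. \<bar>ip a b\<bar> \<le> (sqrt (qr a) + e) * (sqrt (qr b) + e)"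
    using eventually_at_right_less
  proof eventually_elim
    case (elim e)
    have "qr d \<le> (sqrt (qr d) + e)\<^sup>2" for d
      using elim power_mono[of "sqrt (qr d)" "sqrt (qr d) + e" 2] by simp
    then show ?case using elim by (intro abs_ip_le_mult assms) (auto simp: add_nonneg_pos)
  qed
qed simp

lemma corner_functional_zero: "c \<in> fin \<Longrightarrow> corner_functional c 0 = 0"
  using corner_functional_diff[of c 0 0] by simp

end

section \<open>Characters separate points\<close>

text \<open>Characters of subgroups, represented by their graphs.\<close>

definition partial_character :: "('g::ab_group_add \<times> complex) set \<Rightarrow> bool" where
  "partial_character \<Gamma> \<longleftrightarrow> (0, 1) \<in> \<Gamma> \<and>
     (\<forall>g z h w. (g, z) \<in> \<Gamma> \<longrightarrow> (h, w) \<in> \<Gamma> \<longrightarrow> (g + h, z * w) \<in> \<Gamma>) \<and>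
     (\<forall>g z. (g, z) \<in> \<Gamma> \<longrightarrow> (- g, inverse z) \<in> \<Gamma>) \<and>
     (\<forall>g z w. (g, z) \<in> \<Gamma> \<longrightarrow> (g, w) \<in> \<Gamma> \<longrightarrow> z = w) \<and>
     (\<forall>g z. (g, z) \<in> \<Gamma> \<longrightarrow> cmod z = 1)"

primrec nmul :: "nat \<Rightarrow> 'g::ab_group_add \<Rightarrow> 'g" where
  "nmul 0 h = 0"
| "nmul (Suc n) h = h + nmul n h"

lemma nmul_add: "nmul (m + n) h = nmul m h + nmul n h"
  by (induction m) (simp_all add: add.assoc)

text \<open>Adjoins h with the prescribed value \<zeta>; the hypothesis on multiples of h in the old
  domain is what makes the extension single-valued.\<close>

lemma partial_character_extend:
  fixes \<Gamma> :: "('g::ab_group_add \<times> complex) set"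
  assumes \<Gamma>: "partial_character \<Gamma>" and \<zeta>: "cmod \<zeta> = 1"
    and compat: "\<And>n w. (nmul n h, w) \<in> \<Gamma> \<Longrightarrow> \<zeta> ^ n = w"
  shows "\<exists>\<Delta>. partial_character \<Delta> \<and> \<Gamma> \<subseteq> \<Delta> \<and> (h, \<zeta>) \<in> \<Delta>"
proof -
  note pc = \<Gamma>[unfolded partial_character_def]
  have \<zeta>0: "\<zeta> \<noteq> 0" using \<zeta> by auto
  \<comment> \<open>Integer multiples of h are written as differences of natural ones.\<close>
  define \<Delta> where "\<Delta> = {(g + nmul k h - nmul l h, z * \<zeta> ^ k / \<zeta> ^ l) | g z k l. (g, z) \<in> \<Gamma>}"
  have memI: "(g + nmul k h - nmul l h, z * \<zeta> ^ k / \<zeta> ^ l) \<in> \<Delta>" if "(g, z) \<in> \<Gamma>" for g z k l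
    using that by (auto simp: \<Delta>_def)
  have key: "z * \<zeta> ^ a = z' * \<zeta> ^ b"
    if mem: "(g, z) \<in> \<Gamma>" "(g', z') \<in> \<Gamma>" and eq: "g + nmul a h = g' + nmul b h" and ab: "b \<le> a"
    for g z g' z' a b
  proof -
    have "nmul a h = nmul (a - b) h + nmul b h" using ab by (metis nmul_add le_add_diff_inverse2)
    then have "nmul (a - b) h = g' + - g" using eq by (simp add: algebra_simps)
    moreover have "(g' + - g, z' * inverse z) \<in> \<Gamma>" using pc mem by blast
    ultimately have "\<zeta> ^ (a - b) = z' * inverse z" using compat by simp
    moreover have "z \<noteq> 0" using pc mem by fastforce
    ultimately have "z * \<zeta> ^ (a - b) = z'" by (simp add: field_simps)
    then show ?thesis using ab by (metis le_add_diff_inverse2 mult.assoc power_add)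
  qed
  have "partial_character \<Delta>"
    unfolding partial_character_def
  proof (intro conjI allI impI)
    show "(0, 1) \<in> \<Delta>" using memI[of 0 1 0 0] pc by simp
  next
    fix x u y v assume "(x, u) \<in> \<Delta>" "(y, v) \<in> \<Delta>"
    then obtain g z k l g' z' k' l' where
      x: "(g, z) \<in> \<Gamma>" "x = g + nmul k h - nmul l h" "u = z * \<zeta> ^ k / \<zeta> ^ l" and
      y: "(g', z') \<in> \<Gamma>" "y = g' + nmul k' h - nmul l' h" "v = z' * \<zeta> ^ k' / \<zeta> ^ l'"
      unfolding \<Delta>_def by blast
    have "(g + g', z * z') \<in> \<Gamma>" using pc x y by blast
    from memI[OF this, of "k + k'" "l + l'"] show "(x + y, u * v) \<in> \<Delta>"
      by (simp add: x y nmul_add power_add algebra_simps)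
  next
    fix x u assume "(x, u) \<in> \<Delta>"
    then obtain g z k l where
      x: "(g, z) \<in> \<Gamma>" "x = g + nmul k h - nmul l h" "u = z * \<zeta> ^ k / \<zeta> ^ l"
      unfolding \<Delta>_def by blast
    have "(- g, inverse z) \<in> \<Gamma>" using pc x by blast
    from memI[OF this, of l k] show "(- x, inverse u) \<in> \<Delta>"
      by (simp add: x field_simps)
  next
    fix x u v assume "(x, u) \<in> \<Delta>" "(x, v) \<in> \<Delta>"
    then obtain g z k l g' z' k' l' where
      x: "(g, z) \<in> \<Gamma>" "x = g + nmul k h - nmul l h" "u = z * \<zeta> ^ k / \<zeta> ^ l" and
      y: "(g', z') \<in> \<Gamma>" "x = g' + nmul k' h - nmul l' h" "v = z' * \<zeta> ^ k' / \<zeta> ^ l'"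
      unfolding \<Delta>_def by blast
    have eq: "g + nmul (k + l') h = g' + nmul (k' + l) h"
      using x(2) y(2) by (simp add: nmul_add algebra_simps)
    have "z * \<zeta> ^ (k + l') = z' * \<zeta> ^ (k' + l)"
      using key[OF x(1) y(1) eq] key[OF y(1) x(1) eq[symmetric]] by (metis nat_le_linear)
    then show "u = v" using \<zeta>0 by (simp add: x y field_simps power_add)
  next
    fix x u assume "(x, u) \<in> \<Delta>"
    then obtain g z k l where "(g, z) \<in> \<Gamma>" "u = z * \<zeta> ^ k / \<zeta> ^ l" unfolding \<Delta>_def by blast
    then show "cmod u = 1" using pc \<zeta> by (auto simp: norm_mult norm_divide norm_power)
  qed
  moreover have "\<Gamma> \<subseteq> \<Delta>" using memI[of _ _ 0 0] by auto
  moreover have "(h, \<zeta>) \<in> \<Delta>" using memI[of 0 1 1 0] pc by simp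
  ultimately show ?thesis by blast
qed

text \<open>Divisibility of the circle: if m h is the least positive multiple in the domain, then m
  divides n for every n h in it, and an m-th root of the value at m h is compatible. If there is no
  positive multiple, 1 will do.\<close>

lemma ex_unimodular_compatible:
  assumes \<Gamma>: "partial_character \<Gamma>"
  shows "\<exists>\<zeta>. cmod \<zeta> = 1 \<and> (\<forall>n w. (nmul n h, w) \<in> \<Gamma> \<longrightarrow> \<zeta> ^ n = w)"
proof (cases "\<exists>n>0. \<exists>w. (nmul n h, w) \<in> \<Gamma>")
  case False
  then have "1 ^ n = w" if "(nmul n h, w) \<in> \<Gamma>" for n w
  proof -
    have "n = 0" using False that gr0I by metis
    then have "(0, w) \<in> \<Gamma>" using that by simp
    moreover have "(0, 1) \<in> \<Gamma>" using \<Gamma> by (simp add: partial_character_def)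
    ultimately have "w = 1" using \<Gamma> unfolding partial_character_def by blast
    then show ?thesis by simp
  qed
  then show ?thesis by (intro exI[of _ 1]) auto
next
  case True
  define m where "m = (LEAST n. n > 0 \<and> (\<exists>w. (nmul n h, w) \<in> \<Gamma>))"
  have "m > 0 \<and> (\<exists>w. (nmul m h, w) \<in> \<Gamma>)"
    using LeastI_ex[of "\<lambda>n. n > 0 \<and> (\<exists>w. (nmul n h, w) \<in> \<Gamma>)"] True unfolding m_def by blast
  then obtain w0 where m: "m > 0" "(nmul m h, w0) \<in> \<Gamma>" by blast
  have least: "n = 0" if "n < m" "(nmul n h, w) \<in> \<Gamma>" for n w
    using not_less_Least[of n "\<lambda>n. n > 0 \<and> (\<exists>w. (nmul n h, w) \<in> \<Gamma>)"] that by (auto simp: m_def)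
  have w0: "cmod w0 = 1" using \<Gamma> m(2) by (auto simp: partial_character_def)
  define \<zeta> where "\<zeta> = cis (Arg w0 / m)"
  have "\<zeta> ^ m = cis (real m * (Arg w0 / m))" by (simp only: \<zeta>_def Complex.DeMoivre)
  also have "real m * (Arg w0 / m) = Arg w0" using m(1) by simp
  also have "cis (Arg w0) = w0"
  proof -
    have "w0 \<noteq> 0" using w0 by auto
    from cis_Arg[OF this] show ?thesis using w0 by (simp add: sgn_div_norm)
  qed
  finally have \<zeta>: "\<zeta> ^ m = w0" .
  have "\<zeta> ^ n = w" if "(nmul n h, w) \<in> \<Gamma>" for n w
    using that
  proof (induction n arbitrary: w rule: less_induct)
    case (less n)
    show ?case
    proof (cases "n < m")
      case True
      then have "n = 0" using least less.prems by blast
      then show ?thesis using less.prems \<Gamma> by (auto simp: partial_character_def)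
    next
      case False
      then have "nmul n h = nmul (n - m) h + nmul m h" by (metis nmul_add le_add_diff_inverse2 not_less)
      moreover have "(nmul n h + - nmul m h, w * inverse w0) \<in> \<Gamma>"
        using \<Gamma> less.prems m(2) unfolding partial_character_def by blast
      ultimately have "(nmul (n - m) h, w * inverse w0) \<in> \<Gamma>" by simp
      then have "\<zeta> ^ (n - m) = w * inverse w0" using less.IH[of "n - m"] m(1) False by simp
      moreover have "\<zeta> ^ n = \<zeta> ^ (n - m) * \<zeta> ^ m" using False by (simp flip: power_add)
      moreover have "w0 \<noteq> 0" using w0 by auto
      ultimately show ?thesis by (simp add: \<zeta>)
    qed
  qed
  then show ?thesis by (intro exI[of _ \<zeta>]) (simp add: \<zeta>_def)
qed

text \<open>Zorn's lemma on graphs ordered by inclusion: a maximal graph is total, since a missing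
  element could be adjoined.\<close>

lemma partial_character_total:
  fixes \<Gamma> :: "('g::ab_group_add \<times> complex) set"
  assumes \<Gamma>: "partial_character \<Gamma>"
  shows "\<exists>\<eta>\<in>dual_group. \<forall>(g, z)\<in>\<Gamma>. \<eta> g = z"
proof -
  let ?A = "{\<Delta>. partial_character \<Delta> \<and> \<Gamma> \<subseteq> \<Delta>}"
  have "\<exists>M\<in>?A. \<forall>X\<in>?A. M \<subseteq> X \<longrightarrow> X = M"
  proof (rule subset_Zorn_nonempty)
    show "?A \<noteq> {}" using \<Gamma> by blast
  next
    fix C assume C: "C \<noteq> {}" "subset.chain ?A C"
    have pc: "partial_character \<Delta>" "\<Gamma> \<subseteq> \<Delta>" if "\<Delta> \<in> C" for \<Delta>
      using C(2) that by (auto simp: subset_chain_def)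
    have common: "\<exists>\<Delta>\<in>C. p \<in> \<Delta> \<and> r \<in> \<Delta>" if "p \<in> \<Union>C" "r \<in> \<Union>C" for p r
      using that C(2) unfolding subset_chain_def by blast
    have "partial_character (\<Union>C)"
      unfolding partial_character_def
    proof (intro conjI allI impI)
      show "(0, 1) \<in> \<Union>C" using C(1) pc(1) by (auto simp: partial_character_def)
    next
      fix g z h w assume "(g, z) \<in> \<Union>C" "(h, w) \<in> \<Union>C"
      then obtain \<Delta> where "\<Delta> \<in> C" "(g, z) \<in> \<Delta>" "(h, w) \<in> \<Delta>" using common by blast
      then show "(g + h, z * w) \<in> \<Union>C" using pc(1) unfolding partial_character_def by blast
    next
      fix g z assume "(g, z) \<in> \<Union>C"
      then show "(- g, inverse z) \<in> \<Union>C" using pc(1) unfolding partial_character_def by blast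
    next
      fix g z w assume "(g, z) \<in> \<Union>C" "(g, w) \<in> \<Union>C"
      then obtain \<Delta> where "\<Delta> \<in> C" "(g, z) \<in> \<Delta>" "(g, w) \<in> \<Delta>" using common by blast
      then show "z = w" using pc(1) unfolding partial_character_def by blast
    next
      fix g z assume "(g, z) \<in> \<Union>C"
      then show "cmod z = 1" using pc(1) unfolding partial_character_def by blast
    qed
    then show "\<Union>C \<in> ?A" using C(1) pc(2) by blast
  qed
  then obtain M where M': "M \<in> ?A" "\<forall>X\<in>?A. M \<subseteq> X \<longrightarrow> X = M" by (rule bexE)
  then have M: "partial_character M" "\<Gamma> \<subseteq> M" by simp_all
  have max: "X = M" if "partial_character X" "M \<subseteq> X" for X
  proof -
    have "X \<in> ?A" using that M(2) by auto
    then show ?thesis using M'(2) that(2) by simp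
  qed
  note pc = M(1)[unfolded partial_character_def]
  have total: "\<exists>z. (g, z) \<in> M" for g
  proof -
    obtain \<zeta> where "cmod \<zeta> = 1" "\<And>n w. (nmul n g, w) \<in> M \<Longrightarrow> \<zeta> ^ n = w"
      using ex_unimodular_compatible[OF M(1), of g] by blast
    from partial_character_extend[OF M(1) this] max show ?thesis by blast
  qed
  define \<eta> where "\<eta> g = (THE z. (g, z) \<in> M)" for g
  have \<eta>: "\<eta> g = z" if "(g, z) \<in> M" for g z
    unfolding \<eta>_def using that pc by (intro the_equality) blast+
  have mem: "(g, \<eta> g) \<in> M" for g using total \<eta> by metis
  have "\<eta> \<in> dual_group"
    unfolding dual_group_def
  proof (intro CollectI conjI allI)
    show "\<eta> (g + h) = \<eta> g * \<eta> h" for g h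
    proof -
      have "(g + h, \<eta> g * \<eta> h) \<in> M" using pc mem[of g] mem[of h] by blast
      then show ?thesis by (rule \<eta>)
    qed
    show "cmod (\<eta> g) = 1" for g using pc mem[of g] by blast
  qed
  then show ?thesis using \<eta> M(2) by blast
qed

text \<open>Start from the trivial character on {0} and give g a value other than 1 that respects
  its order: -1 for infinite order, a primitive root of unity otherwise.\<close>

lemma dual_group_separates:
  fixes g :: "'g::ab_group_add"
  assumes "g \<noteq> 0"
  shows "\<exists>\<eta>\<in>dual_group. \<eta> g \<noteq> 1"
proof -
  have pc0: "partial_character {(0::'g, 1)}" by (auto simp: partial_character_def)
  have "\<exists>\<zeta>. cmod \<zeta> = 1 \<and> \<zeta> \<noteq> 1 \<and> (\<forall>n. nmul n g = 0 \<longrightarrow> \<zeta> ^ n = 1)"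
  proof (cases "\<exists>n>0. nmul n g = 0")
    case False
    then have "n = 0" if "nmul n g = 0" for n using that gr0I by metis
    then have "(- 1) ^ n = (1::complex)" if "nmul n g = 0" for n using that by fastforce
    then show ?thesis by (intro exI[of _ "-1"]) auto
  next
    case True
    define m where "m = (LEAST n. n > 0 \<and> nmul n g = 0)"
    have "m > 0 \<and> nmul m g = 0"
      using LeastI_ex[of "\<lambda>n. n > 0 \<and> nmul n g = 0"] True unfolding m_def by blast
    then have m: "m > 0" "nmul m g = 0" by simp_all
    have least: "n = 0" if "n < m" "nmul n g = 0" for n
      using not_less_Least[of n "\<lambda>n. n > 0 \<and> nmul n g = 0"] that by (auto simp: m_def)
    \<comment> \<open>As g is not 0, its order is at least 2, so 2 pi / m lies in (0, pi], where the
      cosine is never 1.\<close>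
    have m2: "m \<ge> 2" using m assms by (cases m; cases "m - 1") auto
    define \<zeta> where "\<zeta> = cis (2 * pi / m)"
    have "\<zeta> ^ m = cis (real m * (2 * pi / m))" by (simp only: \<zeta>_def Complex.DeMoivre)
    then have \<zeta>m: "\<zeta> ^ m = 1" using m(1) by simp
    have "\<zeta> \<noteq> 1"
    proof
      assume "\<zeta> = 1"
      then have "cos (2 * pi / m) = cos 0" by (simp add: \<zeta>_def complex_eq_iff)
      moreover have "2 * pi / m \<le> pi"
      proof -
        have "2 \<le> real m" using m2 by simp
        then have "2 * pi \<le> real m * pi" by (intro mult_right_mono) auto
        then show ?thesis using m(1) by (simp add: divide_le_eq mult.commute)
      qed
      ultimately have "2 * pi / m = 0"
        using cos_inj_pi[of "2 * pi / m" 0] by simp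
      then show False using m(1) by simp
    qed
    moreover have "\<zeta> ^ n = 1" if "nmul n g = 0" for n
      using that
    proof (induction n rule: less_induct)
      case (less n)
      show ?case
      proof (cases "n < m")
        case True
        then show ?thesis using least less.prems by fastforce
      next
        case False
        then have "nmul n g = nmul (n - m) g + nmul m g" by (metis nmul_add le_add_diff_inverse2 not_less)
        then have "\<zeta> ^ (n - m) = 1" using less m False by simp
        moreover have "\<zeta> ^ n = \<zeta> ^ (n - m) * \<zeta> ^ m" using False by (simp flip: power_add)
        ultimately show ?thesis by (simp add: \<zeta>m)
      qed
    qed
    ultimately show ?thesis by (intro exI[of _ \<zeta>]) (simp add: \<zeta>_def)
  qed
  then obtain \<zeta> where "cmod \<zeta> = 1" "\<zeta> \<noteq> 1" "\<And>n w. (nmul n g, w) \<in> {(0::'g, 1)} \<Longrightarrow> \<zeta> ^ n = w" by auto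
  then obtain \<Delta> where \<Delta>: "partial_character \<Delta>" "(g, \<zeta>) \<in> \<Delta>"
    using partial_character_extend[OF pc0] by blast
  then show ?thesis using partial_character_total[OF \<Delta>(1)] \<open>\<zeta> \<noteq> 1\<close> by fastforce
qed

section \<open>Approximate units of finite weight\<close>

text \<open>Compression by 1 - T preserves the order, and the norm is monotone on positive
  elements.\<close>

lemma norm_minus_mult_le_of_dominated:
  fixes a b T :: "'a::cstar_algebra"
  assumes "pos (star b * b - star a * a)"
  shows "norm (a - a * T) \<le> norm (b - b * T)"
proof -
  obtain w where w: "star w = w" "star b * b - star a * a = w * w" using assms by (auto simp: pos_def)
  have expand: "star (u - u * T) * (u - u * T) =
      (star u * u) - star T * (star u * u) - (star u * u) * T + star T * (star u * u) * T" for u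
    by (simp add: star_diff star_mult algebra_simps)
  have bb: "star b * b = star a * a + star w * w" using w by (simp add: algebra_simps)
  have "star (b - b * T) * (b - b * T) = star (a - a * T) * (a - a * T) + star (w - w * T) * (w - w * T)"
    unfolding expand bb by (simp add: algebra_simps)
  then have "norm (star (a - a * T) * (a - a * T)) \<le> norm (star (b - b * T) * (b - b * T))"
    by (simp add: pos_norm_mono pos_star_mult)
  then show ?thesis by (simp add: norm_star_mult_self power2_le_iff_abs_le)
qed

text \<open>The root b of the sum of all \<open>star a * a\<close> dominates every a in F, so a
  single self-adjoint element controls F and only a function of t has to be chosen. It is left open
  because it is chosen twice: once for norms alone, once with finite weight.\<close>

lemma ex_approx_generator:
  fixes F :: "'a::cstar_algebra set"
  assumes F: "finite F" and e: "e > 0"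
  shows "\<exists>r \<delta>. star r = r \<and> norm r < 1 \<and> \<delta> > 0 \<and>
    (\<forall>\<gamma>. czero \<gamma> \<longrightarrow> (\<forall>t. \<bar>t\<bar> \<le> 1 \<longrightarrow> \<bar>t - t * \<gamma> t\<bar> \<le> \<delta>) \<longrightarrow> (\<forall>a\<in>F. norm (a - a * cfc r \<gamma>) < e))"
proof -
  have "pos (\<Sum>a\<in>F. star a * a)" by (intro pos_sum pos_star_mult)
  then obtain b where b: "star b = b" "(\<Sum>a\<in>F. star a * a) = b * b" by (auto simp: pos_def)
  define K where "K = 1 + norm b"
  have K: "K > 0" by (simp add: K_def add_pos_nonneg)
  define r where "r = (1 / K) *\<^sub>R b"
  have r: "star r = r" "norm r < 1" using b K by (simp_all add: r_def) (simp add: K_def)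
  have br: "b = K *\<^sub>R r" using K by (simp add: r_def)
  define \<delta> where "\<delta> = e / (2 * K)"
  have \<delta>: "\<delta> > 0" using e K by (simp add: \<delta>_def)
  have "norm (a - a * cfc r \<gamma>) < e"
    if \<gamma>: "czero \<gamma>" "\<And>t. \<bar>t\<bar> \<le> 1 \<Longrightarrow> \<bar>t - t * \<gamma> t\<bar> \<le> \<delta>" and a: "a \<in> F" for \<gamma> a
  proof -
    have "star b * b - star a * a = (\<Sum>a\<in>F - {a}. star a * a)"
      by (simp add: b(1) sum_diff1 F a flip: b(2))
    then have "pos (star b * b - star a * a)" by (simp add: pos_sum pos_star_mult)
    then have "norm (a - a * cfc r \<gamma>) \<le> norm (b - b * cfc r \<gamma>)"
      by (rule norm_minus_mult_le_of_dominated)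
    also have "b - b * cfc r \<gamma> = K *\<^sub>R (r - r * cfc r \<gamma>)"
      by (simp add: br scaleR_right_diff_distrib)
    also have "r - r * cfc r \<gamma> = cfc r (\<lambda>t. t - t * \<gamma> t)"
      by (simp add: cfc_diff[OF r] cfc_mult[OF r] cfc_ident[OF r] czero_mult czero_ident \<gamma>(1))
    also have "norm (K *\<^sub>R \<dots>) \<le> K * \<delta>"
      using K norm_cfc_le[OF r czero_diff[OF czero_ident czero_mult[OF czero_ident \<gamma>(1)]] \<gamma>(2)]
      by (simp add: mult_left_mono)
    also have "\<dots> < e" using K e by (simp add: \<delta>_def)
    finally show ?thesis .
  qed
  then show ?thesis using r \<delta> by blast
qed

lemma ex_approx_unit:
  fixes F :: "'a::cstar_algebra set"
  assumes F: "finite F" and e: "e > 0"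
  shows "\<exists>c. star c = c \<and> norm c \<le> 1 \<and> (\<forall>a\<in>F. norm (a - a * c) < e)"
proof -
  obtain r \<delta> where r: "star r = r" "norm r < 1" and \<delta>: "\<delta> > 0" and
    approx: "\<And>\<gamma> a. czero \<gamma> \<Longrightarrow> (\<And>t. \<bar>t\<bar> \<le> 1 \<Longrightarrow> \<bar>t - t * \<gamma> t\<bar> \<le> \<delta>) \<Longrightarrow> a \<in> F \<Longrightarrow> norm (a - a * cfc r \<gamma>) < e"
    using ex_approx_generator[OF F e] by metis
  \<comment> \<open>The error t - t \<gamma>(t) is t \<delta>^2 / (t^2 + \<delta>^2), at most
    \<delta> in absolute value.\<close>
  define \<gamma> where "\<gamma> t = t\<^sup>2 / (t\<^sup>2 + \<delta>\<^sup>2)" for t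
  have nz: "t\<^sup>2 + \<delta>\<^sup>2 > 0" for t :: real using \<delta> by (simp add: add_nonneg_pos)
  have c\<gamma>: "czero \<gamma>" unfolding czero_def \<gamma>_def
    using nz by (auto intro!: continuous_intros simp: less_imp_neq[THEN not_sym])
  have "\<bar>\<gamma> t\<bar> \<le> 1" for t using nz[of t] \<delta> by (simp add: \<gamma>_def)
  then have "norm (cfc r \<gamma>) \<le> 1" by (intro norm_cfc_le[OF r c\<gamma>])
  moreover have "\<bar>t - t * \<gamma> t\<bar> \<le> \<delta>" for t
  proof -
    define S where "S = t\<^sup>2 + \<delta>\<^sup>2"
    have "t - t * (t\<^sup>2 / S) = t * (S - t\<^sup>2) / S"
      using nz[of t] by (simp add: S_def[symmetric] right_diff_distrib diff_divide_distrib)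
    then have "t - t * \<gamma> t = t * \<delta>\<^sup>2 / (t\<^sup>2 + \<delta>\<^sup>2)"
      by (simp add: \<gamma>_def S_def)
    moreover have "\<bar>t\<bar> * \<delta>\<^sup>2 \<le> \<delta> * (t\<^sup>2 + \<delta>\<^sup>2)"
    proof -
      have "0 \<le> (\<bar>t\<bar> - \<delta>)\<^sup>2 + \<bar>t\<bar> * \<delta>" using \<delta> by simp
      then have "\<bar>t\<bar> * \<delta> \<le> t\<^sup>2 + \<delta>\<^sup>2" by (simp add: power2_diff mult.commute)
      from mult_left_mono[OF this, of \<delta>] \<delta> show ?thesis by (simp add: power2_eq_square mult_ac)
    qed
    ultimately show ?thesis using nz[of t] by (simp add: abs_mult abs_divide divide_le_eq)
  qed
  then have "norm (a - a * cfc r \<gamma>) < e" if "a \<in> F" for a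
    using approx[OF c\<gamma>] that by blast
  ultimately show ?thesis using cfc_star[OF r c\<gamma>] by blast
qed

locale weight_hom = weight \<theta> for \<theta> :: "'b::cstar_algebra \<Rightarrow> ennreal" +
  fixes \<iota> :: "'a::cstar_algebra \<Rightarrow> 'b"
  assumes hom: "star_homomorphism \<iota>" and dense: "densely_defined \<theta>"
begin

lemma hom_simps:
  "\<iota> (x + y) = \<iota> x + \<iota> y" "\<iota> (c *\<^sub>C x) = c *\<^sub>C \<iota> x" "\<iota> (x * y) = \<iota> x * \<iota> y" "\<iota> (star x) = star (\<iota> x)"
  "\<iota> (r *\<^sub>R x) = r *\<^sub>R \<iota> x" "\<iota> (x - y) = \<iota> x - \<iota> y" "norm (\<iota> x) \<le> norm x"
proof -
  show *: "\<iota> (x + y) = \<iota> x + \<iota> y" for x y using hom by (simp add: star_homomorphism_def)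
  show "\<iota> (c *\<^sub>C x) = c *\<^sub>C \<iota> x" "\<iota> (x * y) = \<iota> x * \<iota> y" "\<iota> (star x) = star (\<iota> x)"
    "\<iota> (r *\<^sub>R x) = r *\<^sub>R \<iota> x"
    using hom by (simp_all add: star_homomorphism_def scaleR_eq_scaleC)
  show "\<iota> (x - y) = \<iota> x - \<iota> y" using *[of "x - y" y] by simp
  show "norm (\<iota> x) \<le> norm x" by (rule star_homomorphism_contractive[OF hom])
qed

text \<open>
  If \<open>f (b - \<epsilon>) f = g\<^sup>2\<close>, then \<open>f x f\<close> dominates \<open>g\<^sup>2\<close> for every \<open>x\<close> within distance \<open>\<epsilon>\<close> of \<open>b\<close>.
\<close>

lemma fin_of_spectral_cut:
  assumes v: "v \<in> fin" and close: "norm (star v * v - \<iota> b) < \<epsilon>"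
    and sa: "star b = b" "star f = f" "star g = g"
    and cut: "f * b * f - \<epsilon> *\<^sub>R (f * f) = g * g"
  shows "\<iota> g \<in> fin"
proof -
  have \<epsilon>: "\<epsilon> > 0" using close norm_ge_zero[of "star v * v - \<iota> b"] by linarith
  define z where "z = (1 / \<epsilon>) *\<^sub>R (\<iota> b - star v * v)"
  have "norm z < 1" using close \<epsilon> by (simp add: z_def norm_minus_commute)
  moreover have "star z = z" using sa by (simp add: z_def star_diff star_mult star_star flip: hom_simps)
  ultimately obtain s where s: "star s = s" "s + s = z + s * s" using root_of_one_minus by blast
  define F where "F = \<iota> f"
  have F: "star F = F" "star (\<iota> g) = \<iota> g" using sa by (simp_all add: F_def flip: hom_simps)
  \<comment> \<open>A root of \<epsilon> F (1 - z) F, from 1 - z = (1 - s)^2; this is the gap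
    between F (star v * v) F and the square of the image of g.\<close>
  define w where "w = sqrt \<epsilon> *\<^sub>R (F - s * F)"
  have ww: "star w * w = \<epsilon> *\<^sub>R (F * F) - F * (\<iota> b - star v * v) * F"
  proof -
    have "F * (s + s) * F = F * (z + s * s) * F" by (simp only: s(2))
    then have "star (F - s * F) * (F - s * F) = F * F - F * z * F"
      by (simp add: star_diff star_mult F s(1) algebra_simps)
    moreover have "star w * w = \<epsilon> *\<^sub>R (star (F - s * F) * (F - s * F))"
      using \<epsilon> by (simp add: w_def del: scaleR_right_diff_distrib)
    moreover have "\<epsilon> *\<^sub>R (F * z * F) = F * (\<iota> b - star v * v) * F"
      using \<epsilon> by (simp add: z_def del: scaleR_right_diff_distrib)
    ultimately show ?thesis by (simp add: scaleR_right_diff_distrib)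
  qed
  have "q (\<iota> g) \<le> q (\<iota> g) + q w" by simp
  also have "\<dots> = q (v * F) + q 0"
  proof (rule q_add_cong)
    have "\<iota> (f * b * f - \<epsilon> *\<^sub>R (f * f)) = \<iota> (g * g)" by (simp only: cut)
    then have "\<iota> g * \<iota> g = F * \<iota> b * F - \<epsilon> *\<^sub>R (F * F)" by (simp add: hom_simps F_def)
    then show "star (\<iota> g) * \<iota> g + star w * w = star (v * F) * (v * F) + star 0 * 0"
      by (simp add: ww F star_mult algebra_simps)
  qed
  finally show ?thesis using fin_right_mult[OF v, of F] by (simp add: fin_def)
qed

lemma ex_fin_near:
  assumes "\<epsilon> > 0"
  shows "\<exists>v\<in>fin. norm (star v * v - \<iota> (star a * a)) < \<epsilon>"
proof -
  have "\<iota> (star a * a) \<in> positive_cone" by (simp add: hom_simps)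
  then have "\<iota> (star a * a) \<in> closure {x \<in> positive_cone. \<theta> x < \<infinity>}"
    using dense by (auto simp: densely_defined_def)
  then obtain x where x: "x \<in> positive_cone" "\<theta> x < \<infinity>" "dist x (\<iota> (star a * a)) < \<epsilon>"
    using assms unfolding closure_approachable by blast
  then obtain v where "x = star v * v" by (auto simp: positive_cone_def)
  then show ?thesis using x by (intro bexI[of _ v]) (auto simp: fin_def q_def dist_norm)
qed

text \<open>A spectral cut by f makes g finite as soon as f^2 (t^2 - \<epsilon>) = g^2. Taking f =
  sqrt D gives g = D, and f = sqrt D / M^2 gives g = D / M^2. Their product (D / M)^2 lies between 0
  and 1 and equals 1 where D >= \<epsilon>.\<close>

lemma ex_finite_cutoff:
  assumes r: "star r = (r::'a)" "norm r < 1" and \<delta>: "\<delta> > 0"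
  shows "\<exists>\<kappa> h k. czero \<kappa> \<and> (\<forall>t. 0 \<le> \<kappa> t \<and> \<kappa> t \<le> 1) \<and> (\<forall>t. \<bar>t\<bar> \<le> 1 \<longrightarrow> \<bar>t - t * (\<kappa> t * \<kappa> t)\<bar> \<le> \<delta>) \<and>
    cfc r \<kappa> = h * k \<and> \<iota> h \<in> fin \<and> \<iota> k \<in> fin"
proof -
  \<comment> \<open>Makes t^2 < 2 \<epsilon>, the region where the cut-off falls short of 1, the
    interval |t| < \<delta>.\<close>
  define \<epsilon> where "\<epsilon> = \<delta>\<^sup>2 / 2"
  have \<epsilon>: "\<epsilon> > 0" using \<delta> by (simp add: \<epsilon>_def)
  define D M where "D t = max (t * t - \<epsilon>) 0" and "M t = max (D t) \<epsilon>" for t :: real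
  have M: "M t > 0" for t using \<epsilon> by (simp add: M_def less_max_iff_disj)
  then have M0: "M t \<noteq> 0" for t by (metis less_irrefl)
  have cont: "continuous_on {-1..1} D" "continuous_on {-1..1} M"
    unfolding D_def M_def by (intro continuous_intros)+
  have D0: "D 0 = 0" using \<epsilon> by (simp add: D_def)
  obtain v where v: "v \<in> fin" "norm (star v * v - \<iota> (r * r)) < \<epsilon>"
    using ex_fin_near[OF \<epsilon>, of r] r by auto
  have cut: "\<iota> (cfc r g) \<in> fin"
    if f: "czero f" and g: "czero g" and fg: "\<And>t. f t * (t * t) * f t - \<epsilon> * (f t * f t) = g t * g t" for f g
  proof (rule fin_of_spectral_cut[OF v])
    have rr: "r * r = cfc r (\<lambda>t. t * t)"
      by (simp add: cfc_mult[OF r] czero_ident cfc_ident[OF r])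
    have "cfc r f * (r * r) * cfc r f - \<epsilon> *\<^sub>R (cfc r f * cfc r f) = cfc r (\<lambda>t. f t * (t * t) * f t - \<epsilon> * (f t * f t))"
      unfolding rr by (simp add: cfc_mult[OF r] cfc_diff[OF r] cfc_scale[OF r] czero_mult czero_scale czero_ident f)
    also have "\<dots> = cfc r g * cfc r g" by (simp add: fg cfc_mult[OF r] g)
    finally show "cfc r f * (r * r) * cfc r f - \<epsilon> *\<^sub>R (cfc r f * cfc r f) = cfc r g * cfc r g" .
  qed (simp_all add: star_mult r cfc_star[OF r] f g)
  have sq: "sqrt (D t) * (t * t) * sqrt (D t) - \<epsilon> * (sqrt (D t) * sqrt (D t)) = D t * D t" for t
    by (auto simp: D_def max_def algebra_simps)
  have 1: "\<iota> (cfc r D) \<in> fin"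
  proof (rule cut[of "\<lambda>t. sqrt (D t)"])
    show "czero (\<lambda>t. sqrt (D t))" "czero D"
      by (auto simp: czero_def D0 intro!: continuous_intros cont)
  qed (rule sq)
  define N where "N t = D t / (M t * M t)" for t
  have cN: "czero N" using M0 by (auto simp: czero_def D0 N_def intro!: continuous_intros cont)
  have cD: "czero D" by (auto simp: czero_def D0 cont)
  have 2: "\<iota> (cfc r N) \<in> fin"
  proof (rule cut[of "\<lambda>t. sqrt (D t) / (M t * M t)"])
    show "czero (\<lambda>t. sqrt (D t) / (M t * M t))"
      using M0 by (auto simp: czero_def D0 intro!: continuous_intros cont)
    show "sqrt (D t) / (M t * M t) * (t * t) * (sqrt (D t) / (M t * M t))
        - \<epsilon> * (sqrt (D t) / (M t * M t) * (sqrt (D t) / (M t * M t))) = N t * N t" for t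
      using sq[of t] M0[of t] by (simp add: N_def field_simps)
  qed (rule cN)
  define \<kappa> where "\<kappa> t = D t * N t" for t
  have c\<kappa>: "czero \<kappa>" unfolding \<kappa>_def by (intro czero_mult cD cN)
  have D: "0 \<le> D t" "D t \<le> M t" for t by (simp_all add: D_def M_def)
  have \<kappa>: "0 \<le> \<kappa> t" "\<kappa> t \<le> 1" for t
    using D[of t] M[of t] mult_mono[OF D(2)[of t] D(2)[of t]] by (auto simp: \<kappa>_def N_def field_simps)
  have "\<bar>t - t * (\<kappa> t * \<kappa> t)\<bar> \<le> \<delta>" for t
  proof (cases "D t \<ge> \<epsilon>")
    case True
    then have "M t = D t" by (simp add: M_def)
    then have "\<kappa> t = 1" using M0[of t] by (simp add: \<kappa>_def N_def)
    then show ?thesis using \<delta> by simp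
  next
    case False
    then have "t * t - \<epsilon> < \<epsilon>" by (simp add: D_def)
    then have "t\<^sup>2 \<le> \<delta>\<^sup>2" by (simp add: \<epsilon>_def power2_eq_square)
    then have t: "\<bar>t\<bar> \<le> \<delta>" using \<delta> by (simp add: abs_le_square_iff[symmetric])
    have "0 \<le> \<kappa> t * \<kappa> t" "\<kappa> t * \<kappa> t \<le> 1" using \<kappa> by (simp_all add: mult_le_one)
    then have "\<bar>1 - \<kappa> t * \<kappa> t\<bar> \<le> 1" by linarith
    then have "\<bar>t\<bar> * \<bar>1 - \<kappa> t * \<kappa> t\<bar> \<le> \<bar>t\<bar> * 1" by (intro mult_left_mono) auto
    moreover have "\<bar>t - t * (\<kappa> t * \<kappa> t)\<bar> = \<bar>t\<bar> * \<bar>1 - \<kappa> t * \<kappa> t\<bar>"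
      by (simp add: right_diff_distrib flip: abs_mult)
    ultimately show ?thesis using t by linarith
  qed
  moreover have "cfc r \<kappa> = cfc r D * cfc r N" unfolding \<kappa>_def by (rule cfc_mult[OF r cD cN])
  ultimately show ?thesis using c\<kappa> \<kappa> 1 2 by blast
qed

text \<open>Left multiplication by c contracts q because 1 - c c = (1 - s)^2, and traciality turns
  left into right. The constant is exactly 1, which the strict bound in
  \<open>q_left_mult_le\<close> does not give when norm c is 1.\<close>

lemma q_mult_le_of_root:
  assumes "star (s::'b) = s" "star c = c" "s + s = c * c + s * s"
  shows "q (y * c) \<le> q y"
proof -
  define w where "w = star y"
  have "q (c * w) \<le> q (c * w) + q (w - s * w)" by simp
  also have "\<dots> = q w + q 0"
  proof (rule q_add_cong)
    have "star w * (s + s) * w = star w * (c * c + s * s) * w" by (simp only: assms(3))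
    then show "star (c * w) * (c * w) + star (w - s * w) * (w - s * w) = star w * w + star 0 * 0"
      by (simp add: star_mult star_diff assms(1,2) algebra_simps)
  qed
  finally show ?thesis using q_star[of "y * c"] q_star[of y] by (simp add: w_def star_mult assms(2))
qed

text \<open>The approximate unit is c c because c will enter from both sides, in (v c) star (v c) =
  v (c c) star v.\<close>

lemma ex_finite_approx_unit:
  assumes F: "finite F" and e: "e > 0"
  shows "\<exists>c h k. star c = (c::'a) \<and> norm (c * c) \<le> 1 \<and> c = h * k \<and> \<iota> h \<in> fin \<and> \<iota> k \<in> fin \<and>
    (\<forall>a\<in>F. norm (a - a * (c * c)) < e) \<and> (\<forall>y. q (y * \<iota> c) \<le> q y)"
proof -
  obtain r \<delta> where r: "star r = r" "norm r < 1" and \<delta>: "\<delta> > 0" and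
    approx: "\<And>\<gamma> a. czero \<gamma> \<Longrightarrow> (\<And>t. \<bar>t\<bar> \<le> 1 \<Longrightarrow> \<bar>t - t * \<gamma> t\<bar> \<le> \<delta>) \<Longrightarrow> a \<in> F \<Longrightarrow> norm (a - a * cfc r \<gamma>) < e"
    using ex_approx_generator[OF F e] by metis
  obtain \<kappa> h k where \<kappa>: "czero \<kappa>" "\<And>t. 0 \<le> \<kappa> t" "\<And>t. \<kappa> t \<le> 1"
    "\<And>t. \<bar>t\<bar> \<le> 1 \<Longrightarrow> \<bar>t - t * (\<kappa> t * \<kappa> t)\<bar> \<le> \<delta>" and hk: "cfc r \<kappa> = h * k" "\<iota> h \<in> fin" "\<iota> k \<in> fin"
    using ex_finite_cutoff[OF r \<delta>] by metis
  define c where "c = cfc r \<kappa>"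
  have c: "star c = c" by (simp add: c_def cfc_star[OF r \<kappa>(1)])
  have cc: "c * c = cfc r (\<lambda>t. \<kappa> t * \<kappa> t)" by (simp add: c_def cfc_mult[OF r] \<kappa>(1))
  have sq1: "\<kappa> t * \<kappa> t \<le> 1" for t using \<kappa>(2,3) by (simp add: mult_le_one)
  have "norm (c * c) \<le> 1"
    unfolding cc using sq1 by (intro norm_cfc_le[OF r] czero_mult \<kappa>) simp
  moreover have "norm (a - a * (c * c)) < e" if "a \<in> F" for a
    unfolding cc using that by (intro approx czero_mult \<kappa>)
  moreover have "q (y * \<iota> c) \<le> q y" for y
  proof -
    let ?f = "\<lambda>t. 1 - sqrt (1 - \<kappa> t * \<kappa> t)"
    have cz: "czero ?f" using \<kappa>(1) unfolding czero_def by (auto intro!: continuous_intros)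
    have "(\<lambda>t. ?f t + ?f t) = (\<lambda>t. \<kappa> t * \<kappa> t + ?f t * ?f t)"
    proof
      fix t
      have "sqrt (1 - \<kappa> t * \<kappa> t) * sqrt (1 - \<kappa> t * \<kappa> t) = 1 - \<kappa> t * \<kappa> t" using sq1[of t] by simp
      then show "?f t + ?f t = \<kappa> t * \<kappa> t + ?f t * ?f t" by (simp add: algebra_simps)
    qed
    then have "cfc r (\<lambda>t. ?f t + ?f t) = cfc r (\<lambda>t. \<kappa> t * \<kappa> t + ?f t * ?f t)" by simp
    then have "cfc r ?f + cfc r ?f = c * c + cfc r ?f * cfc r ?f"
      by (simp only: cfc_add[OF r] cfc_mult[OF r] cz czero_mult \<kappa>(1) c_def)
    then have "\<iota> (cfc r ?f + cfc r ?f) = \<iota> (c * c + cfc r ?f * cfc r ?f)" by (simp only:)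
    then show ?thesis
      using c cfc_star[OF r cz]
      by (intro q_mult_le_of_root[of "\<iota> (cfc r ?f)"]) (simp_all only: hom_simps(1,3) flip: hom_simps(4))
  qed
  ultimately show ?thesis using c hk unfolding c_def by blast
qed

end

section \<open>Unitaries of the central sequence algebra\<close>

text \<open>By separability the approximate units for finite sets combine into one sequence, whose
  n-th term serves an initial part of a dense sequence. Self-adjointness transfers the statement to
  the other side.\<close>

lemma ex_central_approx_unit:
  assumes "separable_space (euclidean :: 'a::cstar_algebra topology)"
  shows "\<exists>w :: nat \<Rightarrow> 'a. bounded_seq w \<and> (\<forall>a. null_seq (\<lambda>n. a * w n - a) \<and> null_seq (\<lambda>n. w n * a - a))"
proof -
  obtain C :: "'a set" where C: "countable C" "closure C = UNIV"
    using assms by (auto simp: separable_space_def)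
  then have "C \<noteq> {}" by auto
  then obtain d :: "nat \<Rightarrow> 'a" where d: "C = range d" using C(1) uncountable_def by blast
  define F where "F n = d ` {..n} \<union> star ` d ` {..n}" for n
  have "\<exists>c. star c = c \<and> norm c \<le> 1 \<and> (\<forall>a\<in>F n. norm (a - a * c) < 1 / (real n + 1))" for n
    by (rule ex_approx_unit) (auto simp: F_def)
  then obtain w where w: "\<And>n. star (w n) = w n" "\<And>n. norm (w n) \<le> 1"
    and wF: "\<And>n a. a \<in> F n \<Longrightarrow> norm (a - a * w n) < 1 / (real n + 1)" by metis
  have right: "null_seq (\<lambda>n. a * w n - a)" if "a \<in> closure (range d) \<union> closure (star ` range d)" for a
    unfolding null_seq_def
  proof (rule LIMSEQ_I)
    fix e :: real assume e: "e > 0"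
    have "\<exists>b\<in>range d \<union> star ` range d. dist b a < e / 3"
      using that e closure_approachable[of a "range d"] closure_approachable[of a "star ` range d"]
      by (metis Un_iff divide_pos_pos zero_less_numeral)
    then obtain b where b: "b \<in> range d \<union> star ` range d" "norm (b - a) < e / 3"
      by (auto simp: dist_norm)
    then obtain m where m: "\<And>n. n \<ge> m \<Longrightarrow> b \<in> F n" by (auto simp: F_def)
    obtain N where N: "\<And>n. n \<ge> N \<Longrightarrow> 1 / (real n + 1) < e / 3"
    proof -
      have "\<forall>\<^sub>F n in sequentially. 1 / (real n + 1) < e / 3" using e by real_asymp
      then show ?thesis using that by (auto simp: eventually_sequentially)
    qed
    have "norm (a * w n - a) < e" if n: "n \<ge> max m N" for n
    proof -
      have "norm ((a - b) * w n) \<le> norm (a - b) * 1"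
        using norm_mult_ineq[of "a - b" "w n"] w(2)[of n] by (meson mult_left_mono norm_ge_zero order_trans)
      then have "norm ((a - b) * w n) < e / 3" using b(2) by (simp add: norm_minus_commute)
      moreover have "norm (b - b * w n) < e / 3" using wF[OF m] N n by (meson max.bounded_iff order_less_trans)
      moreover have "norm (a * w n - a) \<le> norm ((a - b) * w n) + norm (b - b * w n) + norm (b - a)"
      proof -
        have eq: "a * w n - a = (a - b) * w n - (b - b * w n) + (b - a)" by (simp add: algebra_simps)
        show ?thesis
          unfolding eq using norm_triangle_ineq[of "(a - b) * w n - (b - b * w n)" "b - a"]
            norm_triangle_ineq4[of "(a - b) * w n" "b - b * w n"] by linarith
      qed
      ultimately show ?thesis using b(2) by linarith
    qed
    then show "\<exists>N. \<forall>n\<ge>N. norm (a * w n - a - 0) < e" unfolding diff_zero by blast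
  qed
  have r: "null_seq (\<lambda>n. a * w n - a)" for a using right C(2) d by simp
  have "null_seq (\<lambda>n. w n * a - a)" for a
    using null_seq_star[OF r[of "star a"]] by (simp add: star_diff star_mult star_star w(1))
  moreover have "bounded_seq w" using w(2) by (auto simp: bounded_seq_iff)
  ultimately show ?thesis using r by blast
qed

section \<open>Representatives of elements of the sequence algebras\<close>

lemma abs_ainf_eq_iff:
  "bounded_seq x \<Longrightarrow> bounded_seq y \<Longrightarrow> abs_ainf x = abs_ainf y \<longleftrightarrow> null_seq (\<lambda>n. x n - y n)"
  using Quotient3_rel[OF Quotient3_ainf, of x y] by (auto simp: seq_rel_def null_seq_def)

lemma abs_finf_eqD:
  "abs_finf x = abs_finf y \<Longrightarrow> x \<in> relative_commutant \<Longrightarrow> y \<in> relative_commutant \<Longrightarrow> x - y \<in> annihilator"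
  using Quotient3_rel[OF Quotient3_finf, of x y] by (auto simp: finf_rel_def annihilator_closed)

lemma ex_abs_ainf: "\<exists>z. bounded_seq z \<and> x = abs_ainf z"
  by (metis Quotient3_ainf Quotient3_abs_rep Quotient3_rep_reflp seq_rel_refl)

lemma ex_abs_finf: "\<exists>z. z \<in> relative_commutant \<and> u = abs_finf z"
  by (metis Quotient3_finf Quotient3_abs_rep Quotient3_rep_reflp finf_rel_refl)

text \<open>A unit of the quotient can only be tested on the relative commutant. The class W of an
  approximate unit lies there, and p W - W annihilates A while W a = a.\<close>

lemma unit_element_finf:
  fixes p :: "'a::cstar_algebra ainf"
  assumes sep: "separable_space (euclidean :: 'a topology)"
    and p: "p \<in> relative_commutant" and unit: "is_unit_element (abs_finf p)"
  shows "const_ainf a * p = const_ainf a"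
proof -
  obtain w :: "nat \<Rightarrow> 'a" where w: "bounded_seq w" "\<And>a. null_seq (\<lambda>n. a * w n - a)" "\<And>a. null_seq (\<lambda>n. w n * a - a)"
    using ex_central_approx_unit[OF sep] by blast
  define W where "W = abs_ainf w"
  have Wa: "W * const_ainf a = const_ainf a" "const_ainf a * W = const_ainf a" for a
    using w by (simp_all add: W_def const_ainf.abs_eq times_ainf.abs_eq seq_rel_refl abs_ainf_eq_iff bounded_seq_mult)
  then have W: "W \<in> relative_commutant" by (simp add: relative_commutant_def)
  have "abs_finf (p * W) = abs_finf W"
    using unit p W by (simp add: is_unit_element_def times_finf.abs_eq[symmetric] finf_rel_refl)
  then have "p * W - W \<in> annihilator"
    by (rule abs_finf_eqD) (simp_all add: relative_commutant_mult p W)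
  then have "(p * W - W) * const_ainf a = 0" by (simp add: annihilator_def)
  then have "p * const_ainf a = const_ainf a"
    by (simp add: left_diff_distrib mult.assoc Wa)
  then show ?thesis using p by (simp add: relative_commutant_def)
qed

text \<open>Equality in the central sequence algebra holds modulo the annihilator, so it becomes a
  norm limit only after multiplication by some a in A; the last three conclusions are of this
  kind.\<close>

lemma finf_unitary_sequence:
  fixes u :: "'a::cstar_algebra finf"
  assumes sep: "separable_space (euclidean :: 'a topology)" and u: "unitary u"
    and eig: "\<And>g. finf_map (\<alpha> g) u = \<eta> g *\<^sub>C u" and aut: "\<And>g. star_automorphism (\<alpha> g)"
  shows "\<exists>x. bounded_seq x \<and> (\<forall>a. null_seq (\<lambda>n. a * x n - x n * a)) \<and>
    (\<forall>a. null_seq (\<lambda>n. a * (star (x n) * x n) - a)) \<and> (\<forall>a. null_seq (\<lambda>n. a * (x n * star (x n)) - a)) \<and>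
    (\<forall>a g. null_seq (\<lambda>n. a * \<alpha> g (x n) - \<eta> g *\<^sub>C (a * x n)))"
proof -
  obtain X where X: "X \<in> relative_commutant" "u = abs_finf X" using ex_abs_finf by blast
  obtain x where x: "bounded_seq x" "X = abs_ainf x" using ex_abs_ainf by blast
  note rc = relative_commutant_closed relative_commutant_mult X(1)
  have hom: "star_homomorphism (\<alpha> g)" for g using aut by (simp add: star_automorphism_def)
  have sX: "star X = abs_ainf (\<lambda>n. star (x n))" using x by (simp add: star_ainf.abs_eq seq_rel_refl)
  note bs = bounded_seq_mult bounded_seq_star bounded_seq_scaleC x(1)
  note abs = const_ainf.abs_eq times_ainf.abs_eq seq_rel_refl abs_ainf_eq_iff bs
  have "null_seq (\<lambda>n. a * x n - x n * a)" for a
  proof -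
    have "const_ainf a * X = X * const_ainf a" using X(1) by (simp add: relative_commutant_def)
    then show ?thesis by (simp add: x(2) abs)
  qed
  moreover have "null_seq (\<lambda>n. a * (star (x n) * x n) - a)" for a
  proof -
    have "is_unit_element (abs_finf (star X * X))"
      using u X by (simp add: unitary_def star_finf.abs_eq times_finf.abs_eq finf_rel_refl rc)
    from unit_element_finf[OF sep _ this] have "const_ainf a * (star X * X) = const_ainf a" by (simp add: rc)
    then show ?thesis by (simp add: sX) (simp add: x(2) abs)
  qed
  moreover have "null_seq (\<lambda>n. a * (x n * star (x n)) - a)" for a
  proof -
    have "is_unit_element (abs_finf (X * star X))"
      using u X by (simp add: unitary_def star_finf.abs_eq times_finf.abs_eq finf_rel_refl rc)
    from unit_element_finf[OF sep _ this] have "const_ainf a * (X * star X) = const_ainf a" by (simp add: rc)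
    then show ?thesis by (simp add: sX) (simp add: x(2) abs)
  qed
  moreover have "null_seq (\<lambda>n. a * \<alpha> g (x n) - \<eta> g *\<^sub>C (a * x n))" for a g
  proof -
    let ?Y = "ainf_map (\<alpha> g) X"
    have bY: "bounded_seq (\<lambda>n. \<alpha> g (x n))"
      using seq_rel_map[OF hom, of x x] x(1) by (simp add: seq_rel_refl)
    have Y: "?Y = abs_ainf (\<lambda>n. \<alpha> g (x n))" using ainf_map_abs[OF hom x(1)] x(2) by simp
    have Yc: "?Y \<in> relative_commutant"
    proof -
      have surj: "\<exists>b. a = \<alpha> g b" for a using aut[of g] by (auto simp: star_automorphism_def bij_def surj_def)
      show ?thesis
        using X(1) surj unfolding relative_commutant_def mem_Collect_eq by (metis ainf_map_simps(2,3)[OF hom])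
    qed
    have "abs_finf ?Y = abs_finf (\<eta> g *\<^sub>C X)"
      using eig[of g] X by (simp add: finf_map_abs[OF aut] scaleC_finf.abs_eq finf_rel_refl)
    then have "?Y - \<eta> g *\<^sub>C X \<in> annihilator" by (rule abs_finf_eqD) (simp_all add: Yc rc)
    then have "const_ainf a * (?Y - \<eta> g *\<^sub>C X) = 0" by (simp add: annihilator_def)
    then have "const_ainf a * ?Y = const_ainf a * (\<eta> g *\<^sub>C X)" by (simp add: right_diff_distrib)
    then have "abs_ainf (\<lambda>n. a * \<alpha> g (x n)) = abs_ainf (\<lambda>n. a * (\<eta> g *\<^sub>C x n))"
      unfolding Y unfolding x(2) by (simp add: const_ainf.abs_eq times_ainf.abs_eq scaleC_ainf.abs_eq seq_rel_refl bs bY)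
    then show ?thesis by (simp add: abs_ainf_eq_iff bs bY mult_scaleC_right)
  qed
  ultimately show ?thesis using x(1) by blast
qed

section \<open>Traces on the crossed product\<close>

locale crossed =
  fixes \<alpha> :: "'g::ab_group_add \<Rightarrow> 'a::cstar_algebra \<Rightarrow> 'a"
    and j :: "('g \<Rightarrow>\<^sub>0 'a) \<Rightarrow> 'b::cstar_algebra"
  assumes act: "group_action \<alpha>" and cp: "crossed_product \<alpha> j"
begin

lemma aut: "star_automorphism (\<alpha> g)"
  using act by (simp add: group_action_def)

lemma \<alpha>_hom: "star_homomorphism (\<alpha> g)"
  using aut by (simp add: star_automorphism_def)

lemma \<alpha>_simps [simp]:
  "\<alpha> 0 a = a" "\<alpha> g 0 = 0"
  "\<alpha> g (a * b) = \<alpha> g a * \<alpha> g b" "\<alpha> g (a - b) = \<alpha> g a - \<alpha> g b" "\<alpha> g (\<alpha> (- g) a) = a"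
proof -
  have add: "\<alpha> g (a + b) = \<alpha> g a + \<alpha> g b" for a b using \<alpha>_hom[of g] by (simp add: star_homomorphism_def)
  show z: "\<alpha> 0 a = a" for a using act by (simp add: group_action_def)
  show "\<alpha> g 0 = 0" using add[of 0 0] by simp
  show "\<alpha> g (a * b) = \<alpha> g a * \<alpha> g b" using \<alpha>_hom[of g] by (simp add: star_homomorphism_def)
  show "\<alpha> g (a - b) = \<alpha> g a - \<alpha> g b" using add[of "a - b" b] by simp
  have "\<alpha> (g + - g) = \<alpha> g \<circ> \<alpha> (- g)" using act unfolding group_action_def by blast
  then have "\<alpha> g (\<alpha> (- g) a) = \<alpha> (g + - g) a" by (simp add: fun_eq_iff)
  then show "\<alpha> g (\<alpha> (- g) a) = a" by (simp add: z)
qed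

definition gen :: "'g \<Rightarrow> 'a \<Rightarrow> 'b" where
  "gen g a = j (Poly_Mapping.single g a)"

lemma j_simps:
  "j (f + h) = j f + j h" "j (cc_scale c f) = c *\<^sub>C j f" "j (cc_mult \<alpha> f h) = j f * j h"
  "j (cc_star \<alpha> f) = star (j f)" "norm (j f) = universal_norm \<alpha> f" "closure (range j) = UNIV"
  using cp by (auto simp: crossed_product_def)

lemma gen_add: "gen g (a + b) = gen g a + gen g b"
  by (simp add: gen_def single_add flip: j_simps)

lemma gen_diff: "gen g (a - b) = gen g a - gen g b"
  using gen_add[of g "a - b" b] by simp

lemma gen_scale: "gen g (c *\<^sub>C a) = c *\<^sub>C gen g a"
  by (simp add: gen_def cc_scale_def flip: j_simps(2))

lemma gen_mult: "gen g a * gen h b = gen (g + h) (a * \<alpha> g b)"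
proof -
  have "cc_mult \<alpha> (Poly_Mapping.single g a) (Poly_Mapping.single h b) = Poly_Mapping.single (g + h) (a * \<alpha> g b)"
    by (cases "a = 0"; cases "b = 0") (simp_all add: cc_mult_def)
  then show ?thesis by (simp add: gen_def flip: j_simps(3))
qed

lemma gen_star: "gen 0 (star a) = star (gen 0 a)"
proof -
  have "cc_star \<alpha> (Poly_Mapping.single 0 a) = Poly_Mapping.single 0 (star a)"
    by (cases "a = 0") (simp_all add: cc_star_def)
  then show ?thesis by (simp add: gen_def flip: j_simps(4))
qed

lemma embed_eq_gen: "cp_embed j = gen 0"
  by (simp add: cp_embed_def gen_def fun_eq_iff)

lemma embed_hom: "star_homomorphism (cp_embed j)"
  by (simp add: star_homomorphism_def embed_eq_gen gen_add gen_scale gen_mult gen_star)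

text \<open>The norm pulled back along j is itself a C*-seminorm, so the l1 bound applies to it and
  makes the generators contractive in their coefficient.\<close>

lemma cstar_seminorm_j: "cc_cstar_seminorm \<alpha> (\<lambda>f. norm (j f))"
  unfolding cc_cstar_seminorm_def
  by (simp only: j_simps(1-4) norm_scaleC norm_star_mult_self norm_mult_ineq norm_triangle_ineq norm_ge_zero) simp

lemma norm_gen_le: "norm (gen g a) \<le> norm a"
  using cc_cstar_seminorm_le[OF act cstar_seminorm_j, of "Poly_Mapping.single g a"]
  by (cases "a = 0") (simp_all add: gen_def)

lemma j_eq_sum: "j f = (\<Sum>g\<in>Poly_Mapping.keys f. gen g (Poly_Mapping.lookup f g))"
proof -
  have j0: "j 0 = 0" using j_simps(1)[of 0 0] by simp
  have jsum: "j (\<Sum>g\<in>F. k g) = (\<Sum>g\<in>F. j (k g))" for F :: "'g set" and k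
    by (induction F rule: infinite_finite_induct) (simp_all add: j0 j_simps)
  have "f = (\<Sum>g\<in>Poly_Mapping.keys f. Poly_Mapping.single g (Poly_Mapping.lookup f g))"
    by (rule poly_mapping_eqI) (simp add: lookup_sum lookup_single when_def in_keys_iff)
  then have "j f = j (\<Sum>g\<in>Poly_Mapping.keys f. Poly_Mapping.single g (Poly_Mapping.lookup f g))" by simp
  then show ?thesis by (simp add: jsum gen_def)
qed

end

locale crossed_weight = crossed \<alpha> j + weight_hom \<theta> "cp_embed j"
  for \<alpha> :: "'g::ab_group_add \<Rightarrow> 'a::cstar_algebra \<Rightarrow> 'a"
    and j :: "('g \<Rightarrow>\<^sub>0 'a) \<Rightarrow> 'b::cstar_algebra"
    and \<theta> :: "'b \<Rightarrow> ennreal"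
begin

abbreviation \<iota> :: "'a \<Rightarrow> 'b" where
  "\<iota> \<equiv> cp_embed j"

text \<open>
  The factorization \<open>c = h k\<close> makes commutators with \<open>c\<close> small in the norm of \<open>ip\<close>, not only in
  the norm of the algebra.
\<close>

lemma corner_functional_asymptotically_tracial:
  assumes x: "bounded_seq x" "\<And>a. null_seq (\<lambda>n. a * x n - x n * a)"
    and c: "star c = c" "c = h * k" "\<iota> h \<in> fin" "\<iota> k \<in> fin"
    and y: "bounded_seq y"
  shows "(\<lambda>n. corner_functional (\<iota> c) (\<iota> (x n) * y n) - corner_functional (\<iota> c) (y n * \<iota> (x n))) \<longlonglongrightarrow> 0"
proof -
  define C where "C = \<iota> c"
  have C: "C \<in> fin" "star C = C"
    using c by (simp_all add: C_def hom_simps fin_left_mult flip: hom_simps(4)) (metis c(1) hom_simps(4) hom_simps(3) c(2))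
  define U where "U n = \<iota> (x n)" for n
  define d where "d n = C * U n - U n * C" for n
  have dfin: "d n \<in> fin" for n by (simp add: d_def C fin_diff fin_left_mult fin_right_mult)
  \<comment> \<open>[h k, u] = h [k, u] + [h, u] k: in each term one factor has finite weight and is
    multiplied by a commutator that is small in norm.\<close>
  have d_le: "qr (d n) \<le> 2 * ((norm (k * x n - x n * k))\<^sup>2 * qr (\<iota> h)) + 2 * ((norm (h * x n - x n * h))\<^sup>2 * qr (\<iota> k))" for n
  proof -
    let ?a = "\<iota> h * \<iota> (k * x n - x n * k)" and ?b = "\<iota> (h * x n - x n * h) * \<iota> k"
    have "d n = ?a + ?b"
      by (simp add: d_def C_def U_def c(2) hom_simps algebra_simps)
    moreover have ab: "?a \<in> fin" "?b \<in> fin" by (simp_all add: fin_left_mult fin_right_mult c)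
    have "qr (?a + ?b) \<le> 2 * qr ?a + 2 * qr ?b"
      using qr_parallelogram[OF ab] qr_nonneg[of "?a - ?b"] by linarith
    ultimately have "qr (d n) \<le> 2 * qr ?a + 2 * qr ?b" by simp
    moreover have "qr ?a \<le> (norm (k * x n - x n * k))\<^sup>2 * qr (\<iota> h)"
      by (rule order_trans[OF qr_right_mult_le_norm[OF c(3)]])
        (intro mult_right_mono power_mono hom_simps(7) norm_ge_zero qr_nonneg)
    moreover have "qr ?b \<le> (norm (h * x n - x n * h))\<^sup>2 * qr (\<iota> k)"
      by (rule order_trans[OF qr_left_mult_le_norm[OF c(4)]])
        (intro mult_right_mono power_mono hom_simps(7) norm_ge_zero qr_nonneg)
    ultimately show ?thesis by linarith
  qed
  have "(\<lambda>n. 2 * ((norm (k * x n - x n * k))\<^sup>2 * qr (\<iota> h)) + 2 * ((norm (h * x n - x n * h))\<^sup>2 * qr (\<iota> k)))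
      \<longlonglongrightarrow> 2 * (0\<^sup>2 * qr (\<iota> h)) + 2 * (0\<^sup>2 * qr (\<iota> k))"
    using x(2)[of h] x(2)[of k] unfolding null_seq_norm_iff
    by (intro tendsto_add tendsto_mult tendsto_const tendsto_power)
  then have "(\<lambda>n. 2 * ((norm (k * x n - x n * k))\<^sup>2 * qr (\<iota> h)) + 2 * ((norm (h * x n - x n * h))\<^sup>2 * qr (\<iota> k))) \<longlonglongrightarrow> 0"
    by simp
  then have "(\<lambda>n. qr (d n)) \<longlonglongrightarrow> 0"
    by (rule tendsto_sandwich[OF _ _ tendsto_const, rotated 2]) (auto simp: d_le)
  then have sd: "(\<lambda>n. sqrt (qr (d n))) \<longlonglongrightarrow> 0"
    using tendsto_real_sqrt by fastforce
  obtain K where K: "\<And>n. norm (y n) \<le> K" using y by (auto simp: bounded_seq_iff)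
  have K0: "0 \<le> K" using K[of 0] norm_ge_zero[of "y 0"] by linarith
  have yC: "sqrt (qr (y' * C)) \<le> K * sqrt (qr C)" if "norm y' \<le> K" for y'
  proof -
    have "qr (y' * C) \<le> K\<^sup>2 * qr C"
      using qr_left_mult_le_norm[OF C(1), of y'] power_mono[OF that, of 2] qr_nonneg[of C]
      by (meson mult_right_mono norm_ge_zero order_trans)
    then have "sqrt (qr (y' * C)) \<le> sqrt (K\<^sup>2 * qr C)" by simp
    then show ?thesis using K0 by (simp add: real_sqrt_mult)
  qed
  have bound: "norm (corner_functional C (U n * y n) - corner_functional C (y n * U n)) \<le> 2 * (sqrt (qr (d n)) * (K * sqrt (qr C)))" for n
  proof -
    let ?y = "y n" and ?U = "U n"
    note fins = C(1) fin_left_mult fin_right_mult fin_diff fin_star dfin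
    \<comment> \<open>U is taken to the other argument, past C, back again, and past C once more;
      each passage past C costs one inner product with \<open>d n\<close>.\<close>
    have "corner_functional C (?U * ?y) = ip (star ?U * C) (?y * C)"
      by (simp add: corner_functional_def ip_left_mult fins star_star mult.assoc)
    also have "star ?U * C = star (d n) + C * star ?U"
      by (simp add: d_def star_diff star_mult C(2))
    also have "ip \<dots> (?y * C) = ip (star (d n)) (?y * C) + ip (C * star ?U) (?y * C)"
      using ip_add_right[of "?y * C" "star (d n)" "C * star ?U"] by (simp add: ip_commute fins)
    also have "ip (C * star ?U) (?y * C) = ip C (?y * C * ?U)"
      by (simp add: ip_right_mult fins star_star)
    also have "?y * C * ?U = ?y * d n + ?y * ?U * C"
      by (simp add: d_def algebra_simps)
    also have "ip C \<dots> = ip C (?y * d n) + corner_functional C (?y * ?U)"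
      by (simp add: ip_add_right fins corner_functional_def)
    also have "ip C (?y * d n) = ip (star ?y * C) (d n)"
      by (simp add: ip_left_mult fins star_star)
    finally have eq: "corner_functional C (?U * ?y) - corner_functional C (?y * ?U) = ip (star (d n)) (?y * C) + ip (star ?y * C) (d n)"
      by simp
    have "\<bar>ip (star (d n)) (?y * C)\<bar> \<le> sqrt (qr (d n)) * (K * sqrt (qr C))"
      using abs_ip_le_sqrt[of "star (d n)" "?y * C"] yC[OF K[of n]]
      by (simp add: fins qr_star) (meson mult_left_mono order_trans qr_nonneg real_sqrt_ge_zero)
    moreover have "\<bar>ip (star ?y * C) (d n)\<bar> \<le> sqrt (qr (d n)) * (K * sqrt (qr C))"
      using abs_ip_le_sqrt[of "d n" "star ?y * C"] yC[of "star ?y"] K[of n] ip_commute[of "star ?y * C" "d n"]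
      by (simp add: fins) (meson mult_left_mono order_trans qr_nonneg real_sqrt_ge_zero)
    ultimately show ?thesis unfolding eq real_norm_def by linarith
  qed
  have "(\<lambda>n. 2 * (sqrt (qr (d n)) * (K * sqrt (qr C)))) \<longlonglongrightarrow> 0"
    by (rule tendsto_eq_intros sd refl | simp)+
  then have "(\<lambda>n. corner_functional C (U n * y n) - corner_functional C (y n * U n)) \<longlonglongrightarrow> 0"
    by (rule Lim_null_comparison[OF always_eventually[OF allI[OF bound]]])
  then show ?thesis by (simp add: C_def U_def)
qed

lemma corner_functional_null:
  assumes "C \<in> fin" "null_seq z"
  shows "(\<lambda>n. corner_functional C (z n)) \<longlonglongrightarrow> 0"
proof (rule Lim_null_comparison)
  show "\<forall>\<^sub>F n in sequentially. norm (corner_functional C (z n)) \<le> norm (z n) * qr C"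
    using abs_corner_functional_le[OF assms(1)] by simp
  show "(\<lambda>n. norm (z n) * qr C) \<longlonglongrightarrow> 0"
    using assms(2) unfolding null_seq_norm_iff by (rule tendsto_mult_left_zero)
qed

lemma null_seq_gen: "null_seq z \<Longrightarrow> null_seq (\<lambda>n. gen g (z n))"
  unfolding null_seq_norm_iff
  by (rule tendsto_sandwich[OF _ _ tendsto_const]) (auto simp: norm_gen_le)

lemma corner_functional_gen_eq_0:
  assumes sep: "separable_space (euclidean :: 'a topology)" and rok: "abelian_Rokhlin \<alpha>"
    and c: "star c = c" "c = h * k" "\<iota> h \<in> fin" "\<iota> k \<in> fin"
    and g: "g \<noteq> 0"
  shows "corner_functional (\<iota> c) (gen g a) = 0"
proof -
  obtain \<eta> where \<eta>: "\<eta> \<in> dual_group" "\<eta> g \<noteq> 1" using dual_group_separates[OF g] by blast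
  then obtain u :: "'a finf" where "unitary u" "\<And>g. finf_map (\<alpha> g) u = \<eta> g *\<^sub>C u"
    using rok by (auto simp: abelian_Rokhlin_def)
  from finf_unitary_sequence[of u \<alpha> \<eta>, OF sep this aut] obtain x where x: "bounded_seq x"
    "\<And>a. null_seq (\<lambda>n. a * x n - x n * a)" "\<And>a. null_seq (\<lambda>n. a * (star (x n) * x n) - a)"
    "\<And>a. null_seq (\<lambda>n. a * (x n * star (x n)) - a)"
    "\<And>a g. null_seq (\<lambda>n. a * \<alpha> g (x n) - \<eta> g *\<^sub>C (a * x n))" by blast
  define C where "C = \<iota> c"
  have C: "C \<in> fin" by (simp add: C_def c(2) hom_simps fin_left_mult c)
  have inv: "corner_functional C (gen g a) = corner_functional C (\<eta> g *\<^sub>C gen g a)" for a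
  proof -
    let ?z = "gen g a"
    define y where "y n = star (\<iota> (x n)) * ?z" for n
    have y: "y n = gen g (star (x n) * a)" for n
      by (simp add: y_def embed_eq_gen gen_mult flip: gen_star)
    obtain K where K: "\<And>n. norm (x n) \<le> K" using x(1) by (auto simp: bounded_seq_iff)
    have "bounded_seq y"
    proof -
      have "norm (y n) \<le> K * norm a" for n
        unfolding y using norm_gen_le[of g "star (x n) * a"] norm_mult_ineq[of "star (x n)" a] K[of n]
        by (smt (verit) mult_right_mono norm_ge_zero norm_star)
      then show ?thesis by (auto simp: bounded_seq_iff)
    qed
    from corner_functional_asymptotically_tracial[OF x(1,2) c this]
    have 1: "(\<lambda>n. corner_functional C (\<iota> (x n) * y n) - corner_functional C (y n * \<iota> (x n))) \<longlonglongrightarrow> 0" by (simp add: C_def)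
    have "null_seq (\<lambda>n. x n * star (x n) * a - a)"
      using null_seq_star[OF x(4)[of "star a"]] by (simp add: star_diff star_mult star_star mult.assoc)
    from null_seq_gen[OF this, of g] have "null_seq (\<lambda>n. \<iota> (x n) * y n - ?z)"
      by (simp add: y embed_eq_gen gen_mult gen_diff mult.assoc)
    from corner_functional_null[OF C this] have 2: "(\<lambda>n. corner_functional C (\<iota> (x n) * y n) - corner_functional C ?z) \<longlonglongrightarrow> 0"
      by (simp add: corner_functional_diff C)
    \<comment> \<open>The summands replace \<alpha> g (x n) by \<eta> g times x n, move x n past a,
      and cancel \<open>star (x n) * x n\<close>.\<close>
    have "null_seq (\<lambda>n. star (x n) * (a * \<alpha> g (x n) - \<eta> g *\<^sub>C (a * x n)) + \<eta> g *\<^sub>C (star (x n) * (a * x n - x n * a)) +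
        \<eta> g *\<^sub>C (star (x n) * x n * a - a))"
    proof (intro null_seq_add null_seq_scaleC null_seq_mult_left bounded_seq_star x)
      show "null_seq (\<lambda>n. star (x n) * x n * a - a)"
        using null_seq_star[OF x(3)[of "star a"]] by (simp add: star_diff star_mult star_star mult.assoc)
    qed
    moreover have "star (x n) * (a * \<alpha> g (x n) - \<eta> g *\<^sub>C (a * x n)) + \<eta> g *\<^sub>C (star (x n) * (a * x n - x n * a)) +
        \<eta> g *\<^sub>C (star (x n) * x n * a - a) = star (x n) * a * \<alpha> g (x n) - \<eta> g *\<^sub>C a" for n
      by (simp add: right_diff_distrib scaleC_diff_right mult_scaleC_right mult.assoc)
    ultimately have "null_seq (\<lambda>n. star (x n) * a * \<alpha> g (x n) - \<eta> g *\<^sub>C a)" by simp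
    from null_seq_gen[OF this, of g] have "null_seq (\<lambda>n. y n * \<iota> (x n) - \<eta> g *\<^sub>C ?z)"
      by (simp add: y embed_eq_gen gen_mult gen_diff gen_scale)
    from corner_functional_null[OF C this] have 3: "(\<lambda>n. corner_functional C (y n * \<iota> (x n)) - corner_functional C (\<eta> g *\<^sub>C ?z)) \<longlonglongrightarrow> 0"
      by (simp add: corner_functional_diff C)
    from tendsto_diff[OF tendsto_add[OF 1 3] 2]
    have "(\<lambda>n. corner_functional C ?z - corner_functional C (\<eta> g *\<^sub>C ?z)) \<longlonglongrightarrow> 0" by simp
    then show ?thesis by (simp add: LIMSEQ_const_iff)
  qed
  \<comment> \<open>As \<eta> g is not 1, every a has the form b - \<eta> g b.\<close>
  define b where "b = (1 / (1 - \<eta> g)) *\<^sub>C a"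
  have "gen g a = gen g b - \<eta> g *\<^sub>C gen g b"
  proof -
    have "b = \<eta> g *\<^sub>C b + (1 - \<eta> g) *\<^sub>C b"
      using scaleC_add_left[of "\<eta> g" "1 - \<eta> g" b] by (simp add: scaleC_one)
    then have "gen g b = gen g (\<eta> g *\<^sub>C b) + gen g ((1 - \<eta> g) *\<^sub>C b)" by (metis gen_add)
    then have "gen g b - \<eta> g *\<^sub>C gen g b = gen g ((1 - \<eta> g) *\<^sub>C b)"
      unfolding gen_scale by (metis add_diff_cancel_left')
    also have "(1 - \<eta> g) *\<^sub>C b = a" using \<eta>(2) by (simp add: b_def scaleC_scaleC scaleC_one)
    finally show ?thesis ..
  qed
  then show ?thesis using inv[of b] C by (simp add: corner_functional_diff C_def)
qed

text \<open>The difference of the two sides is additive and norm bounded in x and vanishes on the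
  generators, whose span is dense.\<close>

lemma corner_functional_eq_expectation:
  assumes sep: "separable_space (euclidean :: 'a topology)" and rok: "abelian_Rokhlin \<alpha>"
    and E: "canonical_expectation j E"
    and c: "star c = c" "c = h * k" "\<iota> h \<in> fin" "\<iota> k \<in> fin"
  shows "corner_functional (\<iota> c) x = corner_functional (\<iota> c) (\<iota> (E x))"
proof -
  define C where "C = \<iota> c"
  have C: "C \<in> fin" by (simp add: C_def c(2) hom_simps fin_left_mult c)
  have Eadd: "E (x + y) = E x + E y" and Enorm: "norm (E x) \<le> norm x" for x y
    using E by (auto simp: canonical_expectation_def conditional_expectation_def)
  have Egen: "E (gen g a) = (if g = 0 then a else 0)" for g a
    using E by (simp add: canonical_expectation_def gen_def)
  have Ediff: "E (x - y) = E x - E y" for x y using Eadd[of "x - y" y] by simp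
  have E0: "E 0 = 0" using Ediff[of 0 0] by simp
  have Esum: "E (\<Sum>i\<in>I. f i) = (\<Sum>i\<in>I. E (f i))" for I :: "'g set" and f
    by (induction I rule: infinite_finite_induct) (simp_all add: E0 Eadd)
  define T where "T x = corner_functional C (x - \<iota> (E x))" for x
  have Tdiff: "T (x - y) = T x - T y" for x y
    by (simp add: T_def Ediff hom_simps C corner_functional_diff)
  have "\<iota> 0 = 0" using hom_simps(6)[of 0 0] by simp
  then have Tgen: "T (gen g a) = 0" for g a
    using corner_functional_gen_eq_0[OF sep rok c, of g a, folded C_def]
    by (auto simp: T_def Egen C corner_functional_zero embed_eq_gen)
  have Tadd: "T (x + y) = T x + T y" for x y using Tdiff[of "x + y" y] by simp
  have T0: "T 0 = 0" using Tdiff[of 0 0] by simp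
  have Tsum: "T (\<Sum>i\<in>I. f i) = (\<Sum>i\<in>I. T (f i))" for I :: "'g set" and f
    by (induction I rule: infinite_finite_induct) (simp_all add: T0 Tadd)
  have Tj: "T (j f) = 0" for f by (simp only: j_eq_sum[of f] Tsum Tgen sum.neutral_const)
  have "\<bar>T x\<bar> \<le> e" if e: "e > 0" for e
  proof -
    define Q where "Q = qr C + 1"
    define d where "d = e / (2 * Q)"
    have q1: "Q > 0" using qr_nonneg[of C] unfolding Q_def by linarith
    have d: "d > 0" using e q1 by (simp add: d_def)
    have "x \<in> closure (range j)" by (simp add: j_simps)
    then obtain f where f: "norm (x - j f) < d"
      using d unfolding closure_approachable by (auto simp: dist_norm norm_minus_commute)
    have "\<bar>T (x - j f)\<bar> \<le> norm ((x - j f) - \<iota> (E (x - j f))) * qr C"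
      unfolding T_def by (rule abs_corner_functional_le[OF C])
    also have "\<dots> \<le> (2 * d) * qr C"
    proof (rule mult_right_mono)
      have "norm (\<iota> (E (x - j f))) \<le> norm (x - j f)"
        using hom_simps(7) Enorm order_trans by blast
      then show "norm ((x - j f) - \<iota> (E (x - j f))) \<le> 2 * d"
        using norm_triangle_ineq4[of "x - j f" "\<iota> (E (x - j f))"] f by linarith
    qed simp
    also have "\<dots> \<le> (2 * d) * Q" using d by (simp add: Q_def)
    also have "\<dots> = e" using q1 by (simp add: d_def)
    finally show ?thesis by (simp add: Tdiff Tj)
  qed
  then have "T x = 0" by (metis abs_ge_zero abs_le_zero_iff dense_ge order.refl)
  then show ?thesis by (simp add: T_def C_def[symmetric] corner_functional_diff C)
qed

text \<open>A generator twists what is moved through it: a \<lambda>_g times c c is a \<alpha>_g(c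
  c) \<lambda>_g. So c c has to be an approximate unit for the elements \<alpha>_(-g)(a), where a
  runs over the coefficients of an approximant of v.\<close>

lemma ex_finite_approx_unit_crossed:
  assumes e: "e > 0"
  shows "\<exists>c h k. star c = c \<and> c = h * k \<and> \<iota> h \<in> fin \<and> \<iota> k \<in> fin \<and>
    norm (v - v * \<iota> (c * c)) < e \<and> (\<forall>y. q (y * \<iota> c) \<le> q y)"
proof -
  have "v \<in> closure (range j)" by (simp add: j_simps)
  then obtain f where f: "norm (v - j f) < e / 4"
    using e unfolding closure_approachable by (metis dist_norm norm_minus_commute divide_pos_pos zero_less_numeral imageE)
  let ?K = "Poly_Mapping.keys f" and ?a = "Poly_Mapping.lookup f"
  define d where "d = e / (4 * (real (card ?K) + 1))"
  have d: "d > 0" using e by (simp add: d_def add_nonneg_pos)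
  obtain c h k where c: "star c = c" "norm (c * c) \<le> 1" "c = h * k" "\<iota> h \<in> fin" "\<iota> k \<in> fin"
    "\<And>y. q (y * \<iota> c) \<le> q y"
    and approx: "\<And>g. g \<in> ?K \<Longrightarrow> norm (\<alpha> (- g) (?a g) - \<alpha> (- g) (?a g) * (c * c)) < d"
    using ex_finite_approx_unit[of "(\<lambda>g. \<alpha> (- g) (?a g)) ` ?K" d] d by auto
  have "norm (gen g (?a g) - gen g (?a g) * \<iota> (c * c)) \<le> d" if "g \<in> ?K" for g
  proof -
    have "gen g (?a g) - gen g (?a g) * \<iota> (c * c) = gen g (\<alpha> g (\<alpha> (- g) (?a g) - \<alpha> (- g) (?a g) * (c * c)))"
      by (simp add: embed_eq_gen gen_mult gen_diff)
    also have "norm \<dots> \<le> norm (\<alpha> (- g) (?a g) - \<alpha> (- g) (?a g) * (c * c))"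
      using norm_gen_le star_homomorphism_contractive[OF \<alpha>_hom] order_trans by blast
    finally show ?thesis using approx[OF that] by linarith
  qed
  then have "norm (\<Sum>g\<in>?K. gen g (?a g) - gen g (?a g) * \<iota> (c * c)) \<le> real (card ?K) * d"
    by (rule sum_norm_bound)
  moreover have "(\<Sum>g\<in>?K. gen g (?a g) - gen g (?a g) * \<iota> (c * c)) = j f - j f * \<iota> (c * c)"
    by (simp only: j_eq_sum[of f] sum_subtractf sum_distrib_right)
  moreover have "real (card ?K) * d \<le> e / 4"
    using e by (simp add: d_def field_simps)
  ultimately have jf: "norm (j f - j f * \<iota> (c * c)) \<le> e / 4" by simp
  have "norm ((v - j f) * \<iota> (c * c)) \<le> norm (v - j f) * 1"
    using norm_mult_ineq[of "v - j f" "\<iota> (c * c)"] hom_simps(7)[of "c * c"] c(2)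
    by (meson mult_left_mono norm_ge_zero order_trans)
  moreover have "norm (v - v * \<iota> (c * c)) \<le> norm (v - j f) + norm (j f - j f * \<iota> (c * c)) + norm ((v - j f) * \<iota> (c * c))"
  proof -
    have eq: "v - v * \<iota> (c * c) = (v - j f) + (j f - j f * \<iota> (c * c)) - (v - j f) * \<iota> (c * c)"
      by (simp add: algebra_simps)
    show ?thesis
      unfolding eq using norm_triangle_ineq4[of "(v - j f) + (j f - j f * \<iota> (c * c))" "(v - j f) * \<iota> (c * c)"]
        norm_triangle_ineq[of "v - j f" "j f - j f * \<iota> (c * c)"] by linarith
  qed
  ultimately have "norm (v - v * \<iota> (c * c)) < e" using f jf e by linarith
  then show ?thesis using c by blast
qed

text \<open>By traciality q v can be read at v star v, where cut-offs enter in the middle: v c c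
  star v approximates v star v and has weight q (v c) = q (w c) <= q w. Lower semicontinuity carries
  the bound to the limit.\<close>

lemma q_le_of_cutoffs_agree:
  assumes lsc: "lower_semicontinuous \<theta>"
    and agree: "\<And>c h k. star c = c \<Longrightarrow> c = h * k \<Longrightarrow> \<iota> h \<in> fin \<Longrightarrow> \<iota> k \<in> fin \<Longrightarrow> q (v * \<iota> c) = q (w * \<iota> c)"
  shows "q v \<le> q w"
proof -
  let ?S = "{y \<in> positive_cone. \<theta> y \<le> q w}"
  have cone: "y * star y \<in> positive_cone" for y :: 'b
    using star_mult_in_cone[of "star y"] by (simp add: star_star)
  have qv: "\<theta> (y * star y) = q y" for y using q_star[of y] by (simp add: q_def star_star)
  have "v * star v \<in> closure ?S"
    unfolding closure_approachable
  proof (intro allI impI)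
    fix e :: real assume e: "e > 0"
    define d where "d = e / (norm v + 1)"
    have d: "d > 0" using e by (simp add: d_def add_nonneg_pos)
    obtain c h k where c: "star c = c" "c = h * k" "\<iota> h \<in> fin" "\<iota> k \<in> fin"
      and approx: "norm (v - v * \<iota> (c * c)) < d" and le: "\<And>y. q (y * \<iota> c) \<le> q y"
      using ex_finite_approx_unit_crossed[OF d] by metis
    let ?y = "v * \<iota> c"
    have "\<theta> (?y * star ?y) \<le> q w" using agree[OF c] le[of w] by (simp add: qv)
    moreover have "dist (?y * star ?y) (v * star v) < e"
    proof -
      have "star (\<iota> c) = \<iota> c" by (simp add: c(1) flip: hom_simps(4))
      then have "v * star v - ?y * star ?y = (v - v * \<iota> (c * c)) * star v"
        by (simp add: star_mult hom_simps algebra_simps)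
      then have "dist (?y * star ?y) (v * star v) \<le> norm (v - v * \<iota> (c * c)) * norm v"
        using norm_mult_ineq[of "v - v * \<iota> (c * c)" "star v"] by (simp add: dist_norm norm_minus_commute)
      also have "\<dots> \<le> d * norm v" using approx by (intro mult_right_mono) auto
      also have "\<dots> < d * (norm v + 1)" using d by simp
      also have "\<dots> = e" using norm_ge_zero[of v] by (simp add: d_def add_nonneg_eq_0_iff)
      finally show ?thesis .
    qed
    ultimately show "\<exists>y\<in>?S. dist y (v * star v) < e" using cone by blast
  qed
  moreover obtain T where "closed T" "?S = positive_cone \<inter> T"
    using lsc unfolding lower_semicontinuous_def closedin_closed by metis
  ultimately have "v * star v \<in> T" by (metis closure_minimal inf_le2 subsetD)
  then have "v * star v \<in> ?S" using \<open>?S = _\<close> cone by blast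
  then show ?thesis by (simp add: qv)
qed

end

theorem theoremC:
  fixes \<alpha> :: "'g::{ab_group_add, countable} \<Rightarrow> 'a::cstar_algebra \<Rightarrow> 'a"
    and j :: "('g \<Rightarrow>\<^sub>0 'a) \<Rightarrow> 'b::cstar_algebra"
    and E :: "'b \<Rightarrow> 'a"
    and \<theta> :: "'b \<Rightarrow> ennreal"
  assumes "separable_space (euclidean :: 'a topology)"
    and "group_action \<alpha>"
    and "abelian_Rokhlin \<alpha>"
    and "crossed_product \<alpha> j"
    and "canonical_expectation j E"
    and "tracial_weight \<theta>"
    and "densely_defined \<theta>"
    and "lower_semicontinuous \<theta>"
  shows "\<forall>x\<in>positive_cone. \<theta> x = \<theta> (cp_embed j (E x))"
proof
  interpret crossed \<alpha> j by standard (rule assms)+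
  interpret crossed_weight \<alpha> j \<theta> by standard (rule assms embed_hom)+
  fix x :: 'b assume x: "x \<in> positive_cone"
  then obtain v where v: "x = star v * v" by (auto simp: positive_cone_def)
  have "E x \<in> positive_cone"
    using assms(5) x by (simp add: canonical_expectation_def conditional_expectation_def)
  then obtain b where b: "E x = star b * b" by (auto simp: positive_cone_def)
  define w where "w = cp_embed j b"
  have w: "cp_embed j (E x) = star w * w" by (simp add: b w_def hom_simps)
  have agree: "q (v * cp_embed j c) = q (w * cp_embed j c)"
    if c: "star c = c" "c = h * k" "cp_embed j h \<in> fin" "cp_embed j k \<in> fin" for c h k
  proof -
    have C: "cp_embed j c \<in> fin" by (simp add: c(2) hom_simps fin_left_mult c)
    have "corner_functional (cp_embed j c) (star v * v) = corner_functional (cp_embed j c) (star w * w)"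
      using corner_functional_eq_expectation[OF assms(1,3,5) c, of x] by (simp add: v[symmetric] w)
    then show ?thesis by (simp add: corner_functional_star_mult C q_eq_qr fin_left_mult)
  qed
  \<comment> \<open>Agreement of the cut-offs is symmetric in v and w, so both inequalities follow,
    infinite values included.\<close>
  have "q v = q w"
    using q_le_of_cutoffs_agree[OF assms(8) agree] q_le_of_cutoffs_agree[OF assms(8) agree[symmetric]]
    by (rule antisym)
  then show "\<theta> x = \<theta> (cp_embed j (E x))" unfolding w unfolding v q_def .
qed

end
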